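(* Let $\varphi$ be a minimal counterexample to Vaught's conjecture, and let $\lambda\in S^\circ=\mathfrak F\cap C_{5.3}\cap(\mathrm{qr}(\varphi),\omega_1)$ with $T_\lambda$, $B_\lambda$ as described in the context. Any two countable models $M,M'$ of $T_\lambda$ with $\omega_1^M=\omega_1^{M'}=\lambda$ which each realize every $n$-type of $T_\lambda$ (all $n\ge1$) are isomorphic. Moreover $B_\lambda$ realizes every $n$-type of $T_\lambda$ and $\omega_1^{B_\lambda}=\lambda$; hence $B_\lambda$ is, up to isomorphism, the unique model of $T_\lambda$ with $\omega_1=\lambda$ that realizes every $n$-type of $T_\lambda$.
   Context: Structures are countable structures in a countable vocabulary; classes of models are counted up to isomorphism. $\Sigma^{\mathrm{in}}_0=\Pi^{\mathrm{in}}_0$ is the set of finitary quantifier-free formulas; for $\alpha>0$, $\Sigma^{\mathrm{in}}_\alpha$ consists of countable disjunctions of formulas $\exists\bar x\,\psi$ with $\psi\in\Pi^{\mathrm{in}}_\beta$, $\beta<\alpha$, and $\Pi^{\mathrm{in}}_\alpha$ is dual. $M\equiv_\alpha N$: $M,N$ satisfy the same $\Pi^{\mathrm{in}}_\alpha$ (equivalently $\Sigma^{\mathrm{in}}_\alpha$) sentences. A Scott sentence of $M$ is an $L_{\omega_1\omega}$ sentence whose countable models are exactly the copies of $M$. $\mathrm{cSR}(M)$: the least $\alpha$ such that $M$ has a $\Pi^{\mathrm{in}}_{\alpha+1}$ Scott sentence. $\omega_1^A=\min\{\omega_1^X: X\in 2^\omega\text{ computes a copy of }A\}$. $\mathrm{qr}(S)$: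 the least $\beta$ with $S\in\Pi^{\mathrm{in}}_\beta\cup\Sigma^{\mathrm{in}}_\beta$. Standing hypotheses: Vaught's conjecture fails, and $\varphi$ is a minimal counterexample: an $L_{\omega_1\omega}$ sentence with exactly $\aleph_1$ countable models up to isomorphism, scattered (for each $\alpha<\omega_1$ at most countably many $\equiv_\alpha$-classes among its models), and such that for every $L_{\omega_1\omega}$ sentence $\psi$ one of $\varphi\wedge\psi$, $\varphi\wedge\neg\psi$ has only countably many models. Moreover for each $\alpha<\omega_1$ only countably many $\Sigma^{\mathrm{in}}_\alpha$-types are realized in models of $\varphi$. For each $\beta<\omega_1$ exactly one $\equiv_\beta$-class of models of $\varphi$ is uncountable, denoted $\mathcal C_\beta$. $f(\alpha)=\min\{\beta:(\forall M\models\varphi)(M\notin\mathcal C_\alpha\Rightarrow\mathrm{cSR}(M)<\beta)\}$, $\mathfrak F=\{\alpha<\omega_1:f(\alpha)\le\alpha\}$. Sacks rank. A fragment is a countable set of $L_{\omega_1\omega}$ formulas closed under subformulas, substitution and the finitary connectives and quantifiers. For a structure $A$: $L^A_0$ is the finitary language; $T^A_\delta=\mathrm{Th}_{L^A_\delta}(A)$; $L^A_{\delta+1}$ is the least fragment containing $L^A_\delta$ and $\bigwedge p$ for every non-principal complete $L^A_\delta$-type $p$ realized in $A$; unions at limits. $\mathrm{sr}_{\mathrm{Sacks}}(A)$ is the least $\delta$ such that $A$ is the atomic model of $T^A_\delta$. Tree of nodes. $L_0$ is the fragment generated by $\varphi$, and $T$ is $\{\varphi\}$ together with the tautologies of $L_0$.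 A theory $T'$ in a fragment $L'$ is $\omega$-complete if for each sentence $F\in L'$, $F\in T'$ or $\neg F\in T'$, and whenever $\bigvee_iF_i\in T'$, some $F_i\in T'$; it is finitarily consistent if no contradiction is derivable from it by finite-length deductions. Nodes on level $0$: finitarily consistent $\omega$-complete extensions of $T$ in $L_0$. An $n$-type of a node $S$ (in fragment $L_S$) is a maximal set of $L_S(\bar x)$-formulas finitarily consistent with $S$; it is principal if generated over $S$ by one of its formulas. Nodes on level $\delta+1$: finitarily consistent $\omega$-complete extensions of a level-$\delta$ node $S$ in $L'_S$, the least fragment containing $L_S$ and $\bigwedge p$ for each non-principal $n$-type $p$ of $S$. Nodes on limit levels: unions along chains. Every model of a node is a model of $\varphi$. Fixed data, supplied by a theorem of Sacks (Bounds on weak scattering, Prop. 5.2 and Thm. 5.3): an increasing branch $(T_\delta)_{\delta<\omega_1}$ of nodes, $T_\delta$ on level $\delta$, unions at limits, $\Delta_1$ over $L(\omega_1,T)$, such that every $T_\delta$ has an atomic model of $\mathrm{sr}_{\mathrm{Sacks}}$ exactly $\delta$; and a club $C_{5.3}\subseteq\omega_1$ (the ordinals $\omega_1^{L(\beta_\delta,T)}$ for the transitive collapses $L(\beta_\delta,T)$ of the $\Sigma_1$-hulls in Sacks' proof) such that for each $\lambda\in C_{5.3}$: $\lambda>\omega$ and $L(\lambda,T)$ is $\Sigma_1$-admissible; the set of non-principal $n$-types of $T_\lambda$ is non-empty and countable; $A_\lambda$ is an atomic model of $T_\lambda$ with $\mathrm{sr}_{\mathrm{Sacks}}(A_\lambda)=\lambda$;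 $B_\lambda\models T_\lambda$ realizes every non-principal $n$-type of $T_\lambda$, $\omega_1^{B_\lambda}=\lambda$ and $\mathrm{sr}_{\mathrm{Sacks}}(B_\lambda)=\lambda+1$. *)

theory Defs
  imports Main "HOL-Library.Countable_Set_Type" "HOL-Library.Nat_Bijection"
begin

section \<open>Hereditarily countable sets and countable ordinals\<close>

text \<open>Since countable sets are extensional, this datatype is (extensionally) the universe of
  hereditarily countable sets. It contains every level \<open>L(\<alpha>,T)\<close>, \<open>\<alpha> < \<omega>\<^sub>1\<close>, for hereditarily countable \<open>T\<close>.\<close>

datatype hc = HSet "hc cset"

primrec elts :: "hc \<Rightarrow> hc set" where
  "elts (HSet S) = rcset S"

definition hset :: "hc set \<Rightarrow> hc" where
  "hset A = HSet (acset A)"  \<comment> \<open>meaningful for countable \<open>A\<close>\<close>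

definition hpair :: "hc \<Rightarrow> hc \<Rightarrow> hc" where
  "hpair x y = hset {hset {x}, hset {x, y}}"

definition transitive_hc :: "hc \<Rightarrow> bool" where
  "transitive_hc x \<longleftrightarrow> (\<forall>y\<in>elts x. elts y \<subseteq> elts x)"

definition ordinal_hc :: "hc \<Rightarrow> bool" where
  "ordinal_hc x \<longleftrightarrow> transitive_hc x \<and> (\<forall>y\<in>elts x. transitive_hc y)"

lemma elts_hset [simp]: "countable A \<Longrightarrow> elts (hset A) = A"
  by (simp add: hset_def acset_inverse)

lemma countable_elts [simp]: "countable (elts x)"
  by (cases x) simp

lemma hset_elts [simp]: "hset (elts x) = x"
  by (cases x) (simp add: hset_def)

lemma hc_eqI: "elts x = elts y \<Longrightarrow> x = y"
  by (metis hset_elts)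

lemma wf_elts: "wf {(x, y). x \<in> elts y}"
proof (rule wfUNIVI)
  fix P :: "hc \<Rightarrow> bool" and x
  assume *: "\<forall>x. (\<forall>y. (y, x) \<in> {(x, y). x \<in> elts y} \<longrightarrow> P y) \<longrightarrow> P x"
  show "P x"
    by (induction x) (use * in auto)
qed

lemma elts_induct: "(\<And>x. (\<And>y. y \<in> elts x \<Longrightarrow> P y) \<Longrightarrow> P x) \<Longrightarrow> P x"
  using wf_induct_rule[OF wf_elts, of P x] by blast

lemma ordinal_elts: "ordinal_hc x \<Longrightarrow> y \<in> elts x \<Longrightarrow> ordinal_hc y"
  unfolding ordinal_hc_def transitive_hc_def by blast

lemma ordinal_trichotomy:
  "ordinal_hc x \<Longrightarrow> ordinal_hc y \<Longrightarrow> x \<in> elts y \<or> x = y \<or> y \<in> elts x"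
proof (induction x arbitrary: y rule: elts_induct)
  case (1 x)
  note IHx = 1
  from IHx(3) show ?case
  proof (induction y rule: elts_induct)
    case (1 y)
    have a: "z \<in> elts y \<or> y \<in> elts x" if "z \<in> elts x" for z
      using IHx(1)[OF that ordinal_elts[OF IHx(2) that] "1.prems"] that IHx(2)
      unfolding ordinal_hc_def transitive_hc_def by blast
    have b: "z \<in> elts x \<or> x \<in> elts y" if "z \<in> elts y" for z
      using "1.IH"[OF that ordinal_elts[OF "1.prems" that]] that "1.prems"
      unfolding ordinal_hc_def transitive_hc_def by blast
    show ?case
      using a b hc_eqI[of x y] by blast
  qed
qed

typedef cord = "{x. ordinal_hc x}"
proof
  show "hset {} \<in> {x. ordinal_hc x}"
    by (simp add: ordinal_hc_def transitive_hc_def)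
qed

text \<open>The type of all countable ordinals; the ordinal \<open>\<omega>\<^sub>1\<close> itself is the whole type.\<close>

instantiation cord :: wellorder
begin

definition less_eq_cord :: "cord \<Rightarrow> cord \<Rightarrow> bool" where
  "\<alpha> \<le> \<beta> \<longleftrightarrow> Rep_cord \<alpha> \<in> elts (Rep_cord \<beta>) \<or> \<alpha> = \<beta>"

definition less_cord :: "cord \<Rightarrow> cord \<Rightarrow> bool" where
  "\<alpha> < \<beta> \<longleftrightarrow> Rep_cord \<alpha> \<in> elts (Rep_cord \<beta>)"

instance
proof
  fix x y z :: cord
  have trans: "a \<in> elts b \<Longrightarrow> b \<in> elts (Rep_cord c) \<Longrightarrow> a \<in> elts (Rep_cord c)" for a b c
    using Rep_cord[of c] unfolding ordinal_hc_def transitive_hc_def by blast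
  have asym: "a \<in> elts b \<Longrightarrow> b \<notin> elts a" for a b
    using wf_not_sym[OF wf_elts, of a b] by auto
  show "x < y \<longleftrightarrow> x \<le> y \<and> \<not> y \<le> x"
    unfolding less_cord_def less_eq_cord_def using asym by blast
  show "x \<le> x"
    by (simp add: less_eq_cord_def)
  show "x \<le> y \<Longrightarrow> y \<le> z \<Longrightarrow> x \<le> z"
    unfolding less_eq_cord_def using trans by blast
  show "x \<le> y \<Longrightarrow> y \<le> x \<Longrightarrow> x = y"
    unfolding less_eq_cord_def using asym by blast
  show "x \<le> y \<or> y \<le> x"
    unfolding less_eq_cord_def
    using ordinal_trichotomy[of "Rep_cord x" "Rep_cord y"] Rep_cord[of x] Rep_cord[of y]
    by (auto simp: Rep_cord_inject)
next
  fix P :: "cord \<Rightarrow> bool" and a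
  assume *: "\<And>x. (\<And>y. y < x \<Longrightarrow> P y) \<Longrightarrow> P x"
  have "wf {(x, y :: cord). x < y}"
    using wf_inv_image[OF wf_elts, of Rep_cord] by (simp add: inv_image_def less_cord_def)
  from wf_induct_rule[OF this, of P a] * show "P a"
    by blast
qed

end

instantiation cord :: zero
begin
definition zero_cord :: cord where "0 = Abs_cord (hset {})"
instance ..
end

definition csuc :: "cord \<Rightarrow> cord" where
  "csuc \<alpha> = (LEAST \<beta>. \<alpha> < \<beta>)"

definition limit_ord :: "cord \<Rightarrow> bool" where
  "limit_ord \<alpha> \<longleftrightarrow> \<alpha> \<noteq> 0 \<and> (\<forall>\<beta><\<alpha>. csuc \<beta> < \<alpha>)"

definition omega :: cord where
  "omega = (LEAST \<alpha>. limit_ord \<alpha>)"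

lemma zero_cord_le [simp]: "0 \<le> (\<alpha>::cord)"
proof -
  have "\<not> \<alpha> < 0"
    unfolding less_cord_def zero_cord_def
    by (subst Abs_cord_inverse) (simp_all add: ordinal_hc_def transitive_hc_def)
  then show ?thesis by simp
qed

lemma less_csuc: "\<alpha> < csuc \<alpha>"
proof -
  define s where "s = hset (insert (Rep_cord \<alpha>) (elts (Rep_cord \<alpha>)))"
  have e: "elts s = insert (Rep_cord \<alpha>) (elts (Rep_cord \<alpha>))"
    by (simp add: s_def)
  have "ordinal_hc s"
    using Rep_cord[of \<alpha>] by (auto simp: ordinal_hc_def transitive_hc_def e)
  then have "\<alpha> < Abs_cord s"
    by (simp add: less_cord_def Abs_cord_inverse e)
  then show ?thesis
    unfolding csuc_def by (rule LeastI)
qed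

definition club :: "cord set \<Rightarrow> bool" where
  "club C \<longleftrightarrow> (\<forall>\<alpha>. \<exists>\<beta>\<in>C. \<alpha> < \<beta>) \<and>
     (\<forall>\<alpha>. limit_ord \<alpha> \<and> (\<forall>\<beta><\<alpha>. \<exists>\<gamma>\<in>C. \<beta> < \<gamma> \<and> \<gamma> < \<alpha>) \<longrightarrow> \<alpha> \<in> C)"

section \<open>Vocabularies, structures and infinitary formulas\<close>

record vocab =
  rels :: "nat set"
  rar :: "nat \<Rightarrow> nat"
  funs :: "nat set"
  far :: "nat \<Rightarrow> nat"

record 'a fostruct =
  univ :: "'a set"
  relI :: "nat \<Rightarrow> 'a list \<Rightarrow> bool"
  funI :: "nat \<Rightarrow> 'a list \<Rightarrow> 'a"

definition ctbl_struct :: "vocab \<Rightarrow> 'a fostruct \<Rightarrow> bool" where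
  "ctbl_struct V M \<longleftrightarrow> univ M \<noteq> {} \<and> countable (univ M) \<and>
     (\<forall>f\<in>funs V. \<forall>xs\<in>lists (univ M). length xs = far V f \<longrightarrow> funI M f xs \<in> univ M)"

definition isomorphic :: "vocab \<Rightarrow> 'a fostruct \<Rightarrow> 'b fostruct \<Rightarrow> bool" where
  "isomorphic V M N \<longleftrightarrow> (\<exists>h. bij_betw h (univ M) (univ N) \<and>
     (\<forall>r\<in>rels V. \<forall>xs\<in>lists (univ M). length xs = rar V r \<longrightarrow>
        relI M r xs = relI N r (map h xs)) \<and>
     (\<forall>f\<in>funs V. \<forall>xs\<in>lists (univ M). length xs = far V f \<longrightarrow>
        h (funI M f xs) = funI N f (map h xs)))"

datatype tm = Var nat | Fn nat "tm list"

text \<open>Formulas use de Bruijn indices: \<open>Exi F\<close> binds index 0 of \<open>F\<close>. Countable conjunctions and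
  universal quantifiers are the usual abbreviations.\<close>

datatype fm =
    Rel nat "tm list"
  | Eq tm tm
  | Neg fm
  | Disj "fm cset"
  | Exi fm

definition Conj :: "fm cset \<Rightarrow> fm" where
  "Conj S = Neg (Disj (cimage Neg S))"

definition Forall :: "fm \<Rightarrow> fm" where
  "Forall F = Neg (Exi (Neg F))"

definition And :: "fm \<Rightarrow> fm \<Rightarrow> fm" where
  "And F G = Conj (acset {F, G})"

primrec tvars :: "tm \<Rightarrow> nat set" where
  "tvars (Var i) = {i}"
| "tvars (Fn f ts) = \<Union> (set (map tvars ts))"

primrec fv :: "fm \<Rightarrow> nat set" where
  "fv (Rel r ts) = \<Union> (tvars ` set ts)"
| "fv (Eq t u) = tvars t \<union> tvars u"
| "fv (Neg F) = fv F"
| "fv (Disj S) = \<Union> (rcset (cimage fv S))"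
| "fv (Exi F) = {i. Suc i \<in> fv F}"

primrec term_of :: "vocab \<Rightarrow> tm \<Rightarrow> bool" where
  "term_of V (Var i) = True"
| "term_of V (Fn f ts) = (f \<in> funs V \<and> length ts = far V f \<and> list_all id (map (term_of V) ts))"

primrec symbols_ok :: "vocab \<Rightarrow> fm \<Rightarrow> bool" where
  "symbols_ok V (Rel r ts) = (r \<in> rels V \<and> length ts = rar V r \<and> (\<forall>t\<in>set ts. term_of V t))"
| "symbols_ok V (Eq t u) = (term_of V t \<and> term_of V u)"
| "symbols_ok V (Neg F) = symbols_ok V F"
| "symbols_ok V (Disj S) = (\<forall>b\<in>rcset (cimage (symbols_ok V) S). b)"
| "symbols_ok V (Exi F) = symbols_ok V F"

text \<open>As usual, only formulas with finitely many free variables are formulas of \<open>L\<^bsub>\<omega>\<^sub>1\<omega>\<^esub>\<close>.\<close>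

definition fml :: "vocab \<Rightarrow> fm \<Rightarrow> bool" where
  "fml V F \<longleftrightarrow> symbols_ok V F \<and> finite (fv F)"

definition sentence :: "vocab \<Rightarrow> fm \<Rightarrow> bool" where
  "sentence V F \<longleftrightarrow> fml V F \<and> fv F = {}"

primrec tsubst :: "(nat \<Rightarrow> tm) \<Rightarrow> tm \<Rightarrow> tm" where
  "tsubst \<sigma> (Var i) = \<sigma> i"
| "tsubst \<sigma> (Fn f ts) = Fn f (map (tsubst \<sigma>) ts)"

definition lift :: "(nat \<Rightarrow> tm) \<Rightarrow> nat \<Rightarrow> tm" where
  "lift \<sigma> = case_nat (Var 0) (\<lambda>i. tsubst (\<lambda>j. Var (Suc j)) (\<sigma> i))"

primrec subst :: "fm \<Rightarrow> (nat \<Rightarrow> tm) \<Rightarrow> fm" where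
  "subst (Rel r ts) = (\<lambda>\<sigma>. Rel r (map (tsubst \<sigma>) ts))"
| "subst (Eq t u) = (\<lambda>\<sigma>. Eq (tsubst \<sigma> t) (tsubst \<sigma> u))"
| "subst (Neg F) = (\<lambda>\<sigma>. Neg (subst F \<sigma>))"
| "subst (Disj S) = (\<lambda>\<sigma>. Disj (cimage (\<lambda>g. g \<sigma>) (cimage subst S)))"
| "subst (Exi F) = (\<lambda>\<sigma>. Exi (subst F (lift \<sigma>)))"

definition inst :: "fm \<Rightarrow> tm \<Rightarrow> fm" where
  "inst F t = subst F (case_nat t Var)"

definition shift :: "fm \<Rightarrow> fm" where
  "shift F = subst F (\<lambda>i. Var (Suc i))"

primrec teval :: "'a fostruct \<Rightarrow> (nat \<Rightarrow> 'a) \<Rightarrow> tm \<Rightarrow> 'a" where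
  "teval M e (Var i) = e i"
| "teval M e (Fn f ts) = funI M f (map (teval M e) ts)"

primrec sat :: "'a fostruct \<Rightarrow> fm \<Rightarrow> (nat \<Rightarrow> 'a) \<Rightarrow> bool" where
  "sat M (Rel r ts) = (\<lambda>e. relI M r (map (teval M e) ts))"
| "sat M (Eq t u) = (\<lambda>e. teval M e t = teval M e u)"
| "sat M (Neg F) = (\<lambda>e. \<not> sat M F e)"
| "sat M (Disj S) = (\<lambda>e. \<exists>P\<in>rcset (cimage (sat M) S). P e)"
| "sat M (Exi F) = (\<lambda>e. \<exists>a\<in>univ M. sat M F (case_nat a e))"

text \<open>An \<open>n\<close>-tuple of a structure is given by an assignment into its universe, of which only the
  first \<open>n\<close> values matter for formulas with free variables below \<open>n\<close>.\<close>

definition assignments :: "'a fostruct \<Rightarrow> (nat \<Rightarrow> 'a) set" where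
  "assignments M = {e. range e \<subseteq> univ M}"

definition models :: "'a fostruct \<Rightarrow> fm \<Rightarrow> bool" where
  "models M F \<longleftrightarrow> (\<forall>e\<in>assignments M. sat M F e)"

definition models_th :: "'a fostruct \<Rightarrow> fm set \<Rightarrow> bool" where
  "models_th M T \<longleftrightarrow> (\<forall>F\<in>T. models M F)"

definition tp :: "fm set \<Rightarrow> nat \<Rightarrow> 'a fostruct \<Rightarrow> (nat \<Rightarrow> 'a) \<Rightarrow> fm set" where
  "tp L n M e = {F \<in> L. fv F \<subseteq> {..<n} \<and> sat M F e}"

section \<open>The infinitary hierarchy, Scott rank and quantifier rank\<close>

inductive qf :: "vocab \<Rightarrow> fm \<Rightarrow> bool" for V where
  qf_Rel: "symbols_ok V (Rel r ts) \<Longrightarrow> qf V (Rel r ts)"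
| qf_Eq: "symbols_ok V (Eq t u) \<Longrightarrow> qf V (Eq t u)"
| qf_Neg: "qf V F \<Longrightarrow> qf V (Neg F)"
| qf_Disj: "finite (rcset S) \<Longrightarrow> (\<And>F. F \<in> rcset S \<Longrightarrow> qf V F) \<Longrightarrow> qf V (Disj S)"

inductive sigma_in :: "vocab \<Rightarrow> cord \<Rightarrow> fm \<Rightarrow> bool"
  and pi_in :: "vocab \<Rightarrow> cord \<Rightarrow> fm \<Rightarrow> bool" for V where
  sigma_0: "qf V F \<Longrightarrow> sigma_in V 0 F"
| pi_0: "qf V F \<Longrightarrow> pi_in V 0 F"
| sigma_pos: "0 < \<alpha> \<Longrightarrow> fml V (Disj S) \<Longrightarrow>
    (\<And>F. F \<in> rcset S \<Longrightarrow> \<exists>k G \<beta>. F = (Exi ^^ k) G \<and> \<beta> < \<alpha> \<and> pi_in V \<beta> G) \<Longrightarrow>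
    sigma_in V \<alpha> (Disj S)"
| pi_pos: "0 < \<alpha> \<Longrightarrow> fml V (Conj S) \<Longrightarrow>
    (\<And>F. F \<in> rcset S \<Longrightarrow> \<exists>k G \<beta>. F = (Forall ^^ k) G \<and> \<beta> < \<alpha> \<and> sigma_in V \<beta> G) \<Longrightarrow>
    pi_in V \<alpha> (Conj S)"

definition equiv_at :: "vocab \<Rightarrow> cord \<Rightarrow> 'a fostruct \<Rightarrow> 'b fostruct \<Rightarrow> bool" where
  "equiv_at V \<alpha> M N \<longleftrightarrow> (\<forall>F. sentence V F \<and> pi_in V \<alpha> F \<longrightarrow> (models M F \<longleftrightarrow> models N F))"

definition scott_sentence :: "vocab \<Rightarrow> 'a fostruct \<Rightarrow> fm \<Rightarrow> bool" where
  "scott_sentence V M F \<longleftrightarrow> sentence V F \<and>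
     (\<forall>N :: nat fostruct. ctbl_struct V N \<longrightarrow> (models N F \<longleftrightarrow> isomorphic V N M))"

definition cSR :: "vocab \<Rightarrow> 'a fostruct \<Rightarrow> cord" where
  "cSR V M = (LEAST \<alpha>. \<exists>F. pi_in V (csuc \<alpha>) F \<and> scott_sentence V M F)"

text \<open>Membership of a sentence in a level of the hierarchy is, as usual, up to logical equivalence;
  an arbitrary \<open>L\<^bsub>\<omega>\<^sub>1\<omega>\<^esub>\<close> sentence need not literally have the syntactic form of any level.\<close>

definition log_equiv :: "vocab \<Rightarrow> fm \<Rightarrow> fm \<Rightarrow> bool" where
  "log_equiv V F G \<longleftrightarrow>
     (\<forall>M :: nat fostruct. ctbl_struct V M \<longrightarrow> (models M F \<longleftrightarrow> models M G))"

definition qr :: "vocab \<Rightarrow> fm \<Rightarrow> cord" where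
  "qr V F = (LEAST \<beta>. \<exists>G. sentence V G \<and> log_equiv V F G \<and> (pi_in V \<beta> G \<or> sigma_in V \<beta> G))"

section \<open>Minimal counterexamples to Vaught's conjecture\<close>

definition Mod :: "vocab \<Rightarrow> fm \<Rightarrow> nat fostruct set" where
  "Mod V F = {M. ctbl_struct V M \<and> models M F}"

definition iso_classes :: "vocab \<Rightarrow> nat fostruct set \<Rightarrow> nat fostruct set set" where
  "iso_classes V K = K // {(M, N). M \<in> K \<and> N \<in> K \<and> isomorphic V M N}"

definition equiv_classes :: "vocab \<Rightarrow> cord \<Rightarrow> nat fostruct set \<Rightarrow> nat fostruct set set" where
  "equiv_classes V \<alpha> K = K // {(M, N). M \<in> K \<and> N \<in> K \<and> equiv_at V \<alpha> M N}"

definition minimal_counterexample :: "vocab \<Rightarrow> fm \<Rightarrow> bool" where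
  "minimal_counterexample V \<phi> \<longleftrightarrow> sentence V \<phi> \<and>
     (card_of (iso_classes V (Mod V \<phi>)), cardSuc natLeq) \<in> ordIso \<and>
     (\<forall>\<alpha>. countable (equiv_classes V \<alpha> (Mod V \<phi>))) \<and>
     (\<forall>\<psi>. sentence V \<psi> \<longrightarrow>
        countable (iso_classes V (Mod V (And \<phi> \<psi>))) \<or>
        countable (iso_classes V (Mod V (And \<phi> (Neg \<psi>)))))"

definition countably_many_sigma_types :: "vocab \<Rightarrow> fm \<Rightarrow> bool" where
  "countably_many_sigma_types V \<phi> \<longleftrightarrow> (\<forall>\<alpha>.
     countable {tp (Collect (sigma_in V \<alpha>)) n M e | n M e. M \<in> Mod V \<phi> \<and> e \<in> assignments M})"

definition unique_uncountable_classes :: "vocab \<Rightarrow> fm \<Rightarrow> bool" where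
  "unique_uncountable_classes V \<phi> \<longleftrightarrow>
     (\<forall>\<beta>. \<exists>!K. K \<in> equiv_classes V \<beta> (Mod V \<phi>) \<and> uncountable (iso_classes V K))"

definition uncountable_class :: "vocab \<Rightarrow> fm \<Rightarrow> cord \<Rightarrow> nat fostruct set" where
  "uncountable_class V \<phi> \<beta> =
     (THE K. K \<in> equiv_classes V \<beta> (Mod V \<phi>) \<and> uncountable (iso_classes V K))"

definition f_bound :: "vocab \<Rightarrow> fm \<Rightarrow> cord \<Rightarrow> cord" where
  "f_bound V \<phi> \<alpha> =
     (LEAST \<beta>. \<forall>M\<in>Mod V \<phi>. M \<notin> uncountable_class V \<phi> \<alpha> \<longrightarrow> cSR V M < \<beta>)"

definition closure_points :: "vocab \<Rightarrow> fm \<Rightarrow> cord set" where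
  "closure_points V \<phi> = {\<alpha>. f_bound V \<phi> \<alpha> \<le> \<alpha>}"

section \<open>Fragments and finite-length deductions\<close>

text \<open>Following the usual convention, fragments contain all atomic formulas.\<close>

inductive_set frag_gen :: "vocab \<Rightarrow> fm set \<Rightarrow> fm set" for V X where
  gen: "F \<in> X \<Longrightarrow> F \<in> frag_gen V X"
| Rel: "symbols_ok V (Rel r ts) \<Longrightarrow> Rel r ts \<in> frag_gen V X"
| Eq: "symbols_ok V (Eq t u) \<Longrightarrow> Eq t u \<in> frag_gen V X"
| Neg: "F \<in> frag_gen V X \<Longrightarrow> Neg F \<in> frag_gen V X"
| Disj: "finite (rcset S) \<Longrightarrow> (\<And>F. F \<in> rcset S \<Longrightarrow> F \<in> frag_gen V X) \<Longrightarrow> Disj S \<in> frag_gen V X"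
| Exi: "F \<in> frag_gen V X \<Longrightarrow> Exi F \<in> frag_gen V X"
| subst: "F \<in> frag_gen V X \<Longrightarrow> (\<And>i. term_of V (\<sigma> i)) \<Longrightarrow> subst F \<sigma> \<in> frag_gen V X"
| sub_Neg: "Neg F \<in> frag_gen V X \<Longrightarrow> F \<in> frag_gen V X"
| sub_Disj: "Disj S \<in> frag_gen V X \<Longrightarrow> F \<in> rcset S \<Longrightarrow> F \<in> frag_gen V X"
| sub_Ex: "Exi F \<in> frag_gen V X \<Longrightarrow> F \<in> frag_gen V X"

definition fragment :: "vocab \<Rightarrow> fm set \<Rightarrow> bool" where
  "fragment V L \<longleftrightarrow> countable L \<and> (\<forall>F\<in>L. fml V F) \<and> frag_gen V L = L"

text \<open>\<open>derH V n \<Gamma> F\<close>: there is a deduction of \<open>F\<close> from \<open>\<Gamma>\<close> of length (height) at most \<open>n\<close> in the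
  natural deduction calculus of \<open>L\<^bsub>\<omega>\<^sub>1\<omega>\<^esub>\<close>. Free variables of \<open>\<Gamma>\<close> are parameters. The rule \<open>DisjE\<close> for
  countable disjunctions has one premise for each disjunct, and \<open>n\<close> bounds the lengths of all of
  them. Restricting \<open>DisjE\<close> to finite \<open>S\<close> would be wrong here: for \<open>p\<close> a non-principal type of
  \<open>T\<^sub>\<delta>\<close>, \<open>\<delta> < \<lambda>\<close>, the set \<open>p \<union> {\<not> \<And>p}\<close> would extend to a type of \<open>T\<^sub>\<lambda>\<close>, which nothing can realize.\<close>

inductive derH :: "vocab \<Rightarrow> nat \<Rightarrow> fm set \<Rightarrow> fm \<Rightarrow> bool" for V where
  Hyp: "F \<in> \<Gamma> \<Longrightarrow> derH V n \<Gamma> F"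
| NegI: "fml V F \<Longrightarrow> derH V n (insert F \<Gamma>) G \<Longrightarrow> derH V n (insert F \<Gamma>) (Neg G) \<Longrightarrow>
    derH V (Suc n) \<Gamma> (Neg F)"
| Classical: "fml V F \<Longrightarrow> derH V n (insert (Neg F) \<Gamma>) G \<Longrightarrow> derH V n (insert (Neg F) \<Gamma>) (Neg G) \<Longrightarrow>
    derH V (Suc n) \<Gamma> F"
| DisjI: "fml V (Disj S) \<Longrightarrow> F \<in> rcset S \<Longrightarrow> derH V n \<Gamma> F \<Longrightarrow> derH V (Suc n) \<Gamma> (Disj S)"
| DisjE: "derH V n \<Gamma> (Disj S) \<Longrightarrow> (\<And>F. F \<in> rcset S \<Longrightarrow> derH V n (insert F \<Gamma>) G) \<Longrightarrow> fml V G \<Longrightarrow>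
    derH V (Suc n) \<Gamma> G"
| ExI: "fml V (Exi F) \<Longrightarrow> term_of V t \<Longrightarrow> derH V n \<Gamma> (inst F t) \<Longrightarrow> derH V (Suc n) \<Gamma> (Exi F)"
| ExE: "derH V n \<Gamma> (Exi F) \<Longrightarrow> derH V n (insert F (shift ` \<Gamma>)) (shift G) \<Longrightarrow> fml V G \<Longrightarrow>
    derH V (Suc n) \<Gamma> G"
| EqI: "term_of V t \<Longrightarrow> derH V (Suc n) \<Gamma> (Eq t t)"
| EqE: "fml V F \<Longrightarrow> derH V n \<Gamma> (Eq t u) \<Longrightarrow> derH V n \<Gamma> (inst F t) \<Longrightarrow> derH V (Suc n) \<Gamma> (inst F u)"

definition derivable :: "vocab \<Rightarrow> fm set \<Rightarrow> fm \<Rightarrow> bool" where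
  "derivable V \<Gamma> F \<longleftrightarrow> (\<exists>n. derH V n \<Gamma> F)"

definition fin_consistent :: "vocab \<Rightarrow> fm set \<Rightarrow> bool" where
  "fin_consistent V \<Gamma> \<longleftrightarrow> \<not> (\<exists>F. derivable V \<Gamma> F \<and> derivable V \<Gamma> (Neg F))"

definition omega_complete :: "vocab \<Rightarrow> fm set \<Rightarrow> fm set \<Rightarrow> bool" where
  "omega_complete V L T \<longleftrightarrow> T \<subseteq> {F \<in> L. sentence V F} \<and>
     (\<forall>F\<in>L. sentence V F \<longrightarrow> F \<in> T \<or> Neg F \<in> T) \<and>
     (\<forall>S. Disj S \<in> T \<longrightarrow> (\<exists>F\<in>rcset S. F \<in> T))"

section \<open>Types, atomic models and Sacks rank\<close>

definition ntype_set :: "vocab \<Rightarrow> fm set \<Rightarrow> fm set \<Rightarrow> nat \<Rightarrow> fm set \<Rightarrow> bool" where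
  "ntype_set V L S n p \<longleftrightarrow> p \<subseteq> {F \<in> L. fv F \<subseteq> {..<n}} \<and> fin_consistent V (S \<union> p)"

definition ntype :: "vocab \<Rightarrow> fm set \<Rightarrow> fm set \<Rightarrow> nat \<Rightarrow> fm set \<Rightarrow> bool" where
  "ntype V L S n p \<longleftrightarrow> ntype_set V L S n p \<and> (\<forall>q. ntype_set V L S n q \<and> p \<subseteq> q \<longrightarrow> q = p)"

definition principal :: "vocab \<Rightarrow> fm set \<Rightarrow> fm set \<Rightarrow> bool" where
  "principal V S p \<longleftrightarrow> (\<exists>F\<in>p. \<forall>G\<in>p. derivable V (insert F S) G)"

definition nonprincipal_types :: "vocab \<Rightarrow> fm set \<Rightarrow> fm set \<Rightarrow> fm set set" where
  "nonprincipal_types V L S = {p. (\<exists>n\<ge>1. ntype V L S n p) \<and> \<not> principal V S p}"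

definition realizes :: "'a fostruct \<Rightarrow> fm set \<Rightarrow> bool" where
  "realizes M p \<longleftrightarrow> (\<exists>e\<in>assignments M. \<forall>F\<in>p. sat M F e)"

definition realizes_all_types :: "vocab \<Rightarrow> fm set \<Rightarrow> fm set \<Rightarrow> 'a fostruct \<Rightarrow> bool" where
  "realizes_all_types V L S M \<longleftrightarrow> (\<forall>n\<ge>1. \<forall>p. ntype V L S n p \<longrightarrow> realizes M p)"

definition atomic_model :: "vocab \<Rightarrow> fm set \<Rightarrow> fm set \<Rightarrow> 'a fostruct \<Rightarrow> bool" where
  "atomic_model V L S M \<longleftrightarrow> ctbl_struct V M \<and> models_th M S \<and>
     (\<forall>n\<ge>1. \<forall>e\<in>assignments M. principal V S (tp L n M e))"

definition Th :: "vocab \<Rightarrow> fm set \<Rightarrow> 'a fostruct \<Rightarrow> fm set" where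
  "Th V L M = {F \<in> L. sentence V F \<and> models M F}"

definition realized_nonprincipal :: "vocab \<Rightarrow> fm set \<Rightarrow> 'a fostruct \<Rightarrow> fm set set" where
  "realized_nonprincipal V L M =
     {p. (\<exists>n\<ge>1. \<exists>e\<in>assignments M. p = tp L n M e) \<and> \<not> principal V (Th V L M) p}"

definition big_conj :: "fm set \<Rightarrow> fm" where
  "big_conj p = Conj (acset p)"

function sacksL :: "vocab \<Rightarrow> 'a fostruct \<Rightarrow> cord \<Rightarrow> fm set" where
  "sacksL V M \<delta> =
     (if \<delta> = 0 then frag_gen V {}
      else if limit_ord \<delta> then (\<Union>\<gamma>\<in>{..<\<delta>}. sacksL V M \<gamma>)
      else (\<Union>\<gamma>\<in>{\<gamma>. \<gamma> < \<delta> \<and> csuc \<gamma> = \<delta>}.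
              frag_gen V (sacksL V M \<gamma> \<union> big_conj ` realized_nonprincipal V (sacksL V M \<gamma>) M)))"
  by auto
termination
  by (relation "inv_image {(x, y :: cord). x < y} (\<lambda>(V, M, \<delta>). \<delta>)")
    (auto intro: wf_inv_image wf)

declare sacksL.simps [simp del]

definition sr_Sacks :: "vocab \<Rightarrow> 'a fostruct \<Rightarrow> cord" where
  "sr_Sacks V M = (LEAST \<delta>. atomic_model V (sacksL V M \<delta>) (Th V (sacksL V M \<delta>) M) M)"

section \<open>The tree of nodes\<close>

definition base_frag :: "vocab \<Rightarrow> fm \<Rightarrow> fm set" where
  "base_frag V \<phi> = frag_gen V {\<phi>}"

definition base_theory :: "vocab \<Rightarrow> fm \<Rightarrow> fm set" where
  "base_theory V \<phi> = insert \<phi> {F \<in> base_frag V \<phi>. sentence V F \<and>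
     (\<forall>M :: nat fostruct. ctbl_struct V M \<longrightarrow> models M F)}"

definition next_frag :: "vocab \<Rightarrow> fm set \<Rightarrow> fm set \<Rightarrow> fm set" where
  "next_frag V L S = frag_gen V (L \<union> big_conj ` nonprincipal_types V L S)"

text \<open>\<open>node V \<phi> \<delta> L S\<close>: the theory \<open>S\<close> in the fragment \<open>L\<close> is a node on level \<open>\<delta>\<close>.\<close>

inductive node :: "vocab \<Rightarrow> fm \<Rightarrow> cord \<Rightarrow> fm set \<Rightarrow> fm set \<Rightarrow> bool" for V \<phi> where
  node_zero: "base_theory V \<phi> \<subseteq> S \<Longrightarrow> fin_consistent V S \<Longrightarrow>
    omega_complete V (base_frag V \<phi>) S \<Longrightarrow> node V \<phi> 0 (base_frag V \<phi>) S"
| node_suc: "node V \<phi> \<delta> L S \<Longrightarrow> fragment V (next_frag V L S) \<Longrightarrow> S \<subseteq> S' \<Longrightarrow>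
    fin_consistent V S' \<Longrightarrow> omega_complete V (next_frag V L S) S' \<Longrightarrow>
    node V \<phi> (csuc \<delta>) (next_frag V L S) S'"
| node_limit: "limit_ord \<delta> \<Longrightarrow> (\<And>\<gamma>. \<gamma> < \<delta> \<Longrightarrow> node V \<phi> \<gamma> (l \<gamma>) (s \<gamma>)) \<Longrightarrow>
    (\<And>\<beta> \<gamma>. \<beta> < \<gamma> \<Longrightarrow> \<gamma> < \<delta> \<Longrightarrow> l \<beta> \<subseteq> l \<gamma> \<and> s \<beta> \<subseteq> s \<gamma>) \<Longrightarrow>
    node V \<phi> \<delta> (\<Union>\<gamma>\<in>{..<\<delta>}. l \<gamma>) (\<Union>\<gamma>\<in>{..<\<delta>}. s \<gamma>)"

section \<open>Relativized constructibility and admissibility\<close>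

text \<open>First-order formulas of set theory in de Bruijn notation; \<open>SBEx i F\<close> is the bounded
  quantifier \<open>\<exists>x \<in> v\<^sub>i. F\<close>.\<close>

datatype sfm = SMem nat nat | SEq nat nat | SNeg sfm | SConj sfm sfm | SBEx nat sfm | SEx sfm

primrec ssat :: "hc set \<Rightarrow> sfm \<Rightarrow> (nat \<Rightarrow> hc) \<Rightarrow> bool" where
  "ssat K (SMem i j) = (\<lambda>e. e i \<in> elts (e j))"
| "ssat K (SEq i j) = (\<lambda>e. e i = e j)"
| "ssat K (SNeg F) = (\<lambda>e. \<not> ssat K F e)"
| "ssat K (SConj F G) = (\<lambda>e. ssat K F e \<and> ssat K G e)"
| "ssat K (SBEx i F) = (\<lambda>e. \<exists>a\<in>K. a \<in> elts (e i) \<and> ssat K F (case_nat a e))"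
| "ssat K (SEx F) = (\<lambda>e. \<exists>a\<in>K. ssat K F (case_nat a e))"

primrec Delta0 :: "sfm \<Rightarrow> bool" where
  "Delta0 (SMem i j) = True"
| "Delta0 (SEq i j) = True"
| "Delta0 (SNeg F) = Delta0 F"
| "Delta0 (SConj F G) = (Delta0 F \<and> Delta0 G)"
| "Delta0 (SBEx i F) = Delta0 F"
| "Delta0 (SEx F) = False"

definition Sigma1_on :: "hc set \<Rightarrow> hc set \<Rightarrow> bool" where
  "Sigma1_on K R \<longleftrightarrow> (\<exists>k F e. Delta0 F \<and> range e \<subseteq> K \<and>
     R = {x \<in> K. ssat K ((SEx ^^ k) F) (case_nat x e)})"

definition Delta1_on :: "hc set \<Rightarrow> hc set \<Rightarrow> bool" where
  "Delta1_on K R \<longleftrightarrow> R \<subseteq> K \<and> Sigma1_on K R \<and> Sigma1_on K (K - R)"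

definition Def :: "hc set \<Rightarrow> hc set" where
  "Def K = {x. \<exists>F e. range e \<subseteq> K \<and> elts x = {a \<in> K. ssat K F (case_nat a e)}}"

inductive_set tc :: "hc \<Rightarrow> hc set" for x where
  tc_base: "x \<in> tc x"
| tc_step: "y \<in> tc x \<Longrightarrow> z \<in> elts y \<Longrightarrow> z \<in> tc x"

text \<open>The hierarchy \<open>L(\<alpha>,t)\<close>, starting from the transitive closure of \<open>{t}\<close>.\<close>

function Lrel :: "hc \<Rightarrow> cord \<Rightarrow> hc set" where
  "Lrel t \<alpha> = tc t \<union> (\<Union>\<beta>\<in>{..<\<alpha>}. Def (Lrel t \<beta>))"
  by auto
termination
  by (relation "inv_image {(x, y :: cord). x < y} (\<lambda>(t, \<alpha>). \<alpha>)")
    (auto intro: wf_inv_image wf)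

declare Lrel.simps [simp del]

definition Lomega1 :: "hc \<Rightarrow> hc set" where
  "Lomega1 t = (\<Union>\<alpha>. Lrel t \<alpha>)"

definition admissible :: "hc set \<Rightarrow> bool" where
  "admissible K \<longleftrightarrow> K \<noteq> {} \<and> (\<forall>x\<in>K. elts x \<subseteq> K) \<and>
     (\<forall>x\<in>K. \<forall>y\<in>K. hset {x, y} \<in> K) \<and>
     (\<forall>x\<in>K. hset (\<Union>y\<in>elts x. elts y) \<in> K) \<and>
     (\<forall>F e. Delta0 F \<and> range e \<subseteq> K \<longrightarrow> (\<forall>a\<in>K. hset {x \<in> elts a. ssat K F (case_nat x e)} \<in> K)) \<and>
     (\<forall>F e. Delta0 F \<and> range e \<subseteq> K \<longrightarrow> (\<forall>a\<in>K.
        (\<forall>x\<in>elts a. \<exists>y\<in>K. ssat K F (case_nat x (case_nat y e))) \<longrightarrow>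
        (\<exists>b\<in>K. \<forall>x\<in>elts a. \<exists>y\<in>elts b. ssat K F (case_nat x (case_nat y e)))))"

primrec nat_code :: "nat \<Rightarrow> hc" where
  "nat_code 0 = hset {}"
| "nat_code (Suc n) = hset (insert (nat_code n) (elts (nat_code n)))"

definition list_code :: "hc list \<Rightarrow> hc" where
  "list_code xs = foldr hpair xs (nat_code 0)"

primrec tm_code :: "tm \<Rightarrow> hc" where
  "tm_code (Var i) = hpair (nat_code 0) (nat_code i)"
| "tm_code (Fn f ts) = hpair (nat_code 1) (hpair (nat_code f) (list_code (map tm_code ts)))"

primrec fm_code :: "fm \<Rightarrow> hc" where
  "fm_code (Rel r ts) = hpair (nat_code 0) (hpair (nat_code r) (list_code (map tm_code ts)))"
| "fm_code (Eq t u) = hpair (nat_code 1) (hpair (tm_code t) (tm_code u))"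
| "fm_code (Neg F) = hpair (nat_code 2) (fm_code F)"
| "fm_code (Disj S) = hpair (nat_code 3) (HSet (cimage fm_code S))"
| "fm_code (Exi F) = hpair (nat_code 4) (fm_code F)"

definition th_code :: "fm set \<Rightarrow> hc" where
  "th_code T = hset (fm_code ` T)"

definition base_code :: "vocab \<Rightarrow> fm \<Rightarrow> hc" where
  "base_code V \<phi> = th_code (base_theory V \<phi>)"

section \<open>Oracle computability and \<open>\<omega>\<^sub>1\<^sup>A\<close>\<close>

datatype recf = RZero | RSuc | RProj nat | ROracle | RComp recf "recf list" | RPrim recf recf | RMin recf

inductive reval :: "nat set \<Rightarrow> recf \<Rightarrow> nat list \<Rightarrow> nat \<Rightarrow> bool" for X where
  "reval X RZero xs 0"
| "reval X RSuc (x # xs) (Suc x)"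
| "i < length xs \<Longrightarrow> reval X (RProj i) xs (xs ! i)"
| "reval X ROracle (x # xs) (if x \<in> X then 1 else 0)"
| "list_all2 (\<lambda>g y. reval X g xs y) gs ys \<Longrightarrow> reval X f ys z \<Longrightarrow> reval X (RComp f gs) xs z"
| "reval X f xs z \<Longrightarrow> reval X (RPrim f g) (0 # xs) z"
| "reval X (RPrim f g) (n # xs) y \<Longrightarrow> reval X g (n # y # xs) z \<Longrightarrow> reval X (RPrim f g) (Suc n # xs) z"
| "reval X f (n # xs) 0 \<Longrightarrow> (\<And>m. m < n \<Longrightarrow> \<exists>y. reval X f (m # xs) (Suc y)) \<Longrightarrow> reval X (RMin f) xs n"

definition computable_in :: "nat set \<Rightarrow> nat set \<Rightarrow> bool" where
  "computable_in X Y \<longleftrightarrow> (\<exists>f. \<forall>n. reval X f [n] (if n \<in> Y then 1 else 0))"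

definition computable_ordinal :: "nat set \<Rightarrow> cord \<Rightarrow> bool" where
  "computable_ordinal X \<alpha> \<longleftrightarrow> (\<exists>R :: nat rel. computable_in X (prod_encode ` R) \<and> Well_order R \<and>
     (\<exists>h. bij_betw h (Field R) {..<\<alpha>} \<and>
        (\<forall>x\<in>Field R. \<forall>y\<in>Field R. (x, y) \<in> R \<longleftrightarrow> h x \<le> h y)))"

definition omega1_oracle :: "nat set \<Rightarrow> cord" where
  "omega1_oracle X = (LEAST \<alpha>. \<not> computable_ordinal X \<alpha>)"

definition atomic_diagram :: "vocab \<Rightarrow> nat fostruct \<Rightarrow> nat set" where
  "atomic_diagram V N =
     {prod_encode (0, a) | a. a \<in> univ N} \<union>
     {prod_encode (1, list_encode (r # xs)) | r xs.
        r \<in> rels V \<and> xs \<in> lists (univ N) \<and> length xs = rar V r \<and> relI N r xs} \<union>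
     {prod_encode (2, list_encode (f # y # xs)) | f y xs.
        f \<in> funs V \<and> xs \<in> lists (univ N) \<and> length xs = far V f \<and> y = funI N f xs}"

definition computes_copy :: "vocab \<Rightarrow> nat set \<Rightarrow> 'a fostruct \<Rightarrow> bool" where
  "computes_copy V X M \<longleftrightarrow>
     (\<exists>N. ctbl_struct V N \<and> isomorphic V N M \<and> computable_in X (atomic_diagram V N))"

definition omega1_struct :: "vocab \<Rightarrow> 'a fostruct \<Rightarrow> cord" where
  "omega1_struct V M = (LEAST \<alpha>. \<exists>X. computes_copy V X M \<and> \<alpha> = omega1_oracle X)"

section \<open>The fixed data\<close>

definition Sacks_branch :: "vocab \<Rightarrow> fm \<Rightarrow> (cord \<Rightarrow> fm set) \<Rightarrow> (cord \<Rightarrow> fm set) \<Rightarrow> bool" where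
  "Sacks_branch V \<phi> L T \<longleftrightarrow>
     (\<forall>\<delta>. node V \<phi> \<delta> (L \<delta>) (T \<delta>)) \<and>
     (\<forall>\<gamma> \<delta>. \<gamma> < \<delta> \<longrightarrow> L \<gamma> \<subseteq> L \<delta> \<and> T \<gamma> \<subseteq> T \<delta>) \<and>
     (\<forall>\<delta>. limit_ord \<delta> \<longrightarrow> L \<delta> = (\<Union>\<gamma>\<in>{..<\<delta>}. L \<gamma>) \<and> T \<delta> = (\<Union>\<gamma>\<in>{..<\<delta>}. T \<gamma>)) \<and>
     Delta1_on (Lomega1 (base_code V \<phi>)) {hpair (Rep_cord \<delta>) (th_code (T \<delta>)) | \<delta>. True} \<and>
     (\<forall>\<delta>. \<exists>M :: nat fostruct. atomic_model V (L \<delta>) (T \<delta>) M \<and> sr_Sacks V M = \<delta>)"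

definition Sacks_club ::
    "vocab \<Rightarrow> fm \<Rightarrow> (cord \<Rightarrow> fm set) \<Rightarrow> (cord \<Rightarrow> fm set) \<Rightarrow> cord set \<Rightarrow>
     (cord \<Rightarrow> nat fostruct) \<Rightarrow> (cord \<Rightarrow> nat fostruct) \<Rightarrow> bool" where
  "Sacks_club V \<phi> L T C A B \<longleftrightarrow> club C \<and> (\<forall>\<kappa>\<in>C.
     omega < \<kappa> \<and> admissible (Lrel (base_code V \<phi>) \<kappa>) \<and>
     nonprincipal_types V (L \<kappa>) (T \<kappa>) \<noteq> {} \<and> countable (nonprincipal_types V (L \<kappa>) (T \<kappa>)) \<and>
     atomic_model V (L \<kappa>) (T \<kappa>) (A \<kappa>) \<and> sr_Sacks V (A \<kappa>) = \<kappa> \<and>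
     ctbl_struct V (B \<kappa>) \<and> models_th (B \<kappa>) (T \<kappa>) \<and>
     (\<forall>p\<in>nonprincipal_types V (L \<kappa>) (T \<kappa>). realizes (B \<kappa>) p) \<and>
     omega1_struct V (B \<kappa>) = \<kappa> \<and> sr_Sacks V (B \<kappa>) = csuc \<kappa>)"

end

theory Submission
  imports Defs
begin

text \<open>Since \<open>L (csuc \<gamma>)\<close> contains a formula isolating each realized type over \<open>L \<gamma>\<close>, two tuples with
  the same type over \<open>L (csuc \<gamma>)\<close> can be extended, back and forth, to tuples with the same type over
  \<open>L \<gamma>\<close>. So if two tuples of a model \<open>M\<close> have the same type over \<open>L \<kappa>\<close>, the tree of finite partial
  automorphisms above them has rank at least \<open>\<kappa>\<close> or an infinite branch. For \<open>M\<close> computed by \<open>X\<close>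
  this tree is computable in \<open>X\<close>; were it well-founded, its Kleene--Brouwer order would be an
  \<open>X\<close>-computable well-order of type below \<open>\<omega>\<^sub>1\<^sup>X = \<kappa>\<close>. Hence the tuples are conjugate under an
  automorphism. This homogeneity, and the realization of all types in both models, yield the
  back-and-forth system between \<open>M\<close> and \<open>M'\<close>. The model \<open>B \<kappa>\<close> also realizes the principal types:
  by consistency, the existential closure of a generator belongs to the complete theory \<open>T \<kappa>\<close>.\<close>

subsection \<open>Computable functions\<close>

text \<open>Two tuples with the same type over \<open>L \<kappa>\<close> admit, for each \<gamma> <
  \<kappa>, extensions that agree over \<open>L \<gamma>\<close>, but the matching element depends
  on \<gamma>, so the back-and-forth cannot simply be continued. The ordinal bound replaces the
  missing compactness: an \<open>X\<close>-computable tree whose ranks exhaust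
  \<open>omega1_oracle X\<close> has an infinite branch. This bound serves only trees computable in
  one oracle with the right ordinal. The two models may be computed by unrelated oracles, and the
  join of these may compute ordinals beyond \<kappa>. Therefore the bound is applied inside one
  model at a time, to automorphisms; the other model is reached by realizing a type anywhere and
  then moving the realization to the wanted place. One notion of node serves both searches: the
  prefix \<open>p\<close> fixes the tuples to be conjugated, and the empty prefix gives the final
  isomorphism.\<close>

lemma reval_det: "reval X f xs y \<Longrightarrow> reval X f xs z \<Longrightarrow> y = z"
proof (induction arbitrary: z rule: reval.induct)
  case (5 xs gs ys f v)
  from 5(4) obtain zs where zs: "list_all2 (\<lambda>g y. reval X g xs y) gs zs" "reval X f zs z"
    by (cases rule: reval.cases) auto
  have "ys = zs"
    using 5(1) zs(1) by (auto simp: list_all2_conv_all_nth intro!: nth_equalityI)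
  then show ?case using 5 zs by blast
next
  case (6 f xs y g)
  from 6(3) show ?case by (cases rule: reval.cases) (use 6 in auto)
next
  case (7 f g n xs y w)
  from 7(5) show ?case by (cases rule: reval.cases) (use 7 in auto)
next
  case (8 f n xs)
  from 8(4) have z: "reval X f (z # xs) 0" "\<And>m. m < z \<Longrightarrow> \<exists>y. reval X f (m # xs) (Suc y)"
    by (auto elim: reval.cases)
  have "\<not> z < n" using 8(3) z(1) by fastforce
  moreover have "\<not> n < z" using 8(2) z(2) by fastforce
  ultimately show ?case by simp
qed (auto elim: reval.cases)

text \<open>Values on lists of other lengths are left open, so \<open>hd\<close>, \<open>tl\<close>
  and indexing can be exchanged freely. Minimization is never introduced: the closure rules below
  use only composition and primitive recursion.\<close>

definition kf :: "nat set \<Rightarrow> nat \<Rightarrow> (nat list \<Rightarrow> nat) \<Rightarrow> bool" where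
  "kf X k f \<longleftrightarrow> (\<exists>r. \<forall>xs. length xs = k \<longrightarrow> reval X r xs (f xs))"

lemma kf_nth: "i < k \<Longrightarrow> kf X k (\<lambda>xs. xs ! i)"
  unfolding kf_def by (metis reval.intros(3))

lemma kf_comp:
  assumes "kf X (length gs) f" "\<forall>g\<in>set gs. kf X k g"
  shows "kf X k (\<lambda>xs. f (map (\<lambda>g. g xs) gs))"
proof -
  obtain r where r: "\<And>xs. length xs = length gs \<Longrightarrow> reval X r xs (f xs)"
    using assms(1) by (auto simp: kf_def)
  obtain q where q: "\<And>g xs. g \<in> set gs \<Longrightarrow> length xs = k \<Longrightarrow> reval X (q g) xs (g xs)"
    using assms(2) unfolding kf_def by metis
  have "reval X (RComp r (map q gs)) xs (f (map (\<lambda>g. g xs) gs))" if "length xs = k" for xs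
    by (rule reval.intros(5)[where ys = "map (\<lambda>g. g xs) gs"])
      (use r q that in \<open>auto simp: list_all2_conv_all_nth\<close>)
  then show ?thesis
    unfolding kf_def by blast
qed

lemma kf_comp1: "kf X 1 (\<lambda>xs. f (xs ! 0)) \<Longrightarrow> kf X k g \<Longrightarrow> kf X k (\<lambda>xs. f (g xs))"
  using kf_comp[of X "[g]" "\<lambda>xs. f (xs ! 0)" k] by simp

lemma kf_comp2:
  "kf X 2 (\<lambda>xs. f (xs ! 0) (xs ! 1)) \<Longrightarrow> kf X k g \<Longrightarrow> kf X k h \<Longrightarrow> kf X k (\<lambda>xs. f (g xs) (h xs))"
  using kf_comp[of X "[g, h]" "\<lambda>xs. f (xs ! 0) (xs ! 1)" k] by (simp add: numeral_2_eq_2)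

lemma kf_Suc:
  assumes "kf X k f"
  shows "kf X k (\<lambda>xs. Suc (f xs))"
proof (rule kf_comp1[where f = Suc, OF _ assms])
  show "kf X 1 (\<lambda>xs. Suc (xs ! 0))"
    unfolding kf_def
    by (rule exI[of _ RSuc]) (auto simp: length_Suc_conv intro: reval.intros)
qed

lemma kf_const: "kf X k (\<lambda>xs. c)"
proof (induction c)
  case 0
  then show ?case unfolding kf_def by (blast intro: reval.intros)
next
  case (Suc c)
  then show ?case by (rule kf_Suc)
qed

lemma kf_prim:
  assumes "kf X k f" "kf X (Suc (Suc k)) g"
  shows "kf X (Suc k) (\<lambda>xs. rec_nat (f (tl xs)) (\<lambda>n r. g (n # r # tl xs)) (hd xs))"
proof -
  obtain r q where r: "\<And>xs. length xs = k \<Longrightarrow> reval X r xs (f xs)"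
    and q: "\<And>xs. length xs = Suc (Suc k) \<Longrightarrow> reval X q xs (g xs)"
    using assms unfolding kf_def by blast
  have "reval X (RPrim r q) (n # xs) (rec_nat (f xs) (\<lambda>n r. g (n # r # xs)) n)"
    if "length xs = k" for n xs
    by (induction n) (use r q that in \<open>auto intro!: reval.intros\<close>)
  then show ?thesis
    unfolding kf_def by (intro exI[of _ "RPrim r q"]) (auto simp: length_Suc_conv)
qed

lemma kf_rec1:
  assumes "kf X 2 (\<lambda>xs. g (xs ! 0) (xs ! 1))"
  shows "kf X 1 (\<lambda>xs. rec_nat c g (xs ! 0))"
proof -
  have "kf X 1 (\<lambda>xs. rec_nat c g (hd xs))"
    using kf_prim[OF kf_const[of X 0 c], of "\<lambda>xs. g (xs ! 0) (xs ! 1)"] assms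
    by (simp add: numeral_2_eq_2)
  moreover have "hd xs = xs ! 0" if "length xs = 1" for xs :: "nat list"
    using that by (cases xs) auto
  ultimately show ?thesis
    unfolding kf_def by simp
qed

lemma kf_rec2:
  assumes "kf X 1 (\<lambda>xs. f (xs ! 0))" "kf X 3 (\<lambda>xs. g (xs ! 0) (xs ! 1) (xs ! 2))"
  shows "kf X 2 (\<lambda>xs. rec_nat (f (xs ! 1)) (\<lambda>n r. g n r (xs ! 1)) (xs ! 0))"
proof -
  have "kf X 2 (\<lambda>xs. rec_nat (f (tl xs ! 0)) (\<lambda>n r. g n r (tl xs ! 0)) (hd xs))"
    using kf_prim[of X 1 "\<lambda>xs. f (xs ! 0)" "\<lambda>xs. g (xs ! 0) (xs ! 1) (xs ! 2)"] assms
    by (simp add: numeral_2_eq_2 numeral_3_eq_3)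
  moreover have "hd xs = xs ! 0 \<and> tl xs ! 0 = xs ! 1" if "length xs = 2" for xs :: "nat list"
    using that by (cases xs) (auto simp: nth_tl)
  ultimately show ?thesis
    unfolding kf_def by simp
qed

lemma kf_add:
  assumes "kf X k f" "kf X k g"
  shows "kf X k (\<lambda>xs. f xs + g xs)"
proof (rule kf_comp2[where f = plus, OF _ assms])
  have *: "rec_nat y (\<lambda>n r. Suc r) x = x + y" for x y :: nat by (induction x) auto
  have "kf X 2 (\<lambda>xs. rec_nat (xs ! 1) (\<lambda>n r. Suc r) (xs ! 0))"
    by (rule kf_rec2[where f = "\<lambda>x. x"]) (intro kf_Suc kf_nth; simp)+
  then show "kf X 2 (\<lambda>xs. xs ! 0 + xs ! 1)" by (simp only: *)
qed

lemma kf_mult: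
  assumes "kf X k f" "kf X k g"
  shows "kf X k (\<lambda>xs. f xs * g xs)"
proof (rule kf_comp2[where f = times, OF _ assms])
  have *: "rec_nat 0 (\<lambda>n r. r + y) x = x * y" for x y :: nat by (induction x) auto
  have "kf X 2 (\<lambda>xs. rec_nat 0 (\<lambda>n r. r + (xs ! 1)) (xs ! 0))"
    by (rule kf_rec2[where f = "\<lambda>x. 0"]) (intro kf_add kf_const kf_nth; simp)+
  then show "kf X 2 (\<lambda>xs. xs ! 0 * xs ! 1)" by (simp only: *)
qed

lemma kf_pred:
  assumes "kf X k f"
  shows "kf X k (\<lambda>xs. f xs - 1)"
proof (rule kf_comp1[where f = "\<lambda>x. x - 1", OF _ assms])
  have *: "rec_nat 0 (\<lambda>n r. n) x = x - 1" for x :: nat by (cases x) auto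
  have "kf X 1 (\<lambda>xs. rec_nat 0 (\<lambda>n r. n) (xs ! 0))"
    by (rule kf_rec1) (intro kf_nth; simp)
  then show "kf X 1 (\<lambda>xs. xs ! 0 - 1)" by (simp only: *)
qed

lemma kf_diff:
  assumes "kf X k f" "kf X k g"
  shows "kf X k (\<lambda>xs. f xs - g xs)"
\<comment> \<open>Primitive recursion runs over the first argument, and it is the subtrahend that
  counts the predecessor steps; hence the swap.\<close>
proof (rule kf_comp2[where f = "\<lambda>x y. y - x", OF _ assms(2) assms(1)])
  have *: "rec_nat y (\<lambda>n r. r - 1) x = y - x" for x y :: nat by (induction x) auto
  have "kf X 2 (\<lambda>xs. rec_nat (xs ! 1) (\<lambda>n r. r - 1) (xs ! 0))"
    by (rule kf_rec2[where f = "\<lambda>x. x"]) (intro kf_pred kf_nth; simp)+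
  then show "kf X 2 (\<lambda>xs. xs ! 1 - xs ! 0)" by (simp only: *)
qed

lemma kf_triangle:
  assumes "kf X k f"
  shows "kf X k (\<lambda>xs. triangle (f xs))"
proof (rule kf_comp1[where f = triangle, OF _ assms])
  have *: "rec_nat 0 (\<lambda>n r. r + Suc n) x = triangle x" for x :: nat by (induction x) auto
  have "kf X 1 (\<lambda>xs. rec_nat 0 (\<lambda>n r. r + Suc n) (xs ! 0))"
    by (rule kf_rec1) (intro kf_add kf_Suc kf_nth; simp)
  then show "kf X 1 (\<lambda>xs. triangle (xs ! 0))" by (simp only: *)
qed

section \<open>Components of coded pairs\<close>

definition pfst :: "nat \<Rightarrow> nat" where "pfst z = fst (prod_decode z)"
definition psnd :: "nat \<Rightarrow> nat" where "psnd z = snd (prod_decode z)"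

lemma pfst_encode [simp]: "pfst (prod_encode (x, y)) = x"
  and psnd_encode [simp]: "psnd (prod_encode (x, y)) = y"
  by (simp_all add: pfst_def psnd_def)

lemma encode_pfst_psnd [simp]: "prod_encode (pfst z, psnd z) = z"
  by (simp add: pfst_def psnd_def)

text \<open>\<open>pfst z + psnd z\<close> is the largest \<open>r\<close> with \<open>triangle r \<le> z\<close>, and both components can be read off it.\<close>

lemma kf_diagonal: "kf X 1 (\<lambda>xs. pfst (xs ! 0) + psnd (xs ! 0))"
proof -
  \<comment> \<open>By truncated subtraction the increment is 1 exactly if
    \<open>triangle (Suc r) \<le> Suc n\<close>, that is, if a new diagonal begins at
    \<open>Suc n\<close>.\<close>
  have *: "rec_nat 0 (\<lambda>n r. r + (1 - (triangle (Suc r) - Suc n))) z = pfst z + psnd z" for z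
  proof (induction z)
    case 0
    have "prod_encode (0, 0) = 0" by (simp add: prod_encode_def)
    then show ?case by (metis add_0 pfst_encode psnd_encode rec_nat_0_imp)
  next
    case (Suc z)
    obtain m n where z: "z = prod_encode (m, n)" by (metis surj_pair prod_decode_inverse)
    have IH: "rec_nat 0 (\<lambda>n r. r + (1 - (triangle (Suc r) - Suc n))) z = m + n"
      using Suc z by simp
    show ?case
    proof (cases n)
      case 0
      then have s: "Suc z = prod_encode (0, Suc m)" by (simp add: z prod_encode_def)
      have "triangle (Suc m) - Suc z = 0" using 0 by (simp add: z prod_encode_def)
      then show ?thesis unfolding nat.rec(2) IH by (simp add: s 0)
    next
      case (Suc k)
      then have s: "Suc z = prod_encode (Suc m, k)" by (simp add: z prod_encode_def)
      have "triangle (Suc (m + n)) - Suc z > 0" using Suc by (simp add: z prod_encode_def)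
      then show ?thesis unfolding nat.rec(2) IH by (simp add: s Suc)
    qed
  qed
  have "kf X 1 (\<lambda>xs. rec_nat 0 (\<lambda>n r. r + (1 - (triangle (Suc r) - Suc n))) (xs ! 0))"
    by (rule kf_rec1) (intro kf_add kf_diff kf_triangle kf_Suc kf_const kf_nth; simp)
  then show ?thesis by (simp only: *)
qed

lemma kf_pfst:
  assumes "kf X k f"
  shows "kf X k (\<lambda>xs. pfst (f xs))"
proof (rule kf_comp1[where f = pfst, OF _ assms])
  have *: "z - triangle (pfst z + psnd z) = pfst z" for z
  proof -
    have "prod_encode (m, n) - triangle (m + n) = m" for m n
      by (simp add: prod_encode_def)
    from this[of "pfst z" "psnd z"] show ?thesis by simp
  qed
  have "kf X 1 (\<lambda>xs. xs ! 0 - triangle (pfst (xs ! 0) + psnd (xs ! 0)))"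
    by (intro kf_diff kf_triangle kf_diagonal kf_nth) simp
  then show "kf X 1 (\<lambda>xs. pfst (xs ! 0))" by (simp only: *)
qed

lemma kf_psnd:
  assumes "kf X k f"
  shows "kf X k (\<lambda>xs. psnd (f xs))"
proof (rule kf_comp1[where f = psnd, OF _ assms])
  have "kf X 1 (\<lambda>xs. (pfst (xs ! 0) + psnd (xs ! 0)) - pfst (xs ! 0))"
    by (intro kf_diff kf_diagonal kf_pfst kf_nth) simp
  then show "kf X 1 (\<lambda>xs. psnd (xs ! 0))" by simp
qed

lemma kf_pair: "kf X k f \<Longrightarrow> kf X k g \<Longrightarrow> kf X k (\<lambda>xs. prod_encode (f xs, g xs))"
  unfolding prod_encode_def by (simp add: kf_add kf_triangle)

text \<open>Tuples of arguments are packed into one number by iterated pairing, so that only unary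
  functions have to be composed.\<close>

definition cf :: "nat set \<Rightarrow> (nat \<Rightarrow> nat) \<Rightarrow> bool" where
  "cf X f \<longleftrightarrow> kf X 1 (\<lambda>xs. f (xs ! 0))"

definition dp :: "nat set \<Rightarrow> (nat \<Rightarrow> bool) \<Rightarrow> bool" where
  "dp X P \<longleftrightarrow> cf X (\<lambda>z. if P z then 1 else 0)"

lemma computable_in_iff: "computable_in X Y \<longleftrightarrow> dp X (\<lambda>z. z \<in> Y)"
proof -
  have "(\<forall>xs. length xs = 1 \<longrightarrow> P xs) \<longleftrightarrow> (\<forall>n. P [n])" for P :: "nat list \<Rightarrow> bool"
    by (auto simp: length_Suc_conv)
  then show ?thesis
    by (simp add: computable_in_def dp_def cf_def kf_def)
qed

named_theorems cf_intros

lemma cf_id [cf_intros]: "cf X (\<lambda>z. z)"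
  by (simp add: cf_def kf_nth)

lemma cf_const [cf_intros]: "cf X (\<lambda>z. c)"
  by (simp add: cf_def kf_const)

lemma cf_Suc [cf_intros]: "cf X f \<Longrightarrow> cf X (\<lambda>z. Suc (f z))"
  by (simp add: cf_def kf_Suc)

lemma cf_add [cf_intros]: "cf X f \<Longrightarrow> cf X g \<Longrightarrow> cf X (\<lambda>z. f z + g z)"
  by (simp add: cf_def kf_add)

lemma cf_mult [cf_intros]: "cf X f \<Longrightarrow> cf X g \<Longrightarrow> cf X (\<lambda>z. f z * g z)"
  by (simp add: cf_def kf_mult)

lemma cf_diff [cf_intros]: "cf X f \<Longrightarrow> cf X g \<Longrightarrow> cf X (\<lambda>z. f z - g z)"
  by (simp add: cf_def kf_diff)

lemma cf_pair [cf_intros]: "cf X f \<Longrightarrow> cf X g \<Longrightarrow> cf X (\<lambda>z. prod_encode (f z, g z))"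
  by (simp add: cf_def kf_pair)

lemma cf_pfst [cf_intros]: "cf X f \<Longrightarrow> cf X (\<lambda>z. pfst (f z))"
  by (simp add: cf_def kf_pfst)

lemma cf_psnd [cf_intros]: "cf X f \<Longrightarrow> cf X (\<lambda>z. psnd (f z))"
  by (simp add: cf_def kf_psnd)

lemma cf_comp: "cf X f \<Longrightarrow> cf X g \<Longrightarrow> cf X (\<lambda>z. f (g z))"
  unfolding cf_def by (rule kf_comp1)

lemma dp_comp: "dp X P \<Longrightarrow> cf X g \<Longrightarrow> dp X (\<lambda>z. P (g z))"
  unfolding dp_def by (rule cf_comp)

lemma cf_rec:
  assumes "cf X f" "cf X (\<lambda>w. g (pfst w) (pfst (psnd w)) (psnd (psnd w)))" "cf X b"
  shows "cf X (\<lambda>z. rec_nat (f z) (\<lambda>n r. g n r z) (b z))"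
proof -
  let ?g = "\<lambda>w. g (pfst w) (pfst (psnd w)) (psnd (psnd w))"
  have "kf X 3 (\<lambda>xs. ?g (prod_encode (xs ! 0, prod_encode (xs ! 1, xs ! 2))))"
    by (rule kf_comp1[where f = ?g]) (use assms(2) in \<open>auto simp: cf_def intro!: kf_pair kf_nth\<close>)
  then have "kf X 3 (\<lambda>xs. g (xs ! 0) (xs ! 1) (xs ! 2))" by simp
  with assms(1) have "kf X 2 (\<lambda>xs. rec_nat (f (xs ! 1)) (\<lambda>n r. g n r (xs ! 1)) (xs ! 0))"
    unfolding cf_def by (rule kf_rec2)
  then show ?thesis
    using kf_comp2[of X "\<lambda>x z. rec_nat (f z) (\<lambda>n r. g n r z) x" 1 "\<lambda>xs. b (xs ! 0)" "\<lambda>xs. xs ! 0"]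
      assms(3) kf_nth[of 0 1] by (simp add: cf_def)
qed

lemma cf_if [cf_intros]: "dp X P \<Longrightarrow> cf X f \<Longrightarrow> cf X g \<Longrightarrow> cf X (\<lambda>z. if P z then f z else g z)"
proof -
  assume a: "dp X P" "cf X f" "cf X g"
  have "cf X (\<lambda>z. (if P z then 1 else 0) * f z + (1 - (if P z then 1 else 0)) * g z)"
    by (intro cf_add cf_mult cf_diff cf_const a a(1)[unfolded dp_def])
  moreover have "(\<lambda>z. (if P z then 1 else 0) * f z + (1 - (if P z then 1 else 0)) * g z)
      = (\<lambda>z. if P z then f z else g z)" by auto
  ultimately show ?thesis by simp
qed

text \<open>Every connective is a case distinction. The predicate \<open>S\<close> stays free, so
  that each connective supplies its own shape and only the equivalence remains to be
  checked.\<close>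

lemma dp_if:
  assumes "dp X P" "dp X Q" "dp X R" "\<And>z. S z \<longleftrightarrow> (if P z then Q z else R z)"
  shows "dp X S"
proof -
  have "cf X (\<lambda>z. if P z then (if Q z then 1 else 0) else (if R z then 1 else 0))"
    by (intro cf_if assms(1-3) assms(1-3)[unfolded dp_def] cf_const)
  then show ?thesis
    unfolding dp_def by (rule back_subst[of "cf X"]) (auto simp: assms(4))
qed

lemma dp_const [cf_intros]: "dp X (\<lambda>z. c)"
  by (simp add: dp_def cf_const)

lemma dp_not [cf_intros]: "dp X P \<Longrightarrow> dp X (\<lambda>z. \<not> P z)"
  by (rule dp_if[of X P "\<lambda>_. False" "\<lambda>_. True"]) (auto simp: dp_const)

lemma dp_conj [cf_intros]: "dp X P \<Longrightarrow> dp X Q \<Longrightarrow> dp X (\<lambda>z. P z \<and> Q z)"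
  by (rule dp_if[of X P Q "\<lambda>_. False"]) (auto simp: dp_const)

lemma dp_disj [cf_intros]: "dp X P \<Longrightarrow> dp X Q \<Longrightarrow> dp X (\<lambda>z. P z \<or> Q z)"
  by (rule dp_if[of X P "\<lambda>_. True" Q]) (auto simp: dp_const)

lemma dp_imp [cf_intros]: "dp X P \<Longrightarrow> dp X Q \<Longrightarrow> dp X (\<lambda>z. P z \<longrightarrow> Q z)"
  by (rule dp_if[of X P Q "\<lambda>_. True"]) (auto simp: dp_const)

lemma dp_iff: "dp X P \<Longrightarrow> dp X Q \<Longrightarrow> dp X (\<lambda>z. P z \<longleftrightarrow> Q z)"
  by (rule dp_if[of X P Q "\<lambda>z. \<not> Q z"]) (auto intro: dp_not)

lemma dp_less [cf_intros]: "cf X f \<Longrightarrow> cf X g \<Longrightarrow> dp X (\<lambda>z. f z < g z)"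
proof -
  assume a: "cf X f" "cf X g"
  have "cf X (\<lambda>z. 1 - (Suc (f z) - g z))"
    by (intro cf_diff cf_Suc cf_const a)
  then show ?thesis
    unfolding dp_def by (rule back_subst[of "cf X"]) auto
qed

lemma dp_le [cf_intros]: "cf X f \<Longrightarrow> cf X g \<Longrightarrow> dp X (\<lambda>z. f z \<le> g z)"
  unfolding less_Suc_eq_le[symmetric] by (intro dp_less cf_Suc)

lemma dp_eq [cf_intros]: "cf X f \<Longrightarrow> cf X g \<Longrightarrow> dp X (\<lambda>z. f z = g z)"
  unfolding eq_iff by (intro dp_conj dp_le)

lemma dp_Ex [cf_intros]:
  assumes "cf X b" "dp X (\<lambda>w. P (pfst w) (psnd w))"
  shows "dp X (\<lambda>z. \<exists>i<b z. P i z)"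
proof -
  let ?g = "\<lambda>n r z. if P n z then 1 else r"
  have "dp X (\<lambda>w. P (pfst w) (psnd (psnd w)))"
    using dp_comp[OF assms(2), of "\<lambda>w. prod_encode (pfst w, psnd (psnd w))"]
    by (simp add: cf_intros)
  then have "cf X (\<lambda>z. rec_nat 0 (\<lambda>n r. ?g n r z) (b z))"
    by (intro cf_rec[where g = ?g] cf_intros assms)
  moreover have "rec_nat 0 (\<lambda>n r. ?g n r z) m = (if \<exists>i<m. P i z then 1 else 0 :: nat)" for z m
    by (induction m) (auto simp: less_Suc_eq)
  ultimately show ?thesis by (simp add: dp_def)
qed

lemma dp_All [cf_intros]:
  assumes "cf X b" "dp X (\<lambda>w. P (pfst w) (psnd w))"
  shows "dp X (\<lambda>z. \<forall>i<b z. P i z)"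
proof -
  have "dp X (\<lambda>z. \<not> (\<exists>i<b z. \<not> P i z))"
    by (intro dp_not dp_Ex assms)
  then show ?thesis by simp
qed

section \<open>Lists coded by numbers\<close>

definition llen :: "nat \<Rightarrow> nat" where "llen c = length (list_decode c)"

definition lnth :: "nat \<Rightarrow> nat \<Rightarrow> nat" where
  "lnth c i = (if i < llen c then list_decode c ! i else 0)"

lemma list_decode_nonzero:
  "0 < c \<Longrightarrow> list_decode c = pfst (c - 1) # list_decode (psnd (c - 1))"
  by (cases c) (auto simp: pfst_def psnd_def split: prod.split)

lemma prod_decode_0: "pfst 0 = 0" "psnd 0 = 0"
  using pfst_encode[of 0 0] psnd_encode[of 0 0] by (simp_all add: prod_encode_def)

text \<open>A nonempty list is coded by the successor of the pair of its head and the code of its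
  tail, so \<open>psnd (r - 1)\<close> codes the tail. The code \<open>0\<close> of the empty list
  is a fixed point because \<open>psnd 0 = 0\<close>.\<close>

lemma list_decode_iterate:
  "list_decode (rec_nat c (\<lambda>_ r. psnd (r - 1)) i) = drop i (list_decode c)"
proof (induction i)
  case (Suc i)
  let ?r = "rec_nat c (\<lambda>_ r. psnd (r - 1)) i"
  have "list_decode (psnd (?r - 1)) = tl (list_decode ?r)"
    by (cases "?r = 0") (simp_all add: prod_decode_0 list_decode_nonzero)
  then show ?case using Suc by (simp add: drop_Suc tl_drop)
qed simp

lemma cf_iterate: "cf X f \<Longrightarrow> cf X g \<Longrightarrow> cf X (\<lambda>z. rec_nat (f z) (\<lambda>_ r. psnd (r - 1)) (g z))"
  by (rule cf_rec[where g = "\<lambda>_ r _. psnd (r - 1)"]) (simp_all add: cf_intros)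

lemma cf_lnth [cf_intros]:
  assumes "cf X f" "cf X g"
  shows "cf X (\<lambda>z. lnth (f z) (g z))"
proof -
  have "lnth c i = pfst (rec_nat c (\<lambda>_ r. psnd (r - 1)) i - 1)" for c i
  proof (cases "rec_nat c (\<lambda>_ r. psnd (r - 1)) i = 0")
    case True
    then have "drop i (list_decode c) = []"
      using list_decode_iterate[of c i] by simp
    then show ?thesis using True by (simp add: lnth_def llen_def prod_decode_0)
  next
    case False
    then have "drop i (list_decode c) = pfst (rec_nat c (\<lambda>_ r. psnd (r - 1)) i - 1) #
        list_decode (psnd (rec_nat c (\<lambda>_ r. psnd (r - 1)) i - 1))"
      using list_decode_iterate[of c i] list_decode_nonzero by simp
    then show ?thesis
      by (metis hd_drop_conv_nth list.sel(1) list.distinct(1) llen_def lnth_def drop_all not_less)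
  qed
  then show ?thesis
    by (simp only:) (intro cf_intros cf_iterate assms)
qed

lemma length_le_list_encode: "length xs \<le> list_encode xs"
proof (induction xs)
  case (Cons x xs)
  then show ?case using le_prod_encode_2[of "list_encode xs" x] by simp
qed simp

text \<open>The length is the number of nonempty iterated tails. Counting up to the code itself is
  enough, since a code is at least the length of its list.\<close>

lemma cf_llen [cf_intros]:
  assumes "cf X f"
  shows "cf X (\<lambda>z. llen (f z))"
proof -
  let ?it = "\<lambda>c i. rec_nat c (\<lambda>_ r. psnd (r - 1)) i"
  have it0: "?it c i = 0 \<longleftrightarrow> llen c \<le> i" for c i
    using list_decode_iterate[of c i] list_decode_eq[of "?it c i" 0] by (simp add: llen_def)
  have "rec_nat 0 (\<lambda>i r. if ?it c i = 0 then r else Suc r) m = min m (llen c)" for c m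
    by (induction m) (simp_all only: nat.rec it0, auto)
  moreover have "llen c \<le> c" for c
    using length_le_list_encode[of "list_decode c"] by (simp add: llen_def)
  ultimately have "llen c = rec_nat 0 (\<lambda>i r. if ?it c i = 0 then r else Suc r) c" for c
    by (simp add: min_absorb2)
  moreover have "cf X (\<lambda>z. rec_nat 0 (\<lambda>i r. if ?it (f z) i = 0 then r else Suc r) (f z))"
    by (rule cf_rec[where g = "\<lambda>i r z. if ?it (f z) i = 0 then r else Suc r"])
      (intro cf_intros cf_iterate assms cf_comp[OF assms])+
  ultimately show ?thesis by simp
qed

unbundle cardinal_syntax

subsection \<open>Computable ordinals\<close>

text \<open>The ordinal \<kappa> as a reflexive well-order, so that comparability and initial
  segments come from the library relations \<open>=o\<close> and \<open><o\<close>.\<close>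

definition cle :: "cord \<Rightarrow> cord rel" where
  "cle \<kappa> = {(\<alpha>, \<beta>). \<alpha> \<le> \<beta> \<and> \<beta> < \<kappa>}"

lemma Field_cle [simp]: "Field (cle \<kappa>) = {..<\<kappa>}"
  by (auto simp: Field_def cle_def)

lemma ordIso_cleI:
  assumes "bij_betw h A {..<\<kappa>}"
  shows "{(x, y). x \<in> A \<and> y \<in> A \<and> h x \<le> h y} =o cle \<kappa>" (is "?R =o _")
proof -
  have inj: "inj_on h A" and img: "h ` A = {..<\<kappa>}"
    using assms by (auto simp: bij_betw_def)
  have wo: "Well_order {(x, y). x \<in> A \<and> y \<in> A \<and> h x \<le> h y}" if "inj_on h A" for h :: "'b \<Rightarrow> cord" and A
  proof -
    let ?R = "{(x, y). x \<in> A \<and> y \<in> A \<and> h x \<le> h y}"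
    have F: "Field ?R = A" by (auto simp: Field_def)
    have "wf (inv_image {(x, y :: cord). x < y} h)" by (simp add: wf)
    moreover have "?R - Id \<subseteq> inv_image {(x, y :: cord). x < y} h"
      using that by (auto simp: inv_image_def inj_on_def order_less_le)
    ultimately have "wf (?R - Id)" by (rule wf_subset)
    then show ?thesis
      unfolding order_on_defs F using that
      by (auto simp: refl_on_def trans_def antisym_def total_on_def inj_on_def)
  qed
  have R: "Well_order ?R" using inj by (rule wo)
  have K: "cle \<kappa> = {(x, y). x \<in> {..<\<kappa>} \<and> y \<in> {..<\<kappa>} \<and> id x \<le> id y}"
    by (auto simp: cle_def)
  have "Well_order (cle \<kappa>)" unfolding K by (rule wo) simp
  moreover have "Field ?R = A" by (auto simp: Field_def)
  moreover have "iso ?R (cle \<kappa>) h"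
    unfolding iso_iff2 Field_cle \<open>Field ?R = A\<close> using assms img by (auto simp: cle_def)
  ultimately show ?thesis
    using R unfolding ordIso_def by auto
qed

lemma Well_order_cle: "Well_order (cle \<kappa>)"
  using ordIso_cleI[of id "{..<\<kappa>}" \<kappa>] by (auto simp: ordIso_def)

lemma iso_cle:
  "iso R (cle \<alpha>) h \<longleftrightarrow> bij_betw h (Field R) {..<\<alpha>} \<and>
     (\<forall>x\<in>Field R. \<forall>y\<in>Field R. (x, y) \<in> R \<longleftrightarrow> h x \<le> h y)"
  unfolding iso_iff2 Field_cle by (auto simp: cle_def bij_betw_def)

lemma computable_ordinal_iff:
  "computable_ordinal X \<alpha> \<longleftrightarrow> (\<exists>R. computable_in X (prod_encode ` R) \<and> R =o cle \<alpha>)"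
proof -
  have *: "R =o cle \<alpha> \<longleftrightarrow> Well_order R \<and> (\<exists>h. iso R (cle \<alpha>) h)" for R :: "nat rel"
    using Well_order_cle[of \<alpha>] by (simp add: ordIso_def)
  show ?thesis
    unfolding computable_ordinal_def * iso_cle by (rule refl)
qed

lemma computable_in_prod_encode:
  "computable_in X (prod_encode ` R) \<longleftrightarrow> dp X (\<lambda>z. (pfst z, psnd z) \<in> R)"
proof -
  have "z \<in> prod_encode ` R \<longleftrightarrow> (pfst z, psnd z) \<in> R" for z
    by (metis encode_pfst_psnd imageI image_iff pfst_encode psnd_encode surj_pair)
  then show ?thesis by (simp add: computable_in_iff)
qed

lemma cle_ordLess: "\<alpha> < \<beta> \<Longrightarrow> cle \<alpha> <o cle \<beta>"
proof -
  assume a: "\<alpha> < \<beta>"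
  then have "cle \<alpha> = Restr (cle \<beta>) (underS (cle \<beta>) \<alpha>)"
    by (auto simp: cle_def underS_def)
  then show ?thesis
    using a Well_order_cle ordLess_iff_ordIso_Restr[of "cle \<beta>" "cle \<alpha>"] ordIso_reflexive
    by (metis Field_cle lessThan_iff)
qed

lemma cle_ordIso_imp_eq: "cle \<alpha> =o cle \<beta> \<Longrightarrow> \<alpha> = \<beta>"
  by (metis cle_ordLess linorder_neqE not_ordLess_ordIso ordIso_symmetric)

text \<open>Burali-Forti: if there were only countably many countable ordinals, they would form a
  hereditarily countable set, itself an ordinal and hence its own element.\<close>

lemma uncountable_cord: "uncountable (UNIV :: cord set)"
proof
  assume c: "countable (UNIV :: cord set)"
  define s where "s = hset (range Rep_cord)"
  have e: "elts s = {x. ordinal_hc x}"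
    using c type_definition.Rep_range[OF type_definition_cord]
      elts_hset[OF countable_image[OF c, of Rep_cord]] by (simp add: s_def)
  have "transitive_hc s"
    unfolding transitive_hc_def e using ordinal_elts by blast
  moreover have "\<forall>y\<in>elts s. transitive_hc y"
    unfolding e by (simp add: ordinal_hc_def)
  ultimately have "ordinal_hc s"
    by (simp add: ordinal_hc_def[of s])
  then have "(s, s) \<in> {(x, y). x \<in> elts y}" using e by simp
  then show False using wf_elts by (meson wf_not_refl)
qed

instance recf :: countable by countable_datatype

text \<open>There are countably many programs; by \<open>reval_det\<close> a program decides at most
  one relation, and a relation has at most one order type.\<close>

lemma countable_computable_ordinals: "countable {\<alpha>. computable_ordinal X \<alpha>}"
proof -
  define P where "P f \<alpha> \<longleftrightarrow> (\<exists>R. (\<forall>n. reval X f [n] (if n \<in> prod_encode ` R then 1 else 0)) \<and>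
    (R :: nat rel) =o cle \<alpha>)" for f \<alpha>
  define g where "g \<alpha> = (SOME f. P f \<alpha>)" for \<alpha>
  have g: "P (g \<alpha>) \<alpha>" if "computable_ordinal X \<alpha>" for \<alpha>
    unfolding g_def
    by (rule someI_ex) (use that in \<open>unfold computable_ordinal_iff computable_in_def P_def, blast\<close>)
  have eq: "\<alpha> = \<beta>" if P\<alpha>: "P f \<alpha>" and P\<beta>: "P f \<beta>" for f \<alpha> \<beta>
  proof -
    obtain R where R: "\<forall>n. reval X f [n] (if n \<in> prod_encode ` R then 1 else 0)" "R =o cle \<alpha>"
      using P\<alpha> unfolding P_def by blast
    obtain R' where R': "\<forall>n. reval X f [n] (if n \<in> prod_encode ` R' then 1 else 0)" "R' =o cle \<beta>"
      using P\<beta> unfolding P_def by blast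
    have "n \<in> prod_encode ` R \<longleftrightarrow> n \<in> prod_encode ` R'" for n
      using reval_det[OF spec[OF R(1), of n] spec[OF R'(1), of n]] by (auto split: if_splits)
    then have "R = R'"
      by (metis inj_image_eq_iff inj_prod_encode set_eqI)
    then show ?thesis
      using R(2) R'(2) cle_ordIso_imp_eq ordIso_symmetric ordIso_transitive by blast
  qed
  have "inj_on g {\<alpha>. computable_ordinal X \<alpha>}"
    by (rule inj_onI) (metis g eq mem_Collect_eq)
  moreover have "countable (g ` {\<alpha>. computable_ordinal X \<alpha>})"
    by (rule countable_subset[OF subset_UNIV]) simp
  ultimately show ?thesis
    by (rule countable_image_inj_on[rotated])
qed

text \<open>The \<open>LEAST\<close> defining \<open>omega1_oracle\<close> is attained because
  \<open>cord\<close> is uncountable while the computable ordinals are not.\<close>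

lemma not_computable_omega1: "\<not> computable_ordinal X (omega1_oracle X)"
proof -
  have "\<exists>\<alpha>. \<not> computable_ordinal X \<alpha>"
    using countable_computable_ordinals[of X] uncountable_cord
    by (metis (mono_tags) UNIV_eq_I mem_Collect_eq)
  then show ?thesis
    unfolding omega1_oracle_def by (rule LeastI_ex)
qed

lemma computable_less_omega1: "\<alpha> < omega1_oracle X \<Longrightarrow> computable_ordinal X \<alpha>"
  unfolding omega1_oracle_def using not_less_Least by blast

lemma less_csuc_iff: "\<alpha> < csuc \<beta> \<longleftrightarrow> \<alpha> \<le> \<beta>"
proof
  show "\<alpha> < csuc \<beta> \<Longrightarrow> \<alpha> \<le> \<beta>"
    unfolding csuc_def using not_less_Least by (metis not_le)
qed (use less_csuc in \<open>blast intro: order_le_less_trans\<close>)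

lemma csuc_le_iff: "csuc \<alpha> \<le> \<beta> \<longleftrightarrow> \<alpha> < \<beta>"
  by (metis less_csuc_iff not_le)

text \<open>The new largest element is coded by \<open>0\<close>.\<close>

lemma computable_csuc:
  assumes "computable_ordinal X \<alpha>"
  shows "computable_ordinal X (csuc \<alpha>)"
proof -
  obtain R where R: "dp X (\<lambda>z. (pfst z, psnd z) \<in> R)" "R =o cle \<alpha>"
    using assms by (auto simp: computable_ordinal_iff computable_in_prod_encode)
  then obtain h where wo: "Well_order R" and h: "bij_betw h (Field R) {..<\<alpha>}"
      "\<And>x y. x \<in> Field R \<Longrightarrow> y \<in> Field R \<Longrightarrow> (x, y) \<in> R \<longleftrightarrow> h x \<le> h y"
    unfolding ordIso_def using iso_cle by blast
  have R_iff: "(x, y) \<in> R \<longleftrightarrow> x \<in> Field R \<and> y \<in> Field R \<and> h x \<le> h y" for x y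
    using h(2) by (auto simp: Field_def)
  define g where "g = case_nat \<alpha> h"
  let ?A = "insert 0 (Suc ` Field R)"
  let ?R = "{(x, y). x \<in> ?A \<and> y \<in> ?A \<and> g x \<le> g y}"
  have lt: "h x < \<alpha>" if "x \<in> Field R" for x
    using h(1) that by (auto simp: bij_betw_def)
  have "bij_betw g ?A {..<csuc \<alpha>}"
    unfolding bij_betw_def
  proof
    show "inj_on g ?A"
      using h(1) lt by (auto simp: inj_on_def g_def bij_betw_def)
    have "g ` ?A = insert \<alpha> (h ` Field R)"
      by (auto simp: g_def image_image)
    then show "g ` ?A = {..<csuc \<alpha>}"
      using h(1) by (auto simp: bij_betw_def less_csuc_iff)
  qed
  then have iso: "?R =o cle (csuc \<alpha>)" by (rule ordIso_cleI)
  have "(x, y) \<in> ?R \<longleftrightarrow> (if y = 0 then x = 0 \<or> (x - 1, x - 1) \<in> R else x \<noteq> 0 \<and> (x - 1, y - 1) \<in> R)"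
    for x y
  proof (cases x; cases y)
    fix n assume "x = 0" "y = Suc n"
    then show ?thesis using lt[of n] by (auto simp: g_def)
  next
    fix n assume "x = Suc n" "y = 0"
    then show ?thesis using lt[of n] by (auto simp: g_def R_iff)
  qed (auto simp: g_def R_iff)
  then have *: "(\<lambda>z. (pfst z, psnd z) \<in> ?R) = (\<lambda>z. (psnd z = 0 \<and> (pfst z = 0 \<or> (pfst z - 1, pfst z - 1) \<in> R)) \<or>
      (psnd z \<noteq> 0 \<and> pfst z \<noteq> 0 \<and> (pfst z - 1, psnd z - 1) \<in> R))"
    by auto
  have R': "dp X (\<lambda>z. (f z, g z) \<in> R)" if "cf X f" "cf X g" for f g
    using dp_comp[OF R(1), of "\<lambda>z. prod_encode (f z, g z)"] that by (simp add: cf_pair)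
  have "dp X (\<lambda>z. (pfst z, psnd z) \<in> ?R)"
    unfolding * by (intro cf_intros R')
  with iso show ?thesis
    unfolding computable_ordinal_iff computable_in_prod_encode by blast
qed

lemma limit_omega1:
  assumes "omega1_oracle X \<noteq> 0"
  shows "limit_ord (omega1_oracle X)"
  unfolding limit_ord_def
proof (intro conjI allI impI assms)
  fix \<beta> assume "\<beta> < omega1_oracle X"
  then show "csuc \<beta> < omega1_oracle X"
    using computable_csuc[OF computable_less_omega1] not_computable_omega1
    by (metis csuc_le_iff order_le_less)
qed

text \<open>Otherwise \<open>omega1_oracle X\<close> would be the type of \<open>R\<close> or of an
  initial segment of \<open>R\<close>. Such a segment is again computable, as membership below a
  fixed \<open>a\<close> is decided by \<open>R\<close>; this contradicts
  \<open>not_computable_omega1\<close>.\<close>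

lemma ordLess_omega1:
  assumes R: "Well_order R" "dp X (\<lambda>z. (pfst z, psnd z) \<in> R)"
  shows "R <o cle (omega1_oracle X)" (is "_ <o cle ?\<kappa>")
proof (rule ccontr)
  assume "\<not> R <o cle ?\<kappa>"
  then have "cle ?\<kappa> \<le>o R"
    using ordLess_or_ordLeq[OF R(1) Well_order_cle] by blast
  then consider "cle ?\<kappa> =o R" | a where "a \<in> Field R" "cle ?\<kappa> =o Restr R (underS R a)"
    using ordLeq_iff_ordLess_or_ordIso ordLess_iff_ordIso_Restr[OF R(1) Well_order_cle] by blast
  then have "computable_ordinal X ?\<kappa>"
  proof cases
    case 1
    then show ?thesis
      using R(2) ordIso_symmetric unfolding computable_ordinal_iff computable_in_prod_encode by blast
  next
    case 2
    have R': "dp X (\<lambda>z. (f z, g z) \<in> R)" if "cf X f" "cf X g" for f g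
      using dp_comp[OF R(2), of "\<lambda>z. prod_encode (f z, g z)"] that by (simp add: cf_pair)
    have "(\<lambda>z. (pfst z, psnd z) \<in> Restr R (underS R a)) =
        (\<lambda>z. (pfst z, psnd z) \<in> R \<and> \<not> pfst z = a \<and> (pfst z, a) \<in> R \<and> \<not> psnd z = a \<and> (psnd z, a) \<in> R)"
      by (auto simp: underS_def)
    then have "dp X (\<lambda>z. (pfst z, psnd z) \<in> Restr R (underS R a))"
      by (simp only:) (intro cf_intros R')
    then show ?thesis
      using 2(2) ordIso_symmetric unfolding computable_ordinal_iff computable_in_prod_encode by blast
  qed
  then show False using not_computable_omega1 by blast
qed

subsection \<open>Computable well-founded trees\<close>

lemma path_exists:
  assumes "P []" "\<And>s. P s \<Longrightarrow> \<exists>x. P (s @ [x])"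
  obtains f where "\<And>k. P (map f [0..<k])"
proof -
  define g where "g = rec_nat [] (\<lambda>_ s. s @ [SOME x. P (s @ [x])])"
  define f where "f k = (SOME x. P (g k @ [x]))" for k
  have "g k = map f [0..<k] \<and> P (g k)" for k
    by (induction k) (auto simp: g_def f_def assms(1) intro: someI_ex[OF assms(2)])
  then show ?thesis using that[of f] by metis
qed

definition gt_lex :: "nat list rel" where
  "gt_lex = lexord {(a, b). b < a}"

lemma gt_lex_simps [simp]:
  "(s, []) \<notin> gt_lex"
  "([], t) \<in> gt_lex \<longleftrightarrow> t \<noteq> []"
  "(a # s, b # t) \<in> gt_lex \<longleftrightarrow> b < a \<or> a = b \<and> (s, t) \<in> gt_lex"
  "(s @ u, s @ v) \<in> gt_lex \<longleftrightarrow> (u, v) \<in> gt_lex"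
  by (auto simp: gt_lex_def neq_Nil_conv irrefl_def)

text \<open>Serves decidability on codes: the right-hand side has bounded quantifiers only. The
  index \<open>i\<close> is the first place of difference, and \<open>i = length t\<close> is the
  case that \<open>s\<close> properly extends \<open>t\<close>.\<close>

lemma gt_lex_index:
  "(t, s) \<in> gt_lex \<longleftrightarrow> (\<exists>i\<le>length t. i < length s \<and> (\<forall>j<i. s ! j = t ! j) \<and>
     (i < length t \<longrightarrow> s ! i < t ! i))"
proof (induction t arbitrary: s)
  case Nil
  then show ?case by auto
next
  case (Cons a t)
  show ?case
  proof (cases s)
    case (Cons b s')
    have "(\<exists>i\<le>length (a # t). i < length s \<and> (\<forall>j<i. s ! j = (a # t) ! j) \<and>
        (i < length (a # t) \<longrightarrow> s ! i < (a # t) ! i)) \<longleftrightarrow>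
      b < a \<or> b = a \<and> (\<exists>i\<le>length t. i < length s' \<and> (\<forall>j<i. s' ! j = t ! j) \<and>
        (i < length t \<longrightarrow> s' ! i < t ! i))" (is "?l \<longleftrightarrow> ?r")
    proof
      assume ?l
      then obtain i where i: "i \<le> length (a # t)" "i < length s" "\<forall>j<i. s ! j = (a # t) ! j"
        "i < length (a # t) \<longrightarrow> s ! i < (a # t) ! i" by blast
      show ?r
      proof (cases i)
        case 0
        then show ?thesis using i Cons by auto
      next
        case (Suc k)
        then have "b = a" using i(3) Cons by auto
        moreover have "s' ! j = t ! j" if "j < k" for j
          using i(3)[rule_format, of "Suc j"] that Suc Cons by simp
        ultimately show ?thesis using i Suc Cons by auto
      qed
    next
      assume ?r
      then show ?l
      proof
        assume "b < a"
        then show ?l using Cons by (intro exI[of _ 0]) auto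
      next
        assume "b = a \<and> (\<exists>i\<le>length t. i < length s' \<and> (\<forall>j<i. s' ! j = t ! j) \<and>
          (i < length t \<longrightarrow> s' ! i < t ! i))"
        then obtain i where "b = a" "i \<le> length t" "i < length s'" "\<forall>j<i. s' ! j = t ! j"
          "i < length t \<longrightarrow> s' ! i < t ! i" by blast
        then show ?l using Cons by (intro exI[of _ "Suc i"]) (auto simp: nth_Cons')
      qed
    qed
    then show ?thesis using Cons.IH[of s'] Cons by auto
  qed simp
qed

text \<open>The Kleene--Brouwer order: proper extensions are smaller, whence both reversals.\<close>

definition kb :: "nat list set \<Rightarrow> nat rel" where
  "kb Tr = {(c, d). list_decode c \<in> Tr \<and> list_decode d \<in> Tr \<and>
     (c = d \<or> (list_decode d, list_decode c) \<in> gt_lex)}"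

text \<open>Suppose a set of nodes has no minimal element. \<open>P s\<close> says that some
  nonempty set of this kind consists of extensions of \<open>s\<close>. Passing to the least
  possible next entry preserves this, and iterating yields an infinite path.\<close>

lemma kb_minimal:
  assumes closed: "\<And>s t. s @ t \<in> Tr \<Longrightarrow> s \<in> Tr"
    and no_path: "\<And>f. \<exists>k. map f [0..<k] \<notin> Tr"
    and Q: "Q \<subseteq> Tr" "Q \<noteq> {}"
  shows "\<exists>s\<in>Q. \<forall>t\<in>Q. (s, t) \<notin> gt_lex"
proof (rule ccontr)
  assume bad: "\<not> ?thesis"
  define P where "P s \<longleftrightarrow> (\<exists>Q\<subseteq>Tr. Q \<noteq> {} \<and> (\<forall>q\<in>Q. \<exists>u. q = s @ u) \<and>
    (\<forall>q\<in>Q. \<exists>t\<in>Q. (q, t) \<in> gt_lex))" for s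
  have P0: "P []" unfolding P_def using bad Q by (intro exI[of _ Q]) auto
  have step: "\<exists>x. P (s @ [x])" if P: "P s" for s
  proof -
    obtain Q where Q: "Q \<subseteq> Tr" "Q \<noteq> {}" "\<And>q. q \<in> Q \<Longrightarrow> \<exists>u. q = s @ u"
      "\<And>q. q \<in> Q \<Longrightarrow> \<exists>t\<in>Q. (q, t) \<in> gt_lex"
      using P unfolding P_def by blast
    obtain q where q: "q \<in> Q" using Q(2) by blast
    obtain t where t: "t \<in> Q" "(q, t) \<in> gt_lex" using Q(4)[OF q] by blast
    \<comment> \<open>\<open>s\<close> is the largest among its own extensions, so whatever lies
      below \<open>q\<close> extends \<open>s\<close> properly.\<close>
    have "t \<noteq> s" using t(2) Q(3)[OF q] gt_lex_simps(4)[of s _ "[]"] by auto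
    then have ex: "\<exists>x u. s @ x # u \<in> Q"
      using Q(3)[OF t(1)] t(1) by (metis append_Nil2 neq_Nil_conv)
    define x where "x = (LEAST x. \<exists>u. s @ x # u \<in> Q)"
    have x: "\<exists>u. s @ x # u \<in> Q" unfolding x_def using ex by (rule LeastI_ex)
    have least: "x \<le> y" if "s @ y # u \<in> Q" for y u
      unfolding x_def by (rule Least_le) (use that in blast)
    let ?Q = "{q \<in> Q. \<exists>u. q = s @ x # u}"
    \<comment> \<open>Going down from an extension of \<open>s @ [x]\<close> cannot raise the entry
      after \<open>s\<close>, and by minimality of \<open>x\<close> cannot lower it, so the descent
      stays in \<open>?Q\<close>.\<close>
    have "\<exists>t\<in>?Q. (q, t) \<in> gt_lex" if "q \<in> ?Q" for q
    proof -
      from that obtain u where u: "q = s @ x # u" "q \<in> Q" by blast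
      obtain t where t: "t \<in> Q" "(q, t) \<in> gt_lex" using Q(4)[OF u(2)] by blast
      obtain v where v: "t = s @ v" using Q(3)[OF t(1)] by blast
      with t(2) u(1) obtain y w where "v = y # w"
        using gt_lex_simps(4)[of s "x # u" "[]"] by (cases v) auto
      with v t u(1) least[of y w] have "t = s @ x # w" by auto
      with t show ?thesis by blast
    qed
    then show ?thesis
      unfolding P_def using x Q(1) by (intro exI[of _ x] exI[of _ ?Q]) auto
  qed
  obtain f where "\<And>k. P (map f [0..<k])"
    using path_exists[of P, OF P0 step] by blast
  moreover have "s \<in> Tr" if "P s" for s
  proof -
    from that obtain Q where "Q \<subseteq> Tr" "Q \<noteq> {}" "\<forall>q\<in>Q. \<exists>u. q = s @ u"
      unfolding P_def by blast
    then obtain q where "q \<in> Q" "q \<in> Tr" by blast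
    with \<open>\<forall>q\<in>Q. \<exists>u. q = s @ u\<close> obtain u where "s @ u \<in> Tr" by metis
    then show ?thesis by (rule closed)
  qed
  ultimately show False using no_path by blast
qed

lemma Well_order_kb:
  assumes closed: "\<And>s t. s @ t \<in> Tr \<Longrightarrow> s \<in> Tr"
    and no_path: "\<And>f. \<exists>k. map f [0..<k] \<notin> Tr"
  shows "Well_order (kb Tr)"
proof -
  have irrefl: "(s, s) \<notin> gt_lex" for s
    using gt_lex_simps(4)[of s "[]" "[]"] by simp
  have trans: "(s, t) \<in> gt_lex \<Longrightarrow> (t, u) \<in> gt_lex \<Longrightarrow> (s, u) \<in> gt_lex" for s t u
    unfolding gt_lex_def by (rule lexord_trans) (auto simp: trans_def)
  have total: "(s, t) \<in> gt_lex \<or> s = t \<or> (t, s) \<in> gt_lex" for s t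
    unfolding gt_lex_def by (rule lexord_linear) auto
  have "wf (kb Tr - Id)"
    unfolding wf_eq_minimal
  proof (intro allI impI)
    fix Q :: "nat set" and x assume x: "x \<in> Q"
    show "\<exists>z\<in>Q. \<forall>y. (y, z) \<in> kb Tr - Id \<longrightarrow> y \<notin> Q"
    proof (cases "list_decode ` Q \<inter> Tr = {}")
      case True
      then show ?thesis using x by (auto simp: kb_def)
    next
      case False
      then obtain s where s: "s \<in> list_decode ` Q \<inter> Tr"
          "\<forall>t\<in>list_decode ` Q \<inter> Tr. (s, t) \<notin> gt_lex"
        using kb_minimal[of Tr "list_decode ` Q \<inter> Tr"] closed no_path by blast
      then show ?thesis by (auto simp: kb_def)
    qed
  qed
  moreover have "trans (kb Tr)"
    using trans by (auto simp: trans_def kb_def)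
  moreover have "antisym (kb Tr)"
    using trans irrefl by (auto simp: antisym_def kb_def)
  moreover have "total_on (Field (kb Tr)) (kb Tr)"
  proof (rule total_onI)
    fix c d assume "c \<in> Field (kb Tr)" "d \<in> Field (kb Tr)" "c \<noteq> d"
    then have "list_decode c \<in> Tr" "list_decode d \<in> Tr" by (auto simp: Field_def kb_def)
    then show "(c, d) \<in> kb Tr \<or> (d, c) \<in> kb Tr"
      using total[of "list_decode c" "list_decode d"] \<open>c \<noteq> d\<close> by (auto simp: kb_def list_decode_eq)
  qed
  moreover have "refl_on (Field (kb Tr)) (kb Tr)"
    by (auto simp: refl_on_def kb_def Field_def)
  ultimately show ?thesis
    by (simp add: order_on_defs Field_def) (auto simp: Field_def)
qed

text \<open>The Kleene--Brouwer order is a computable well-order here, hence embeds into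
  \<open>omega1_oracle X\<close>. As children precede their parents in it, the embedding already
  decreases along edges and can stand in for the rank of the tree.\<close>

lemma tree_rank:
  assumes closed: "\<And>s t. s @ t \<in> Tr \<Longrightarrow> s \<in> Tr"
    and no_path: "\<And>f. \<exists>k. map f [0..<k] \<notin> Tr"
    and dec: "dp X (\<lambda>c. list_decode c \<in> Tr)"
  obtains h where "\<And>s. s \<in> Tr \<Longrightarrow> h s < omega1_oracle X"
    "\<And>s x. s @ [x] \<in> Tr \<Longrightarrow> h (s @ [x]) < h s"
proof -
  have code: "(list_decode d, list_decode c) \<in> gt_lex \<longleftrightarrow> (\<exists>i<Suc (llen d). i < llen c \<and>
      (\<forall>j<i. lnth c j = lnth d j) \<and> (i < llen d \<longrightarrow> lnth c i < lnth d i))" for c d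
    unfolding gt_lex_index llen_def[symmetric] less_Suc_eq_le
    by (rule ex_cong1) (auto simp: lnth_def)
  have "dp X (\<lambda>z. (pfst z, psnd z) \<in> kb Tr)"
    unfolding kb_def mem_Collect_eq prod.case code
    by (intro cf_intros dp_comp[OF dec])
  moreover have "Well_order (kb Tr)"
    using closed no_path by (rule Well_order_kb)
  ultimately have "kb Tr <o cle (omega1_oracle X)"
    by (rule ordLess_omega1[rotated])
  then obtain f where wo: "Well_order (kb Tr)" and f: "embed (kb Tr) (cle (omega1_oracle X)) f"
    unfolding ordLess_def embedS_def by blast
  have refl: "s \<in> Tr \<Longrightarrow> list_encode s \<in> Field (kb Tr)" for s
    by (rule FieldI1[of _ "list_encode s"]) (simp add: kb_def)
  show ?thesis
  proof (rule that[of "f \<circ> list_encode"])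
    fix s assume "s \<in> Tr"
    then show "(f \<circ> list_encode) s < omega1_oracle X"
      using embed_in_Field[OF f refl] by simp
  next
    fix s x assume sx: "s @ [x] \<in> Tr"
    then have s: "s \<in> Tr" using closed by blast
    have "(s, s @ [x]) \<in> gt_lex" using gt_lex_simps(4)[of s "[]" "[x]"] by simp
    then have "(list_encode (s @ [x]), list_encode s) \<in> kb Tr"
      using s sx by (simp add: kb_def)
    then have "f (list_encode (s @ [x])) \<le> f (list_encode s)"
      using embed_compat[OF f] by (auto simp: compat_def cle_def)
    moreover have "f (list_encode (s @ [x])) \<noteq> f (list_encode s)"
      using inj_onD[OF embed_inj_on[OF wo f] _ refl[OF sx] refl[OF s]]
      by (metis append_self_conv list_encode_inverse not_Cons_self2)
    ultimately show "(f \<circ> list_encode) (s @ [x]) < (f \<circ> list_encode) s" by simp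
  qed
qed

subsection \<open>Substitution and soundness\<close>

lemma tvars_tsubst: "tvars (tsubst \<sigma> t) = (\<Union>i\<in>tvars t. tvars (\<sigma> i))"
  by (induction t) auto

lemma tsubst_tsubst: "tsubst \<tau> (tsubst \<sigma> t) = tsubst (\<lambda>i. tsubst \<tau> (\<sigma> i)) t"
  by (induction t) auto

lemma tsubst_cong: "(\<And>i. i \<in> tvars t \<Longrightarrow> \<sigma> i = \<tau> i) \<Longrightarrow> tsubst \<sigma> t = tsubst \<tau> t"
  by (induction t) auto

lemma tsubst_Var: "tsubst Var t = t"
  by (induction t) (auto simp: map_idI)

lemma term_of_tsubst: "term_of V t \<Longrightarrow> (\<And>i. term_of V (\<sigma> i)) \<Longrightarrow> term_of V (tsubst \<sigma> t)"
  by (induction t) (auto simp: list_all_iff)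

lemma finite_tvars: "finite (tvars t)"
  by (induction t) auto

lemma lift_simps [simp]:
  "lift \<sigma> 0 = Var 0" "lift \<sigma> (Suc i) = tsubst (\<lambda>j. Var (Suc j)) (\<sigma> i)"
  by (simp_all add: lift_def)

lemma term_of_lift: "(\<And>i. term_of V (\<sigma> i)) \<Longrightarrow> term_of V (lift \<sigma> i)"
  by (cases i) (auto intro: term_of_tsubst)

lemma subst_Disj: "subst (Disj S) \<sigma> = Disj (cimage (\<lambda>F. subst F \<sigma>) S)"
  by (simp add: cset.map_comp comp_def)

lemma subst_cong: "(\<And>i. i \<in> fv F \<Longrightarrow> \<sigma> i = \<tau> i) \<Longrightarrow> subst F \<sigma> = subst F \<tau>"
proof (induction F arbitrary: \<sigma> \<tau>)
  case (Disj S)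
  have "cimage (\<lambda>F. subst F \<sigma>) S = cimage (\<lambda>F. subst F \<tau>) S"
  proof (rule cset.map_cong[OF refl])
    fix F assume "F \<in> rcset S"
    then show "subst F \<sigma> = subst F \<tau>"
      by (rule Disj.IH) (use Disj.prems \<open>F \<in> rcset S\<close> in \<open>auto simp: cimage.rep_eq\<close>)
  qed
  then show ?case by (simp only: subst_Disj)
next
  case (Exi F)
  have "lift \<sigma> i = lift \<tau> i" if "i \<in> fv F" for i
    by (cases i) (use Exi.prems that in auto)
  then show ?case using Exi.IH[of "lift \<sigma>" "lift \<tau>"] by simp
next
  case (Neg F)
  have "subst F \<sigma> = subst F \<tau>" by (rule Neg.IH, rule Neg.prems) simp
  then show ?case by simp
qed (auto intro: tsubst_cong)

lemma subst_subst: "subst (subst F \<sigma>) \<tau> = subst F (\<lambda>i. tsubst \<tau> (\<sigma> i))"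
proof (induction F arbitrary: \<sigma> \<tau>)
  case (Disj S)
  have "cimage (\<lambda>F. subst (subst F \<sigma>) \<tau>) S = cimage (\<lambda>F. subst F (\<lambda>i. tsubst \<tau> (\<sigma> i))) S"
    by (rule cset.map_cong[OF refl]) (rule Disj.IH)
  then show ?case by (simp only: subst_Disj cset.map_comp comp_def)
next
  case (Exi F)
  have "tsubst (lift \<tau>) (lift \<sigma> i) = lift (\<lambda>i. tsubst \<tau> (\<sigma> i)) i" for i
    by (cases i) (simp_all add: tsubst_tsubst)
  then show ?case using Exi.IH by simp
qed (simp_all add: tsubst_tsubst)

lemma subst_Var: "subst F Var = F"
proof (induction F)
  case (Disj S)
  have "cimage (\<lambda>F. subst F Var) S = cimage (\<lambda>F. F) S"
    by (rule cset.map_cong[OF refl]) (rule Disj.IH)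
  then show ?case by (simp only: subst_Disj cset.map_ident)
next
  case (Exi F)
  have "lift Var = Var" by (rule ext, rename_tac i, case_tac i) auto
  then show ?case using Exi by simp
qed (simp_all add: tsubst_Var map_idI)

lemma fv_subst: "fv (subst F \<sigma>) \<subseteq> (\<Union>i\<in>fv F. tvars (\<sigma> i))"
proof (induction F arbitrary: \<sigma>)
  case (Disj S)
  then show ?case by (simp only: subst_Disj) (fastforce simp: cimage.rep_eq)
next
  case (Exi F)
  show ?case
  proof
    fix i assume "i \<in> fv (subst (Exi F) \<sigma>)"
    then obtain j where j: "j \<in> fv F" "Suc i \<in> tvars (lift \<sigma> j)" using Exi by fastforce
    then obtain k where "j = Suc k" by (cases j) auto
    with j show "i \<in> (\<Union>i\<in>fv (Exi F). tvars (\<sigma> i))" by (auto simp: tvars_tsubst)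
  qed
qed (auto simp: tvars_tsubst)

lemma symbols_ok_subst:
  "symbols_ok V F \<Longrightarrow> (\<And>i. term_of V (\<sigma> i)) \<Longrightarrow> symbols_ok V (subst F \<sigma>)"
proof (induction F arbitrary: \<sigma>)
  case (Disj S)
  then show ?case by (simp only: subst_Disj) (auto simp: cimage.rep_eq)
next
  case (Exi F)
  then show ?case by (simp add: term_of_lift)
qed (auto intro: term_of_tsubst)

lemma fml_subst: "fml V F \<Longrightarrow> (\<And>i. term_of V (\<sigma> i)) \<Longrightarrow> fml V (subst F \<sigma>)"
  unfolding fml_def using symbols_ok_subst finite_subset[OF fv_subst] finite_tvars by blast

lemma teval_tsubst: "teval M e (tsubst \<sigma> t) = teval M (\<lambda>i. teval M e (\<sigma> i)) t"
  by (induction t) (auto intro: arg_cong[of _ _ "funI M _"])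

lemma teval_cong: "(\<And>i. i \<in> tvars t \<Longrightarrow> e i = e' i) \<Longrightarrow> teval M e t = teval M e' t"
proof (induction t)
  case (Fn f ts)
  have "map (teval M e) ts = map (teval M e') ts"
    by (rule map_cong[OF refl], rule Fn.IH) (use Fn.prems in auto)
  then show ?case by (simp del: map_eq_conv)
qed simp

lemma sat_Disj: "sat M (Disj S) e \<longleftrightarrow> (\<exists>F\<in>rcset S. sat M F e)"
  by (simp add: cimage.rep_eq)

lemma sat_subst: "sat M (subst F \<sigma>) e = sat M F (\<lambda>i. teval M e (\<sigma> i))"
proof (induction F arbitrary: \<sigma> e)
  case (Disj S)
  then show ?case by (simp only: subst_Disj sat_Disj) (auto simp: cimage.rep_eq)
next
  case (Exi F)
  have "(\<lambda>i. teval M (case_nat a e) (lift \<sigma> i)) = case_nat a (\<lambda>i. teval M e (\<sigma> i))" for a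
    by (rule ext, rename_tac i, case_tac i) (auto simp: teval_tsubst)
  then show ?case using Exi by simp
qed (simp_all add: teval_tsubst comp_def)

lemma sat_cong: "(\<And>i. i \<in> fv F \<Longrightarrow> e i = e' i) \<Longrightarrow> sat M F e = sat M F e'"
proof (induction F arbitrary: e e')
  case (Rel r ts)
  have "map (teval M e) ts = map (teval M e') ts"
    by (rule map_cong[OF refl], rule teval_cong) (use Rel in auto)
  then show ?case by (simp del: map_eq_conv)
next
  case (Eq t u)
  then show ?case using teval_cong[of t e e' M] teval_cong[of u e e' M] by auto
next
  case (Neg F)
  then show ?case by (metis fv.simps(3) sat.simps(3))
next
  case (Disj S)
  have "sat M F e = sat M F e'" if "F \<in> rcset S" for F
    by (rule Disj.IH[OF that]) (use Disj.prems that in \<open>auto simp: cimage.rep_eq\<close>)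
  then show ?case unfolding sat_Disj by blast
next
  case (Exi F)
  have "sat M F (case_nat a e) = sat M F (case_nat a e')" for a
    by (rule Exi.IH) (use Exi.prems in \<open>auto split: nat.split\<close>)
  then show ?case by simp
qed

lemma sat_shift: "sat M (shift F) e = sat M F (\<lambda>i. e (Suc i))"
  by (simp add: shift_def sat_subst)

lemma sat_inst: "sat M (inst F t) e = sat M F (case_nat (teval M e t) e)"
proof -
  have "(\<lambda>i. teval M e (case i of 0 \<Rightarrow> t | Suc n \<Rightarrow> Var n)) = case_nat (teval M e t) e"
    by (rule ext) (simp split: nat.split)
  then show ?thesis by (simp add: inst_def sat_subst)
qed

lemma sat_Conj: "sat M (Conj S) e \<longleftrightarrow> (\<forall>F\<in>rcset S. sat M F e)"
  by (simp add: Conj_def cimage.rep_eq)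

lemma sat_big_conj: "countable p \<Longrightarrow> sat M (big_conj p) e \<longleftrightarrow> (\<forall>F\<in>p. sat M F e)"
  by (simp add: big_conj_def sat_Conj acset_inverse)

lemma fv_big_conj: "countable p \<Longrightarrow> fv (big_conj p) = (\<Union>F\<in>p. fv F)"
  by (simp add: big_conj_def Conj_def cimage.rep_eq acset_inverse image_image)

lemma assignments_iff: "e \<in> assignments M \<longleftrightarrow> (\<forall>i. e i \<in> univ M)"
  by (auto simp: assignments_def)

lemma assignments_case_nat [simp]:
  "case_nat a e \<in> assignments M \<longleftrightarrow> a \<in> univ M \<and> e \<in> assignments M"
  by (auto simp: assignments_iff split: nat.splits)

lemma teval_in_univ:
  "ctbl_struct V M \<Longrightarrow> e \<in> assignments M \<Longrightarrow> term_of V t \<Longrightarrow> teval M e t \<in> univ M"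
proof (induction t)
  case (Fn f ts)
  have "map (teval M e) ts \<in> lists (univ M)"
    using Fn by (auto simp: list_all_iff)
  then show ?case using Fn.prems by (auto simp: ctbl_struct_def)
qed (simp add: assignments_iff)

lemma derH_sound:
  "derH V n \<Gamma> F \<Longrightarrow> ctbl_struct V M \<Longrightarrow> e \<in> assignments M \<Longrightarrow> \<forall>G\<in>\<Gamma>. sat M G e \<Longrightarrow> sat M F e"
proof (induction arbitrary: e rule: derH.induct)
  case (NegI F n \<Gamma> G)
  then show ?case by (metis insert_iff sat.simps(3))
next
  case (Classical F n \<Gamma> G)
  then show ?case by (metis insert_iff sat.simps(3))
next
  case (DisjI S F n \<Gamma>)
  then show ?case unfolding sat_Disj by blast
next
  case (DisjE n \<Gamma> S G)
  then obtain F where "F \<in> rcset S" "sat M F e" unfolding sat_Disj by blast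
  with DisjE show ?case by (metis insert_iff)
next
  case (ExI F t n \<Gamma>)
  then have "sat M F (case_nat (teval M e t) e)" by (metis sat_inst)
  moreover have "teval M e t \<in> univ M"
    by (rule teval_in_univ[OF ExI.prems(1,2) ExI.hyps(2)])
  ultimately show ?case by auto
next
  case (ExE n \<Gamma> F G)
  from ExE.IH(1)[OF ExE.prems] obtain a where a: "a \<in> univ M" "sat M F (case_nat a e)" by auto
  have "sat M (shift G) (case_nat a e)"
    by (rule ExE.IH(2)) (use ExE.prems a in \<open>auto simp: sat_shift\<close>)
  then show ?case by (simp add: sat_shift)
next
  case (EqE F n \<Gamma> t u)
  have "teval M e t = teval M e u" using EqE.IH(1) EqE.prems by simp
  moreover have "sat M (inst F t) e" using EqE.IH(2) EqE.prems by simp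
  ultimately show ?case by (simp add: sat_inst)
qed simp_all

lemma derivable_sound:
  "derivable V \<Gamma> F \<Longrightarrow> ctbl_struct V M \<Longrightarrow> e \<in> assignments M \<Longrightarrow> \<forall>G\<in>\<Gamma>. sat M G e \<Longrightarrow> sat M F e"
  unfolding derivable_def using derH_sound by blast

lemma assignments_nonempty: "ctbl_struct V M \<Longrightarrow> \<exists>e. e \<in> assignments M"
  by (auto simp: ctbl_struct_def assignments_iff)

lemma models_thD: "models_th M S \<Longrightarrow> F \<in> S \<Longrightarrow> e \<in> assignments M \<Longrightarrow> sat M F e"
  by (simp add: models_th_def models_def)

subsection \<open>Types\<close>

text \<open>Consistency is soundness in \<open>M\<close>. For maximality, a formula of
  \<open>L\<close> missing from the set is false at \<open>e\<close>, so its negation is present and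
  excludes it.\<close>

lemma ntype_tp:
  assumes "ctbl_struct V M" "models_th M S" "e \<in> assignments M" "\<And>F. F \<in> L \<Longrightarrow> Neg F \<in> L"
  shows "ntype V L S n (tp L n M e)"
proof -
  have s: "\<forall>G\<in>S \<union> tp L n M e. sat M G e"
    using models_thD[OF assms(2) _ assms(3)] by (auto simp: tp_def)
  have "fin_consistent V (S \<union> tp L n M e)"
    unfolding fin_consistent_def using derivable_sound[OF _ assms(1,3) s] by (metis sat.simps(3))
  moreover have "q = tp L n M e" if q: "ntype_set V L S n q" "tp L n M e \<subseteq> q" for q
  proof
    show "q \<subseteq> tp L n M e"
    proof
      fix F assume F: "F \<in> q"
      show "F \<in> tp L n M e"
      proof (rule ccontr)
        assume n: "F \<notin> tp L n M e"
        have "F \<in> L" "fv F \<subseteq> {..<n}" using F q(1) by (auto simp: ntype_set_def)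
        with n assms(4) have "Neg F \<in> tp L n M e" by (simp add: tp_def)
        with q(2) have "Neg F \<in> q" by blast
        then have "derivable V (S \<union> q) F" "derivable V (S \<union> q) (Neg F)"
          using F by (auto simp: derivable_def intro: derH.Hyp)
        then show False using q(1) by (auto simp: ntype_set_def fin_consistent_def)
      qed
    qed
  qed (use q in simp)
  ultimately show ?thesis by (auto simp: ntype_def ntype_set_def tp_def)
qed

lemma ntype_eq_tp:
  assumes "ntype V L S n p" "ctbl_struct V M" "models_th M S" "e \<in> assignments M"
    "\<And>F. F \<in> L \<Longrightarrow> Neg F \<in> L" "\<forall>F\<in>p. sat M F e"
  shows "tp L n M e = p"
proof -
  have "p \<subseteq> tp L n M e"
    using assms(1,6) by (auto simp: ntype_def ntype_set_def tp_def)
  then show ?thesis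
    using assms(1) ntype_tp[OF assms(2-5)] by (simp add: ntype_def)
qed

lemma fv_Exi_funpow: "fv ((Exi ^^ k) F) = {i. i + k \<in> fv F}"
  by (induction k) auto

lemma symbols_ok_Exi_funpow: "symbols_ok V ((Exi ^^ k) F) = symbols_ok V F"
  by (induction k) auto

lemma fml_Exi_funpow: "fml V F \<Longrightarrow> fml V ((Exi ^^ k) F)"
  unfolding fml_def fv_Exi_funpow symbols_ok_Exi_funpow
  using finite_vimageI[of "fv F" "\<lambda>i. i + k"] by (auto simp: vimage_def)

text \<open>\<open>(Exi ^^ k) F\<close> under a substitution that has already used up the witnesses
  \<open>\<sigma> 0, \<dots>, \<sigma> (k - 1)\<close>.\<close>

lemma derivable_Exi_funpow:
  assumes "derH V m \<Gamma> (subst F \<sigma>)" "fml V F" "\<And>i. term_of V (\<sigma> i)"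
  shows "derH V (m + k) \<Gamma> (subst ((Exi ^^ k) F) (\<lambda>i. \<sigma> (i + k)))"
proof (induction k)
  case 0
  then show ?case using assms(1) by simp
next
  case (Suc k)
  let ?\<tau> = "\<lambda>i. \<sigma> (i + Suc k)"
  have eq: "inst (subst ((Exi ^^ k) F) (lift ?\<tau>)) (\<sigma> k) = subst ((Exi ^^ k) F) (\<lambda>i. \<sigma> (i + k))"
  proof -
    have "tsubst (case_nat (\<sigma> k) Var) (lift ?\<tau> i) = \<sigma> (i + k)" for i
      by (cases i) (simp_all add: tsubst_tsubst tsubst_Var)
    then show ?thesis by (simp add: inst_def subst_subst)
  qed
  have "fml V (subst ((Exi ^^ Suc k) F) ?\<tau>)"
    by (intro fml_subst fml_Exi_funpow assms(2,3))
  moreover have "derH V (m + k) \<Gamma> (subst ((Exi ^^ k) F) (\<lambda>i. \<sigma> (i + k)))"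
    using Suc by simp
  ultimately show ?case
    using derH.ExI[of V "subst ((Exi ^^ k) F) (lift ?\<tau>)" "\<sigma> k" "m + k" \<Gamma>] assms(3) eq by simp
qed

lemma sat_Exi_funpow:
  "e \<in> assignments M \<Longrightarrow> sat M ((Exi ^^ k) F) e \<Longrightarrow> \<exists>e'\<in>assignments M. sat M F e'"
proof (induction k arbitrary: e)
  case (Suc k)
  then obtain a where "a \<in> univ M" "sat M ((Exi ^^ k) F) (case_nat a e)" by auto
  then show ?case using Suc.IH[of "case_nat a e"] Suc.prems(1) by simp
qed auto

lemma realizes_principal:
  assumes p: "ntype V L S n p" "principal V S p"
    and L: "\<And>F. F \<in> L \<Longrightarrow> Exi F \<in> L" "\<And>F. F \<in> L \<Longrightarrow> fml V F"
    and complete: "\<And>F. F \<in> L \<Longrightarrow> sentence V F \<Longrightarrow> F \<in> S \<or> Neg F \<in> S"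
    and M: "ctbl_struct V M" "models_th M S"
  shows "realizes M p"
proof -
  obtain F where F: "F \<in> p" "\<And>G. G \<in> p \<Longrightarrow> derivable V (insert F S) G"
    using p(2) by (auto simp: principal_def)
  have FL: "F \<in> L" "fv F \<subseteq> {..<n}" and cons: "fin_consistent V (S \<union> p)"
    using p(1) F(1) by (auto simp: ntype_def ntype_set_def)
  let ?E = "(Exi ^^ n) F"
  have fvE: "fv ?E = {}" using FL(2) by (auto simp: fv_Exi_funpow)
  have "?E \<in> L" using FL(1) by (induction n) (auto intro: L(1))
  moreover have "sentence V ?E" using fvE fml_Exi_funpow[OF L(2)[OF FL(1)]] by (simp add: sentence_def)
  moreover have "Neg ?E \<notin> S"
  proof
    assume "Neg ?E \<in> S"
    then have "derivable V (S \<union> p) (Neg ?E)" by (auto simp: derivable_def intro: derH.Hyp)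
    \<comment> \<open>With \<sigma> the identity, the variables of the generator are their own
      witnesses. The remaining shift by \<open>n\<close> acts on a sentence and has no
      effect.\<close>
    moreover have "derH V (0 + n) (S \<union> p) (subst ?E (\<lambda>i. Var (i + n)))"
      by (rule derivable_Exi_funpow)
        (use F(1) L(2)[OF FL(1)] in \<open>auto simp: subst_Var intro: derH.Hyp\<close>)
    then have "derivable V (S \<union> p) ?E"
      using subst_cong[of ?E "\<lambda>i. Var (i + n)" Var] fvE by (auto simp: derivable_def subst_Var)
    ultimately show False using cons by (auto simp: fin_consistent_def)
  qed
  ultimately have E: "?E \<in> S" using complete by blast
  obtain e where "e \<in> assignments M" using assignments_nonempty[OF M(1)] by blast
  then obtain e' where e': "e' \<in> assignments M" "sat M F e'"
    using models_thD[OF M(2) E] sat_Exi_funpow by blast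
  then have "\<forall>G\<in>insert F S. sat M G e'" using models_thD[OF M(2)] by blast
  then show ?thesis
    unfolding realizes_def using derivable_sound[OF F(2) M(1) e'(1)] e'(1) by blast
qed

subsection \<open>Nodes\<close>

text \<open>The part of the closure conditions that is available at every node: \<open>node\<close>
  asserts \<open>fragment\<close> only at successor levels, whereas these conditions also hold at
  level 0 and pass to unions at limits.\<close>

definition closed_frag :: "vocab \<Rightarrow> fm set \<Rightarrow> bool" where
  "closed_frag V L \<longleftrightarrow>
     (\<forall>r ts. symbols_ok V (Rel r ts) \<longrightarrow> Rel r ts \<in> L) \<and>
     (\<forall>t u. symbols_ok V (Eq t u) \<longrightarrow> Eq t u \<in> L) \<and>
     (\<forall>F\<in>L. Neg F \<in> L \<and> Exi F \<in> L \<and> (\<forall>\<sigma>. (\<forall>i. term_of V (\<sigma> i)) \<longrightarrow> subst F \<sigma> \<in> L))"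

lemma closed_frag_gen: "closed_frag V (frag_gen V X)"
  by (auto simp: closed_frag_def intro: frag_gen.Neg frag_gen.Exi frag_gen.subst frag_gen.Rel frag_gen.Eq
      simp del: symbols_ok.simps)

lemma node_closed_frag: "node V \<phi> \<delta> L S \<Longrightarrow> closed_frag V L"
proof (induction rule: node.induct)
  case (node_limit \<delta> l s)
  then have "\<exists>\<gamma>. \<gamma> < \<delta>" using zero_cord_le[of \<delta>] unfolding limit_ord_def order_less_le by metis
  then show ?case
    using node_limit by (simp add: closed_frag_def) blast
qed (auto simp: base_frag_def next_frag_def closed_frag_gen)

lemma node_complete:
  "node V \<phi> \<delta> L S \<Longrightarrow> F \<in> L \<Longrightarrow> sentence V F \<Longrightarrow> F \<in> S \<or> Neg F \<in> S"
proof (induction arbitrary: F rule: node.induct)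
  case (node_limit \<delta> l s)
  then obtain \<gamma> where "\<gamma> < \<delta>" "F \<in> l \<gamma>" by auto
  then show ?case using node_limit.IH node_limit.prems by blast
qed (auto simp: omega_complete_def)

lemma node_sentences: "node V \<phi> \<delta> L S \<Longrightarrow> S \<subseteq> {F \<in> L. sentence V F}"
proof (induction rule: node.induct)
  case (node_limit \<delta> l s)
  then show ?case by fastforce
qed (auto simp: omega_complete_def)

lemma node_eq_Th:
  assumes "node V \<phi> \<delta> L S" "ctbl_struct V M" "models_th M S"
  shows "S = Th V L M"
proof -
  obtain e where e: "e \<in> assignments M" using assignments_nonempty[OF assms(2)] by blast
  have "F \<in> S" if "F \<in> L" "sentence V F" "models M F" for F
  proof (rule ccontr)
    assume "F \<notin> S"
    then have "Neg F \<in> S" using node_complete[OF assms(1) that(1,2)] by blast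
    then show False using that(3) e models_thD[OF assms(3) _ e] by (fastforce simp: models_def)
  qed
  then show ?thesis
    using node_sentences[OF assms(1)] assms(3) by (auto simp: Th_def models_th_def)
qed

lemma csuc_inject: "csuc \<alpha> = csuc \<beta> \<longleftrightarrow> \<alpha> = \<beta>"
  by (metis less_csuc less_csuc_iff order_antisym)

lemma csuc_neq_0: "csuc \<alpha> \<noteq> 0"
  by (metis less_csuc not_le zero_cord_le)

lemma not_limit_csuc: "\<not> limit_ord (csuc \<alpha>)"
  using less_csuc[of \<alpha>] by (auto simp: limit_ord_def)

text \<open>The model pins down how a node arose. At a successor, the two predecessor fragments
  agree by induction, and both predecessor theories are then the theory of \<open>M\<close> in that
  fragment, by \<open>node_eq_Th\<close>.\<close>

lemma node_frag_unique:
  assumes "ctbl_struct V M"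
  shows "node V \<phi> \<delta> L S \<Longrightarrow> models_th M S \<Longrightarrow> node V \<phi> \<delta> L' S' \<Longrightarrow> models_th M S' \<Longrightarrow> L = L'"
proof (induction arbitrary: L' S' rule: node.induct)
  case (node_zero S)
  from node_zero(5) show ?case
    by cases (auto simp: csuc_neq_0[symmetric] limit_ord_def dest: csuc_neq_0[THEN notE, OF sym])
next
  case (node_suc \<delta> L S S1)
  from node_suc(8) show ?case
  proof cases
    case (node_suc \<delta>' L2 S2)
    then have \<delta>': "\<delta>' = \<delta>" by (simp add: csuc_inject)
    have m: "models_th M S" "models_th M S2"
      using node_suc.prems node_suc.hyps(3) node_suc by (auto simp: models_th_def)
    have "L = L2" by (rule node_suc.IH[of L2 S2]) (use m node_suc \<delta>' in auto)
    moreover have "S = S2"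
      using node_eq_Th[OF node_suc.hyps(1) assms m(1)] node_eq_Th[OF _ assms m(2)] node_suc \<delta>' \<open>L = L2\<close>
      by metis
    ultimately show ?thesis using node_suc by simp
  qed (auto simp: csuc_neq_0 not_limit_csuc)
next
  case (node_limit \<delta> l s)
  have not: "\<delta> \<noteq> 0" "\<And>\<gamma>. \<delta> \<noteq> csuc \<gamma>"
    using node_limit.hyps(1) not_limit_csuc by (auto simp: limit_ord_def)
  from node_limit.prems(2) show ?case
  proof cases
    case (node_limit l' s')
    have "l \<gamma> = l' \<gamma>" if "\<gamma> < \<delta>" for \<gamma>
      by (rule node_limit.IH[OF that]) (use node_limit node_limit.prems that in \<open>auto simp: models_th_def\<close>)
    then show ?thesis using node_limit by simp
  qed (use not in auto)
qed

text \<open>An increasing branch says that the theory on level \<open>csuc \<gamma>\<close> contains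
  the one on level \<gamma>, but not that it was formed from it. The predecessor delivered by the
  inductive definition is identified by means of a common model.\<close>

lemma node_csucE:
  assumes "node V \<phi> (csuc \<gamma>) L' S'" "node V \<phi> \<gamma> L S" "ctbl_struct V M" "models_th M S'" "S \<subseteq> S'"
  shows "L' = next_frag V L S" "fragment V L'"
proof -
  from assms(1) have "L' = next_frag V L S \<and> fragment V L'"
  proof cases
    case (node_suc \<delta> L1 S1)
    then have n: "node V \<phi> \<gamma> L1 S1" by (simp add: csuc_inject)
    have m: "models_th M S" "models_th M S1"
      using assms(4,5) node_suc by (auto simp: models_th_def)
    have "L = L1" using node_frag_unique[OF assms(3,2) m(1) n m(2)] .
    moreover have "S = S1"
      using node_eq_Th[OF assms(2,3) m(1)] node_eq_Th[OF n assms(3) m(2)] \<open>L = L1\<close> by simp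
    ultimately show ?thesis using node_suc by simp
  qed (auto simp: csuc_neq_0 not_limit_csuc)
  then show "L' = next_frag V L S" "fragment V L'" by auto
qed

text \<open>The isolating formula is \<open>big_conj p\<close> for a non-principal type \<open>p\<close>, and a generator otherwise.\<close>

lemma tp_isolated_next:
  assumes L: "closed_frag V L" "countable L" and M: "ctbl_struct V M" "models_th M S"
    and e: "e \<in> assignments M" and n: "1 \<le> n"
  obtains F where "F \<in> next_frag V L S" "fv F \<subseteq> {..<n}" "sat M F e"
    "\<And>e'. e' \<in> assignments M \<Longrightarrow> sat M F e' \<Longrightarrow> tp L n M e' = tp L n M e"
proof -
  let ?p = "tp L n M e"
  have neg: "\<And>F. F \<in> L \<Longrightarrow> Neg F \<in> L" using L(1) by (auto simp: closed_frag_def)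
  have type: "ntype V L S n ?p" by (rule ntype_tp[OF M e neg])
  show ?thesis
  proof (cases "principal V S ?p")
    case True
    then obtain F where F: "F \<in> ?p" "\<And>G. G \<in> ?p \<Longrightarrow> derivable V (insert F S) G"
      by (auto simp: principal_def)
    show ?thesis
    proof (rule that[of F])
      show "F \<in> next_frag V L S" "fv F \<subseteq> {..<n}" "sat M F e"
        using F(1) by (auto simp: tp_def next_frag_def intro: frag_gen.gen)
    next
      fix e' assume e': "e' \<in> assignments M" "sat M F e'"
      then have "\<forall>G\<in>insert F S. sat M G e'" using models_thD[OF M(2)] by blast
      then show "tp L n M e' = ?p"
        using ntype_eq_tp[OF type M e'(1) neg] derivable_sound[OF F(2) M(1) e'(1)] by blast
    qed
  next
    case False
    have c: "countable ?p" by (rule countable_subset[OF _ L(2)]) (auto simp: tp_def)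
    show ?thesis
    proof (rule that[of "big_conj ?p"])
      show "big_conj ?p \<in> next_frag V L S"
        unfolding next_frag_def nonprincipal_types_def
        by (rule frag_gen.gen) (use type False n in blast)
      show "fv (big_conj ?p) \<subseteq> {..<n}" "sat M (big_conj ?p) e"
        by (auto simp: fv_big_conj[OF c] sat_big_conj[OF c]) (auto simp: tp_def)
    next
      fix e' assume e': "e' \<in> assignments M" "sat M (big_conj ?p) e'"
      then show "tp L n M e' = ?p"
        using ntype_eq_tp[OF type M e'(1) neg] sat_big_conj[OF c] by blast
    qed
  qed
qed

text \<open>Let \<open>F\<close> isolate the type of the extended tuple. Then \<open>Exi F\<close>
  holds at \<open>e\<close>, hence at \<open>e'\<close>, and any witness there has the right type.
  One level is spent because \<open>F\<close> is found only in the next fragment.\<close>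

lemma tp_forth:
  assumes L: "closed_frag V L" "countable L" and M: "ctbl_struct V M" "models_th M S"
    and e: "e \<in> assignments M" "e' \<in> assignments M"
    and tp: "tp (next_frag V L S) n M e = tp (next_frag V L S) n M e'"
    and c: "c \<in> univ M"
  obtains d where "d \<in> univ M" "tp L (Suc n) M (case_nat c e) = tp L (Suc n) M (case_nat d e')"
proof -
  obtain F where F: "F \<in> next_frag V L S" "fv F \<subseteq> {..<Suc n}" "sat M F (case_nat c e)"
    "\<And>e'. e' \<in> assignments M \<Longrightarrow> sat M F e' \<Longrightarrow> tp L (Suc n) M e' = tp L (Suc n) M (case_nat c e)"
    using tp_isolated_next[OF L M, of "case_nat c e" "Suc n"] c e by auto
  have "Exi F \<in> tp (next_frag V L S) n M e"
    using F(1-3) c by (auto simp: tp_def next_frag_def intro: frag_gen.Exi)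
  then have "sat M (Exi F) e'" unfolding tp by (simp add: tp_def)
  then obtain d where "d \<in> univ M" "sat M F (case_nat d e')" by auto
  then show ?thesis using F(4)[of "case_nat d e'"] e that by auto
qed

subsection \<open>Isomorphisms\<close>

definition iso_map :: "vocab \<Rightarrow> 'a fostruct \<Rightarrow> 'b fostruct \<Rightarrow> ('a \<Rightarrow> 'b) \<Rightarrow> bool" where
  "iso_map V M N h \<longleftrightarrow> bij_betw h (univ M) (univ N) \<and>
     (\<forall>r\<in>rels V. \<forall>xs\<in>lists (univ M). length xs = rar V r \<longrightarrow> relI M r xs = relI N r (map h xs)) \<and>
     (\<forall>f\<in>funs V. \<forall>xs\<in>lists (univ M). length xs = far V f \<longrightarrow> h (funI M f xs) = funI N f (map h xs))"

lemma isomorphic_iff: "isomorphic V M N \<longleftrightarrow> (\<exists>h. iso_map V M N h)"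
  by (simp add: isomorphic_def iso_map_def)

lemma iso_map_relI:
  "iso_map V M N h \<Longrightarrow> r \<in> rels V \<Longrightarrow> xs \<in> lists (univ M) \<Longrightarrow> length xs = rar V r \<Longrightarrow>
    relI M r xs = relI N r (map h xs)"
  unfolding iso_map_def by blast

lemma iso_map_funI:
  "iso_map V M N h \<Longrightarrow> f \<in> funs V \<Longrightarrow> xs \<in> lists (univ M) \<Longrightarrow> length xs = far V f \<Longrightarrow>
    h (funI M f xs) = funI N f (map h xs)"
  unfolding iso_map_def by blast

lemma iso_map_inv:
  assumes "ctbl_struct V M" "iso_map V M N h"
  shows "iso_map V N M (inv_into (univ M) h)"
proof -
  let ?g = "inv_into (univ M) h"
  have bij: "bij_betw h (univ M) (univ N)" using assms(2) by (simp add: iso_map_def)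
  have gin: "?g y \<in> univ M" and hg: "h (?g y) = y" if "y \<in> univ N" for y
    using that bij by (auto simp: bij_betw_def inv_into_into f_inv_into_f)
  have gh: "?g (h x) = x" if "x \<in> univ M" for x
    using that bij by (simp add: bij_betw_def inv_into_f_f)
  have xs: "map ?g ys \<in> lists (univ M)" "map h (map ?g ys) = ys" if "ys \<in> lists (univ N)" for ys
    using that gin hg by (auto simp: map_idI)
  show ?thesis
    unfolding iso_map_def
  proof (intro conjI ballI impI)
    show "bij_betw ?g (univ N) (univ M)" using bij by (rule bij_betw_inv_into)
  next
    fix r ys assume "r \<in> rels V" "ys \<in> lists (univ N)" "length ys = rar V r"
    then show "relI N r ys = relI M r (map ?g ys)"
      using assms(2) xs[of ys] unfolding iso_map_def by (metis length_map)
  next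
    fix f ys assume f: "f \<in> funs V" "ys \<in> lists (univ N)" "length ys = far V f"
    then have "h (funI M f (map ?g ys)) = funI N f ys"
      using assms(2) xs[of ys] unfolding iso_map_def by (metis length_map)
    moreover have "funI M f (map ?g ys) \<in> univ M"
      using assms(1) f xs[of ys] unfolding ctbl_struct_def by (metis length_map)
    ultimately show "?g (funI N f ys) = funI M f (map ?g ys)" using gh by metis
  qed
qed

lemma isomorphic_sym: "ctbl_struct V M \<Longrightarrow> isomorphic V M N \<Longrightarrow> isomorphic V N M"
  using iso_map_inv unfolding isomorphic_iff by blast

lemma isomorphic_trans:
  assumes "isomorphic V M N" "isomorphic V N K"
  shows "isomorphic V M K"
proof -
  obtain g h where g: "iso_map V M N g" and h: "iso_map V N K h"
    using assms by (auto simp: isomorphic_iff)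
  have l: "map g xs \<in> lists (univ N)" if "xs \<in> lists (univ M)" for xs
    using g that by (fastforce simp: iso_map_def bij_betw_def)
  have "iso_map V M K (h \<circ> g)"
    unfolding iso_map_def
  proof (intro conjI ballI impI)
    show "bij_betw (h \<circ> g) (univ M) (univ K)"
      using g h by (auto simp: iso_map_def intro: bij_betw_trans)
  next
    fix r xs assume "r \<in> rels V" "xs \<in> lists (univ M)" "length xs = rar V r"
    then show "relI M r xs = relI K r (map (h \<circ> g) xs)"
      using iso_map_relI[OF g] iso_map_relI[OF h _ l] by simp
  next
    fix f xs assume "f \<in> funs V" "xs \<in> lists (univ M)" "length xs = far V f"
    then show "(h \<circ> g) (funI M f xs) = funI K f (map (h \<circ> g) xs)"
      using iso_map_funI[OF g] iso_map_funI[OF h _ l] by simp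
  qed
  then show ?thesis by (auto simp: isomorphic_iff)
qed

lemma teval_iso:
  assumes "iso_map V M N h" "ctbl_struct V M" "e \<in> assignments M"
  shows "term_of V t \<Longrightarrow> h (teval M e t) = teval N (\<lambda>i. h (e i)) t"
proof (induction t)
  case (Fn f ts)
  have "map (teval M e) ts \<in> lists (univ M)"
    using Fn teval_in_univ[OF assms(2,3)] by (auto simp: list_all_iff)
  then have "h (funI M f (map (teval M e) ts)) = funI N f (map h (map (teval M e) ts))"
    using assms(1) Fn.prems unfolding iso_map_def by simp
  also have "map h (map (teval M e) ts) = map (teval N (\<lambda>i. h (e i))) ts"
    using Fn by (auto simp: list_all_iff)
  finally show ?case by simp
qed simp

lemma sat_iso:
  assumes "iso_map V M N h" "ctbl_struct V M"
  shows "symbols_ok V F \<Longrightarrow> e \<in> assignments M \<Longrightarrow> sat N F (\<lambda>i. h (e i)) = sat M F e"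
proof (induction F arbitrary: e)
  case (Rel r ts)
  have "map (teval M e) ts \<in> lists (univ M)"
    using Rel teval_in_univ[OF assms(2)] by auto
  then have "relI M r (map (teval M e) ts) = relI N r (map h (map (teval M e) ts))"
    using assms(1) Rel unfolding iso_map_def by simp
  also have "map h (map (teval M e) ts) = map (teval N (\<lambda>i. h (e i))) ts"
    using Rel teval_iso[OF assms] by auto
  finally show ?case by simp
next
  case (Eq t u)
  have "inj_on h (univ M)" using assms(1) by (simp add: iso_map_def bij_betw_def)
  then have "h (teval M e t) = h (teval M e u) \<longleftrightarrow> teval M e t = teval M e u"
    using Eq teval_in_univ[OF assms(2)] by (auto dest: inj_onD)
  then show ?case using Eq teval_iso[OF assms] by simp
next
  case (Neg F)
  then show ?case by simp
next
  case (Disj S)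
  then have "sat N F (\<lambda>i. h (e i)) = sat M F e" if "F \<in> rcset S" for F
    using that by (auto simp: cimage.rep_eq)
  then show ?case unfolding sat_Disj by blast
next
  case (Exi F)
  have img: "univ N = h ` univ M" using assms(1) by (simp add: iso_map_def bij_betw_def)
  have "case_nat (h a) (\<lambda>i. h (e i)) = (\<lambda>i. h (case_nat a e i))" for a
    by (rule ext) (simp split: nat.split)
  then have "sat N F (case_nat (h a) (\<lambda>i. h (e i))) = sat M F (case_nat a e)" if "a \<in> univ M" for a
    using Exi that by simp
  then show ?case by (simp add: img)
qed

lemma assignments_iso:
  "iso_map V M N h \<Longrightarrow> e \<in> assignments M \<Longrightarrow> (\<lambda>i. h (e i)) \<in> assignments N"
  by (auto simp: assignments_iff iso_map_def bij_betw_def)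

lemma models_th_iso:
  assumes "iso_map V M N h" "ctbl_struct V M" "\<And>F. F \<in> S \<Longrightarrow> symbols_ok V F" "models_th M S"
  shows "models_th N S"
  unfolding models_th_def models_def
proof (intro ballI)
  fix F e assume F: "F \<in> S" and e: "e \<in> assignments N"
  let ?g = "inv_into (univ M) h"
  have g: "(\<lambda>i. ?g (e i)) \<in> assignments M"
    using assignments_iso[OF iso_map_inv[OF assms(2,1)] e] .
  have "h (?g (e i)) = e i" for i
    using assms(1) e by (auto simp: assignments_iff iso_map_def bij_betw_def f_inv_into_f)
  then show "sat N F e"
    using sat_iso[OF assms(1,2) assms(3)[OF F] g] models_thD[OF assms(4) F g] by simp
qed

lemma realizes_all_types_iso:
  assumes "iso_map V M N h" "ctbl_struct V M" "\<And>F. F \<in> L \<Longrightarrow> symbols_ok V F"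
    "realizes_all_types V L S M"
  shows "realizes_all_types V L S N"
  unfolding realizes_all_types_def
proof (intro allI impI)
  fix n p assume "1 \<le> n" and p: "ntype V L S n p"
  then obtain e where e: "e \<in> assignments M" "\<forall>F\<in>p. sat M F e"
    using assms(4) unfolding realizes_all_types_def realizes_def by blast
  have "p \<subseteq> L" using p by (auto simp: ntype_def ntype_set_def)
  then have "\<forall>F\<in>p. sat N F (\<lambda>i. h (e i))" using sat_iso[OF assms(1,2) assms(3) e(1)] e(2) by blast
  then show "realizes N p" using assignments_iso[OF assms(1) e(1)] by (auto simp: realizes_def)
qed

text \<open>Transport along an enumeration gives a copy on numbers, whose diagram is computable from
  itself. Hence the \<open>LEAST\<close> in \<open>omega1_struct\<close> is over a nonempty
  set.\<close>

lemma computes_copy_exists: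
  assumes "ctbl_struct V M"
  shows "\<exists>X. computes_copy V X M"
proof -
  let ?h = "to_nat_on (univ M)" and ?g = "from_nat_into (univ M)"
  define N where "N = \<lparr>univ = ?h ` univ M, relI = \<lambda>r xs. relI M r (map ?g xs),
    funI = \<lambda>f xs. ?h (funI M f (map ?g xs))\<rparr>"
  have c: "countable (univ M)" using assms by (simp add: ctbl_struct_def)
  have gh: "?g (?h x) = x" if "x \<in> univ M" for x using that c by simp
  have gh': "map ?g (map ?h xs) = xs" if "xs \<in> lists (univ M)" for xs
    using that gh by (auto simp: map_idI)
  have iso: "iso_map V M N ?h"
    unfolding iso_map_def
  proof (intro conjI ballI impI)
    show "bij_betw ?h (univ M) (univ N)"
      using c by (simp add: N_def bij_betw_def inj_on_to_nat_on)
  next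
    fix r xs assume "xs \<in> lists (univ M)"
    then show "relI M r xs = relI N r (map ?h xs)" using gh'[of xs] by (simp add: N_def del: map_map)
  next
    fix f xs assume "xs \<in> lists (univ M)"
    then show "?h (funI M f xs) = funI N f (map ?h xs)" using gh'[of xs] by (simp add: N_def del: map_map)
  qed
  have "map ?g xs \<in> lists (univ M)" if "xs \<in> lists (univ N)" for xs
    using that gh by (fastforce simp: N_def)
  then have "ctbl_struct V N"
    using assms unfolding ctbl_struct_def by (auto simp: N_def)
  moreover have "computable_in Y Y" for Y
    unfolding computable_in_def by (blast intro: reval.intros(4))
  moreover have "isomorphic V N M"
    using iso_map_inv[OF assms iso] by (auto simp: isomorphic_iff)
  ultimately show ?thesis unfolding computes_copy_def by blast
qed

lemma omega1_struct_attained: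
  assumes "ctbl_struct V M"
  obtains X N where "ctbl_struct V N" "isomorphic V N M" "computable_in X (atomic_diagram V N)"
    "omega1_struct V M = omega1_oracle X"
proof -
  have "\<exists>X. computes_copy V X M \<and> omega1_struct V M = omega1_oracle X"
    unfolding omega1_struct_def
    by (rule LeastI_ex[where P = "\<lambda>\<alpha>. \<exists>X. computes_copy V X M \<and> \<alpha> = omega1_oracle X"])
      (use computes_copy_exists[OF assms] in blast)
  then show ?thesis using that unfolding computes_copy_def by blast
qed

subsection \<open>The tree of finite partial isomorphisms\<close>

lemma atomic_diagram_univ: "prod_encode (0, a) \<in> atomic_diagram V N \<longleftrightarrow> a \<in> univ N"
  by (auto simp: atomic_diagram_def prod_encode_eq)

lemma atomic_diagram_rel:
  "prod_encode (1, list_encode (r # xs)) \<in> atomic_diagram V N \<longleftrightarrow>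
     r \<in> rels V \<and> xs \<in> lists (univ N) \<and> length xs = rar V r \<and> relI N r xs"
  by (auto simp: atomic_diagram_def prod_encode_eq list_encode_eq simp del: list_encode.simps)

lemma atomic_diagram_fun:
  "prod_encode (2, list_encode (f # ys)) \<in> atomic_diagram V N \<longleftrightarrow>
     (\<exists>y xs. ys = y # xs \<and> f \<in> funs V \<and> xs \<in> lists (univ N) \<and> length xs = far V f \<and> y = funI N f xs)"
  by (auto simp: atomic_diagram_def prod_encode_eq list_encode_eq simp del: list_encode.simps)

lemma atomic_diagram_tag: "prod_encode (k, a) \<in> atomic_diagram V N \<Longrightarrow> k \<in> {0, 1, 2}"
  by (auto simp: atomic_diagram_def prod_encode_eq)

text \<open>A node is a list \<open>s\<close> of codes of pairs beginning with \<open>p\<close>. The move with number \<open>\<langle>0, a\<rangle>\<close> after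
  \<open>p\<close> puts \<open>a\<close> into the domain, the one with number \<open>\<langle>1, b\<rangle>\<close> puts \<open>b\<close> into the range. To keep the tree
  decidable in the diagrams, only facts with codes below the length of \<open>s\<close> are compared.\<close>

definition booked :: "nat set \<Rightarrow> nat set \<Rightarrow> nat list \<Rightarrow> nat \<Rightarrow> nat \<Rightarrow> bool" where
  "booked D D' p i x \<longleftrightarrow> prod_encode (0, pfst x) \<in> D \<and> prod_encode (0, psnd x) \<in> D' \<and>
     (i < length p \<longrightarrow> x = p ! i) \<and>
     (length p \<le> i \<and> pfst (i - length p) = 0 \<and> prod_encode (0, psnd (i - length p)) \<in> D \<longrightarrow>
        pfst x = psnd (i - length p)) \<and>
     (length p \<le> i \<and> pfst (i - length p) \<noteq> 0 \<and> prod_encode (0, psnd (i - length p)) \<in> D' \<longrightarrow>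
        psnd x = psnd (i - length p))"

text \<open>\<open>m\<close> and \<open>m'\<close> code possible facts of the same kind about the
  same symbol, with entries matched by pairs in \<open>s\<close>. Entry 0 is the symbol, so matching
  starts at \<open>j = 1\<close>; for a function symbol the value is matched like an argument. Tag
  0, membership in the universe, is left to \<open>booked\<close>.\<close>

definition corr :: "nat list \<Rightarrow> nat \<Rightarrow> nat \<Rightarrow> bool" where
  "corr s m m' \<longleftrightarrow> pfst m = pfst m' \<and> pfst m \<noteq> 0 \<and> llen (psnd m) = llen (psnd m') \<and>
     0 < llen (psnd m) \<and> lnth (psnd m) 0 = lnth (psnd m') 0 \<and>
     (\<forall>j<llen (psnd m). 0 < j \<longrightarrow>
        (\<exists>i<length s. s ! i = prod_encode (lnth (psnd m) j, lnth (psnd m') j)))"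

definition btree :: "nat set \<Rightarrow> nat set \<Rightarrow> nat list \<Rightarrow> nat list \<Rightarrow> bool" where
  "btree D D' p s \<longleftrightarrow>
     (\<forall>i<length s. booked D D' p i (s ! i)) \<and>
     (\<forall>i<length s. \<forall>j<length s. pfst (s ! i) = pfst (s ! j) \<longleftrightarrow> psnd (s ! i) = psnd (s ! j)) \<and>
     (\<forall>m<length s. \<forall>m'<length s. corr s m m' \<longrightarrow> (m \<in> D \<longleftrightarrow> m' \<in> D'))"

text \<open>\<open>corr\<close> is monotone in the list, and the bounds on positions and codes grow
  with its length, so a shorter list meets fewer demands.\<close>

lemma btree_prefix:
  assumes "btree D D' p (s @ t)"
  shows "btree D D' p s"
proof -
  have nth: "(s @ t) ! i = s ! i" if "i < length s" for i using that by (simp add: nth_append)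
  have all: "\<forall>i<length (s @ t). booked D D' p i ((s @ t) ! i)"
    "\<forall>i<length (s @ t). \<forall>j<length (s @ t).
      pfst ((s @ t) ! i) = pfst ((s @ t) ! j) \<longleftrightarrow> psnd ((s @ t) ! i) = psnd ((s @ t) ! j)"
    "\<forall>m<length (s @ t). \<forall>m'<length (s @ t). corr (s @ t) m m' \<longrightarrow> (m \<in> D \<longleftrightarrow> m' \<in> D')"
    using assms unfolding btree_def by blast+
  have "corr (s @ t) m m'" if "corr s m m'" for m m'
    using that nth unfolding corr_def by (metis length_append trans_less_add1)
  moreover have "booked D D' p i (s ! i)" if "i < length s" for i
    using all(1)[rule_format, of i] nth that by simp
  moreover have "pfst (s ! i) = pfst (s ! j) \<longleftrightarrow> psnd (s ! i) = psnd (s ! j)"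
    if "i < length s" "j < length s" for i j
    using all(2)[rule_format, of i j] nth that by simp
  ultimately show ?thesis
    unfolding btree_def using all(3) by simp
qed

lemma dp_btree:
  assumes "dp X (\<lambda>z. z \<in> D)" "dp X (\<lambda>z. z \<in> D')"
  shows "dp X (\<lambda>c. btree D D' p (list_decode c))"
proof -
  \<comment> \<open>The fixed list enters as a constant code, because \<open>lnth\<close> is already
    known to be computable in the index.\<close>
  have p: "p ! i = lnth (list_encode p) i" if "i < length p" for i
    using that by (simp add: lnth_def llen_def)
  have booked_code: "booked D D' p i x \<longleftrightarrow> prod_encode (0, pfst x) \<in> D \<and> prod_encode (0, psnd x) \<in> D' \<and>
     (i < length p \<longrightarrow> x = lnth (list_encode p) i) \<and>
     (length p \<le> i \<and> pfst (i - length p) = 0 \<and> prod_encode (0, psnd (i - length p)) \<in> D \<longrightarrow>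
        pfst x = psnd (i - length p)) \<and>
     (length p \<le> i \<and> \<not> pfst (i - length p) = 0 \<and> prod_encode (0, psnd (i - length p)) \<in> D' \<longrightarrow>
        psnd x = psnd (i - length p))" for i x
    unfolding booked_def using p by auto
  have len: "length (list_decode c) = llen c" for c by (simp add: llen_def)
  have nth: "list_decode c ! i = lnth c i" if "i < llen c" for c i using that by (simp add: lnth_def)
  have corr_code: "corr (list_decode c) m m' \<longleftrightarrow> pfst m = pfst m' \<and> \<not> pfst m = 0 \<and> llen (psnd m) = llen (psnd m') \<and>
     0 < llen (psnd m) \<and> lnth (psnd m) 0 = lnth (psnd m') 0 \<and>
     (\<forall>j<llen (psnd m). 0 < j \<longrightarrow>
        (\<exists>i<llen c. lnth c i = prod_encode (lnth (psnd m) j, lnth (psnd m') j)))" for c m m'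
    unfolding corr_def len using nth by (metis (lifting))
  have "btree D D' p (list_decode c) \<longleftrightarrow>
     (\<forall>i<llen c. booked D D' p i (lnth c i)) \<and>
     (\<forall>i<llen c. \<forall>j<llen c. pfst (lnth c i) = pfst (lnth c j) \<longleftrightarrow> psnd (lnth c i) = psnd (lnth c j)) \<and>
     (\<forall>m<llen c. \<forall>m'<llen c. corr (list_decode c) m m' \<longrightarrow> (m \<in> D \<longleftrightarrow> m' \<in> D'))" for c
    unfolding btree_def len by (simp add: nth cong: imp_cong)
  then have *: "(\<lambda>c. btree D D' p (list_decode c)) = (\<lambda>c.
     (\<forall>i<llen c. booked D D' p i (lnth c i)) \<and>
     (\<forall>i<llen c. \<forall>j<llen c. pfst (lnth c i) = pfst (lnth c j) \<longleftrightarrow> psnd (lnth c i) = psnd (lnth c j)) \<and>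
     (\<forall>m<llen c. \<forall>m'<llen c. corr (list_decode c) m m' \<longrightarrow> (m \<in> D \<longleftrightarrow> m' \<in> D')))"
    by (rule ext)
  show ?thesis
    unfolding * booked_code corr_code
    by (intro cf_intros dp_iff dp_comp[OF assms(1)] dp_comp[OF assms(2)])
qed

text \<open>Along an infinite path every move is made, so the pairs define a bijection between the
  universes, and every fact is compared once the path is longer than its codes.\<close>

lemma btree_path_iso:
  assumes M: "ctbl_struct V M"
    and path: "\<And>k. btree (atomic_diagram V M) (atomic_diagram V N) p (map f [0..<k])"
  obtains h where "iso_map V M N h" "\<And>i. i < length p \<Longrightarrow> h (pfst (p ! i)) = psnd (p ! i)"
proof -
  let ?D = "atomic_diagram V M" and ?D' = "atomic_diagram V N"
  have book: "booked ?D ?D' p i (f i)" for i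
  proof -
    have "booked ?D ?D' p i (map f [0..<Suc i] ! i)"
      using path[of "Suc i"] unfolding btree_def by (metis diff_zero length_map length_upt lessI)
    then show ?thesis by (simp del: upt_Suc)
  qed
  have inj: "pfst (f i) = pfst (f j) \<longleftrightarrow> psnd (f i) = psnd (f j)" for i j
  proof -
    let ?k = "Suc (max i j)"
    have "i < length (map f [0..<?k])" "j < length (map f [0..<?k])" by auto
    then have "pfst (map f [0..<?k] ! i) = pfst (map f [0..<?k] ! j) \<longleftrightarrow>
        psnd (map f [0..<?k] ! i) = psnd (map f [0..<?k] ! j)"
      using path[of ?k] unfolding btree_def by blast
    then show ?thesis by (simp del: upt_Suc)
  qed
  have univ: "pfst (f i) \<in> univ M" "psnd (f i) \<in> univ N" for i
    using book[of i] by (auto simp: booked_def atomic_diagram_univ)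
  have dom: "pfst (f (length p + prod_encode (0, a))) = a" if "a \<in> univ M" for a
    using book[of "length p + prod_encode (0, a)"] that by (simp add: booked_def atomic_diagram_univ)
  have ran: "psnd (f (length p + prod_encode (1, b))) = b" if "b \<in> univ N" for b
    using book[of "length p + prod_encode (1, b)"] that by (simp add: booked_def atomic_diagram_univ)
  \<comment> \<open>The position of the move that puts \<open>a\<close> into the domain.\<close>
  define ix where "ix a = length p + prod_encode (0, a)" for a
  define h where "h a = psnd (f (ix a))" for a
  have h: "h (pfst (f i)) = psnd (f i)" for i
    using inj[of "ix (pfst (f i))" i] dom[OF univ(1)[of i]] by (simp add: h_def ix_def)
  have code: "m \<in> ?D \<longleftrightarrow> m' \<in> ?D'"
    if xs: "xs \<in> lists (univ M)" and k: "k \<noteq> 0"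
      and m: "m = prod_encode (k, list_encode (r # xs))" "m' = prod_encode (k, list_encode (r # map h xs))"
    for m m' k r xs
  proof -
    \<comment> \<open>Long enough to exceed both codes and the positions of all arguments.\<close>
    let ?K = "Suc (m + m' + sum_list (map ix xs))"
    let ?s = "map f [0..<?K]"
    have "\<exists>i<length ?s. ?s ! i = prod_encode (xs ! j, map h xs ! j)" if "j < length xs" for j
    proof -
      let ?a = "xs ! j"
      have "ix ?a \<le> sum_list (map ix xs)" using that by (intro member_le_sum_list) auto
      then have "ix ?a < length ?s" by simp
      moreover have "?s ! ix ?a = f (ix ?a)" using \<open>ix ?a \<le> _\<close> by (simp del: upt_Suc)
      moreover have "f (ix ?a) = prod_encode (xs ! j, map h xs ! j)"
      proof -
        have "?a \<in> univ M" using xs nth_mem[OF that] by auto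
        then have "pfst (f (ix ?a)) = ?a" using dom by (simp add: ix_def)
        then show ?thesis using that by (metis encode_pfst_psnd h_def nth_map)
      qed
      ultimately show ?thesis by metis
    qed
    then have "corr ?s m m'"
      using k unfolding corr_def m llen_def lnth_def
      by (auto simp: nth_Cons' simp del: upt_Suc list_encode.simps)
    moreover have "m < length ?s" "m' < length ?s" by auto
    ultimately show ?thesis using path[of ?K] unfolding btree_def by blast
  qed
  have "iso_map V M N h"
    unfolding iso_map_def
  proof (intro conjI ballI impI)
    show "bij_betw h (univ M) (univ N)"
      unfolding bij_betw_def
    proof
      show "inj_on h (univ M)"
        by (rule inj_onI) (metis dom h_def inj ix_def)
      show "h ` univ M = univ N"
      proof
        show "h ` univ M \<subseteq> univ N" using univ(2) by (auto simp: h_def)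
        show "univ N \<subseteq> h ` univ M"
        proof
          fix b assume "b \<in> univ N"
          then have "b = h (pfst (f (length p + prod_encode (1, b))))" using ran h by simp
          then show "b \<in> h ` univ M" using univ(1) by blast
        qed
      qed
    qed
  next
    fix r xs assume r: "r \<in> rels V" "xs \<in> lists (univ M)" "length xs = rar V r"
    then have "map h xs \<in> lists (univ N)" using univ(2) by (auto simp: h_def)
    then show "relI M r xs = relI N r (map h xs)"
      using code[OF r(2), of 1 _ r] r by (simp only: atomic_diagram_rel) simp
  next
    fix g xs assume g: "g \<in> funs V" "xs \<in> lists (univ M)" "length xs = far V g"
    show "h (funI M g xs) = funI N g (map h xs)"
    proof -
      \<comment> \<open>The value is the first entry of a function fact, so \<open>code\<close> is
        applied to the list \<open>funI M g xs # xs\<close>, which must lie in the universe.\<close>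
      have "funI M g xs \<in> univ M" using M g by (auto simp: ctbl_struct_def)
      then show ?thesis
        using code[of "funI M g xs # xs" 2 _ g] g by (simp only: atomic_diagram_fun) auto
    qed
  qed
  moreover have "h (pfst (p ! i)) = psnd (p ! i)" if "i < length p" for i
    using h[of i] book[of i] that by (simp add: booked_def)
  ultimately show ?thesis by (rule that)
qed

text \<open>The most recently added element of a tuple is the value of the variable \<open>0\<close>.\<close>

definition asgn :: "'a \<Rightarrow> 'a list \<Rightarrow> nat \<Rightarrow> 'a" where
  "asgn u xs i = (if i < length xs then rev xs ! i else u)"

lemma asgn_snoc: "asgn u (xs @ [x]) = case_nat x (asgn u xs)"
  by (rule ext) (auto simp: asgn_def split: nat.split)

lemma asgn_in: "u \<in> univ M \<Longrightarrow> set xs \<subseteq> univ M \<Longrightarrow> asgn u xs \<in> assignments M"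
  using nth_mem[of _ "rev xs"] by (auto simp: assignments_iff asgn_def simp del: nth_mem)

lemma asgn_nth:
  assumes "i < length xs"
  shows "asgn u xs (length xs - Suc i) = xs ! i"
proof -
  have "length xs - Suc i < length xs" using assms by simp
  then show ?thesis using assms by (simp add: asgn_def rev_nth Suc_diff_Suc)
qed

text \<open>All conditions on a node other than \<open>booked\<close> compare atomic formulas, and
  \<open>L\<close> contains these. The pair at position \<open>i\<close> is the value of variable
  \<open>length s - Suc i\<close>, since later pairs get smaller indices.\<close>

lemma btree_if_tp:
  assumes L: "closed_frag V L"
    and book: "\<And>i. i < length s \<Longrightarrow> booked (atomic_diagram V M) (atomic_diagram V N) p i (s ! i)"
    and tp: "tp L (length s) M (asgn u (map pfst s)) = tp L (length s) N (asgn u' (map psnd s))"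
  shows "btree (atomic_diagram V M) (atomic_diagram V N) p s"
proof -
  let ?D = "atomic_diagram V M" and ?D' = "atomic_diagram V N" and ?n = "length s"
  let ?e = "asgn u (map pfst s)" and ?e' = "asgn u' (map psnd s)"
  have sat: "sat M F ?e = sat N F ?e'" if "F \<in> L" "fv F \<subseteq> {..<?n}" for F
    using tp that by (auto simp: tp_def)
  have e: "?e (?n - Suc i) = pfst (s ! i)" "?e' (?n - Suc i) = psnd (s ! i)" if "i < ?n" for i
    using asgn_nth[of i "map pfst s" u] asgn_nth[of i "map psnd s" u'] that by simp_all
  have eq: "pfst (s ! i) = pfst (s ! j) \<longleftrightarrow> psnd (s ! i) = psnd (s ! j)" if "i < ?n" "j < ?n" for i j
  proof -
    let ?F = "Eq (Var (?n - Suc i)) (Var (?n - Suc j))"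
    have "?F \<in> L" using L by (auto simp: closed_frag_def)
    moreover have "fv ?F \<subseteq> {..<?n}" using that by auto
    ultimately have "sat M ?F ?e = sat N ?F ?e'" by (rule sat)
    then show ?thesis using e[OF that(1)] e[OF that(2)] by simp
  qed
  have fact: "m \<in> ?D \<longleftrightarrow> m' \<in> ?D'" if corr: "corr s m m'" for m m'
  proof -
    define k where "k = pfst m"
    obtain r xs where l: "list_decode (psnd m) = r # xs"
      using corr by (cases "list_decode (psnd m)") (auto simp: corr_def llen_def)
    obtain r' ys where l': "list_decode (psnd m') = r' # ys"
      using corr by (cases "list_decode (psnd m')") (auto simp: corr_def llen_def)
    have len: "length ys = length xs" and r': "r' = r"
      using corr l l' by (auto simp: corr_def llen_def lnth_def)
    have m: "m = prod_encode (k, list_encode (r # xs))" "m' = prod_encode (k, list_encode (r # ys))"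
      using corr l l' r' unfolding corr_def k_def
      by (metis encode_pfst_psnd list_decode_inverse)+
    have "\<exists>i<?n. s ! i = prod_encode (xs ! j, ys ! j)" if "j < length xs" for j
    proof -
      have "Suc j < llen (psnd m)" using that l by (simp add: llen_def)
      then obtain i where "i < ?n" "s ! i = prod_encode (lnth (psnd m) (Suc j), lnth (psnd m') (Suc j))"
        using corr unfolding corr_def by blast
      then show ?thesis using l l' len that by (auto simp: lnth_def llen_def)
    qed
    then obtain ix where ix: "\<And>j. j < length xs \<Longrightarrow> ix j < ?n \<and> s ! ix j = prod_encode (xs ! j, ys ! j)"
      by metis
    define ts where "ts = map (\<lambda>j. Var (?n - Suc (ix j))) [0..<length xs]"
    have evals: "map (teval M ?e) ts = xs" "map (teval N ?e') ts = ys"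
      by (rule nth_equalityI; use e ix len in \<open>simp add: ts_def\<close>)+
    have terms: "\<forall>t\<in>set ts. term_of V t" "\<Union> (tvars ` set ts) \<subseteq> {..<?n}" "length ts = length xs"
      using ix by (fastforce simp: ts_def)+
    have "xs ! j \<in> univ M \<and> ys ! j \<in> univ N" if "j < length xs" for j
      using book[of "ix j"] ix[OF that] by (simp add: booked_def atomic_diagram_univ)
    then have univ: "xs \<in> lists (univ M)" "ys \<in> lists (univ N)"
      using len by (auto simp: in_set_conv_nth)
    \<comment> \<open>Tag 0 is excluded by \<open>corr\<close>; a tag above 2 occurs in neither
      diagram.\<close>
    have "k = 1 \<or> k = 2 \<or> k \<notin> {0, 1, 2}" using corr by (auto simp: k_def corr_def)
    then show ?thesis
    proof (elim disjE)
      assume k: "k = 1"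
      have "relI M r xs = relI N r ys" if "r \<in> rels V" "length xs = rar V r"
      proof -
        have "Rel r ts \<in> L" using L terms that by (auto simp: closed_frag_def)
        then show ?thesis using sat[of "Rel r ts"] terms evals by simp
      qed
      then show ?thesis unfolding m k atomic_diagram_rel using univ len by auto
    next
      assume k: "k = 2"
      show ?thesis
      \<comment> \<open>The first term denotes the value and the others the arguments, so a function
        fact becomes an atomic equation.\<close>
      proof (cases ts)
        case Nil
        then show ?thesis unfolding m k atomic_diagram_fun using evals by auto
      next
        case (Cons t us)
        have xs: "xs = teval M ?e t # map (teval M ?e) us" "ys = teval N ?e' t # map (teval N ?e') us"
          using evals Cons by auto
        let ?F = "Eq t (Fn r us)"
        have "sat M ?F ?e = sat N ?F ?e'" if "r \<in> funs V" "length us = far V r"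
        proof -
          have "?F \<in> L" using L terms that Cons by (auto simp: closed_frag_def list_all_iff)
          then show ?thesis using sat[of ?F] terms Cons by auto
        qed
        then show ?thesis unfolding m k atomic_diagram_fun using univ xs by auto
      qed
    next
      assume "k \<notin> {0, 1, 2}"
      then show ?thesis unfolding m using atomic_diagram_tag by blast
    qed
  qed
  show ?thesis unfolding btree_def using book eq fact by blast
qed

lemma tp_cong: "(\<And>i. i < n \<Longrightarrow> e i = e' i) \<Longrightarrow> tp L n M e = tp L n M e'"
proof -
  assume "\<And>i. i < n \<Longrightarrow> e i = e' i"
  then have "sat M F e = sat M F e'" if "fv F \<subseteq> {..<n}" for F
    using that by (intro sat_cong) auto
  then show ?thesis by (auto simp: tp_def)
qed

lemma tp_mono: "L \<subseteq> L' \<Longrightarrow> tp L' n M e = tp L' n N e' \<Longrightarrow> tp L n M e = tp L n N e'"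
  by (auto simp: tp_def)

lemma tp_tail:
  assumes L: "closed_frag V L" and tp: "tp L (Suc n) M e = tp L (Suc n) N e'"
  shows "tp L n M (\<lambda>i. e (Suc i)) = tp L n N (\<lambda>i. e' (Suc i))"
proof -
  have "sat M F (\<lambda>i. e (Suc i)) = sat N F (\<lambda>i. e' (Suc i))" if F: "F \<in> L" "fv F \<subseteq> {..<n}" for F
  proof -
    have "shift F \<in> L" using L F(1) by (auto simp: closed_frag_def shift_def)
    moreover have "fv (shift F) \<subseteq> {..<Suc n}"
      unfolding shift_def using fv_subst[of F "\<lambda>i. Var (Suc i)"] F(2) by auto
    ultimately have "sat M (shift F) e = sat N (shift F) e'" using tp by (auto simp: tp_def)
    then show ?thesis by (simp add: sat_shift)
  qed
  then show ?thesis by (auto simp: tp_def)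
qed

text \<open>The number prescribed by a move may lie outside the universe; then any element will do.
  So plain back-and-forth for \<open>P\<close> suffices to make each move.\<close>

lemma booked_move:
  assumes s: "length p \<le> i"
    and forw: "\<And>c. c \<in> univ M \<Longrightarrow> \<exists>d\<in>univ N. P c d"
    and backw: "\<And>d. d \<in> univ N \<Longrightarrow> \<exists>c\<in>univ M. P c d"
    and ne: "univ M \<noteq> {}" "univ N \<noteq> {}"
  obtains c d where "c \<in> univ M" "d \<in> univ N" "P c d"
    "booked (atomic_diagram V M) (atomic_diagram V N) p i (prod_encode (c, d))"
proof (cases "pfst (i - length p) = 0")
  case True
  obtain c where c: "c \<in> univ M" "psnd (i - length p) \<in> univ M \<longrightarrow> c = psnd (i - length p)"
    using ne(1) by blast
  obtain d where "d \<in> univ N" "P c d" using forw[OF c(1)] by blast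
  with c show ?thesis
    using that[of c d] s True by (auto simp: booked_def atomic_diagram_univ)
next
  case False
  obtain d where d: "d \<in> univ N" "psnd (i - length p) \<in> univ N \<longrightarrow> d = psnd (i - length p)"
    using ne(2) by blast
  obtain c where "c \<in> univ M" "P c d" using backw[OF d(1)] by blast
  with d show ?thesis
    using that[of c d] s False by (auto simp: booked_def atomic_diagram_univ)
qed

subsection \<open>Homogeneity\<close>

lemma Sacks_branch_facts:
  assumes "Sacks_branch V \<phi> L T"
  shows "node V \<phi> \<delta> (L \<delta>) (T \<delta>)" "closed_frag V (L \<delta>)" "\<gamma> \<le> \<delta> \<Longrightarrow> L \<gamma> \<subseteq> L \<delta>"
    "\<gamma> \<le> \<delta> \<Longrightarrow> T \<gamma> \<subseteq> T \<delta>" "countable (L \<delta>)" "F \<in> L \<delta> \<Longrightarrow> fml V F"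
proof -
  have node: "node V \<phi> \<delta> (L \<delta>) (T \<delta>)" for \<delta> using assms by (simp add: Sacks_branch_def)
  then show "node V \<phi> \<delta> (L \<delta>) (T \<delta>)" "closed_frag V (L \<delta>)" by (auto intro: node_closed_frag)
  have mono: "L \<gamma> \<subseteq> L \<delta>" "T \<gamma> \<subseteq> T \<delta>" if "\<gamma> \<le> \<delta>" for \<gamma> \<delta>
    using assms that unfolding Sacks_branch_def by (metis order_le_less subset_refl)+
  then show "\<gamma> \<le> \<delta> \<Longrightarrow> L \<gamma> \<subseteq> L \<delta>" "\<gamma> \<le> \<delta> \<Longrightarrow> T \<gamma> \<subseteq> T \<delta>" by auto
  \<comment> \<open>Countability and well-formedness at \<delta> are read off one level higher,
    where the successor rule asserts \<open>fragment\<close>.\<close>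
  have "fragment V (L (csuc \<delta>))"
    using node[of "csuc \<delta>"] by cases (auto simp: csuc_neq_0 not_limit_csuc)
  moreover have "L \<delta> \<subseteq> L (csuc \<delta>)" using mono(1) less_csuc by (simp add: order_less_imp_le)
  ultimately show "countable (L \<delta>)" "F \<in> L \<delta> \<Longrightarrow> fml V F"
    unfolding fragment_def by (auto intro: countable_subset)
qed

text \<open>The contradiction comes from the ranks: a node whose two tuples have the same type over
  \<open>L \<beta>\<close> has rank at least \<open>\<beta>\<close>.\<close>

lemma homogeneous:
  assumes branch: "Sacks_branch V \<phi> L T"
    and N: "ctbl_struct V N" "models_th N (T \<kappa>)"
    and X: "computable_in X (atomic_diagram V N)" "\<kappa> = omega1_oracle X" and lim: "limit_ord \<kappa>"
    and e: "e \<in> assignments N" "e' \<in> assignments N" and tp: "tp (L \<kappa>) n N e = tp (L \<kappa>) n N e'"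
  obtains h where "iso_map V N N h" "\<And>i. i < n \<Longrightarrow> h (e i) = e' i"
proof -
  let ?D = "atomic_diagram V N"
  \<comment> \<open>\<open>asgn\<close> reads a list from its end, so reversal makes
    \<open>e i\<close> the value of variable \<open>i\<close>.\<close>
  define p where "p = rev (map (\<lambda>i. prod_encode (e i, e' i)) [0..<n])"
  obtain u where u: "u \<in> univ N" using N(1) by (auto simp: ctbl_struct_def)
  define same where "same \<beta> s \<longleftrightarrow>
    tp (L \<beta>) (length s) N (asgn u (map pfst s)) = tp (L \<beta>) (length s) N (asgn u (map psnd s))" for \<beta> s
  have len_p: "length p = n" by (simp add: p_def)
  have maps: "map pfst p = rev (map e [0..<n])" "map psnd p = rev (map e' [0..<n])"
    by (simp_all add: p_def rev_map comp_def)
  have asgn_p: "tp L' n N (asgn u (map pfst p)) = tp L' n N e"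
    "tp L' n N (asgn u (map psnd p)) = tp L' n N e'" for L'
    by (rule tp_cong, simp add: asgn_def maps)+
  have same_p: "same \<beta> p" if "\<beta> \<le> \<kappa>" for \<beta>
    unfolding same_def len_p asgn_p by (rule tp_mono[OF Sacks_branch_facts(3)[OF branch that] tp])
  have p_nth: "p ! i = prod_encode (e (n - Suc i), e' (n - Suc i))" if "i < n" for i
    using that by (simp add: p_def rev_nth)
  have "booked ?D ?D p i (p ! i)" if "i < length p" for i
    using that e by (simp add: booked_def atomic_diagram_univ p_nth len_p assignments_iff)
  then have btree_p: "btree ?D ?D p p"
    using btree_if_tp[OF Sacks_branch_facts(2)[OF branch]] same_p[of \<kappa>] by (auto simp: same_def)
  \<comment> \<open>The length condition matters: before position \<open>length p\<close> the next
    pair is dictated by \<open>p\<close>, and moves begin only after it.\<close>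
  have step: "\<exists>x. btree ?D ?D p (s @ [x]) \<and> same \<gamma> (s @ [x])"
    if s: "btree ?D ?D p s" "length p \<le> length s" "same (csuc \<gamma>) s" and \<gamma>: "\<gamma> < \<kappa>" for s \<gamma>
  proof -
    let ?e = "asgn u (map pfst s)" and ?e' = "asgn u (map psnd s)"
    have suc: "csuc \<gamma> \<le> \<kappa>" using \<gamma> by (simp add: csuc_le_iff)
    then have models: "models_th N (T (csuc \<gamma>))" "models_th N (T \<gamma>)"
      using N(2) Sacks_branch_facts(4)[OF branch] \<gamma> less_csuc
      unfolding models_th_def by (meson order_less_imp_le subsetD)+
    have L_suc: "L (csuc \<gamma>) = next_frag V (L \<gamma>) (T \<gamma>)"
      by (rule node_csucE[OF Sacks_branch_facts(1)[OF branch] Sacks_branch_facts(1)[OF branch] N(1) models(1)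
            Sacks_branch_facts(4)[OF branch]]) (simp add: less_csuc order_less_imp_le)
    have book: "booked ?D ?D p i (s ! i)" if "i < length s" for i
      using s(1) that by (auto simp: btree_def)
    have asgn: "?e \<in> assignments N" "?e' \<in> assignments N"
      by (rule asgn_in[OF u]; use book in \<open>auto simp: booked_def atomic_diagram_univ in_set_conv_nth\<close>)+
    have tp_s: "tp (next_frag V (L \<gamma>) (T \<gamma>)) (length s) N ?e = tp (next_frag V (L \<gamma>) (T \<gamma>)) (length s) N ?e'"
      using s(3) by (simp add: same_def L_suc)
    let ?P = "\<lambda>c d. tp (L \<gamma>) (Suc (length s)) N (case_nat c ?e) = tp (L \<gamma>) (Suc (length s)) N (case_nat d ?e')"
    note forth = tp_forth[OF Sacks_branch_facts(2,5)[OF branch] N(1) models(2)]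
    have "\<exists>d\<in>univ N. ?P c d" if "c \<in> univ N" for c
      using forth[OF asgn tp_s that] by metis
    moreover have "\<exists>c\<in>univ N. ?P c d" if "d \<in> univ N" for d
      using forth[OF asgn(2,1) tp_s[symmetric] that] by metis
    ultimately obtain c d where cd: "c \<in> univ N" "d \<in> univ N" "?P c d"
      "booked ?D ?D p (length s) (prod_encode (c, d))"
      using booked_move[OF s(2), of N N ?P] u by blast
    let ?s = "s @ [prod_encode (c, d)]"
    have same: "same \<gamma> ?s" using cd(3) by (simp add: same_def asgn_snoc)
    have "booked ?D ?D p i (?s ! i)" if "i < length ?s" for i
      using that book cd(4) by (cases "i = length s") (auto simp: nth_append)
    then have "btree ?D ?D p ?s"
      using btree_if_tp[OF Sacks_branch_facts(2)[OF branch]] same unfolding same_def by blast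
    with same show ?thesis by blast
  qed
  have "\<exists>f. \<forall>k. btree ?D ?D p (map f [0..<k])"
  proof (rule ccontr)
    assume "\<not> ?thesis"
    then have no_path: "\<exists>k. map f [0..<k] \<notin> Collect (btree ?D ?D p)" for f by auto
    have "dp X (\<lambda>c. list_decode c \<in> Collect (btree ?D ?D p))"
      using dp_btree X(1) by (simp add: computable_in_iff)
    then obtain h where h: "\<And>s. btree ?D ?D p s \<Longrightarrow> h s < \<kappa>"
      "\<And>s x. btree ?D ?D p (s @ [x]) \<Longrightarrow> h (s @ [x]) < h s"
      using tree_rank[of "Collect (btree ?D ?D p)", OF _ no_path] btree_prefix X(2) by (metis mem_Collect_eq)
    \<comment> \<open>If \<open>h s < \<beta>\<close>, agreement over \<open>L (csuc (h s))\<close>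
      gives a child that agrees over \<open>L (h s)\<close>. By induction the child has value at
      least \<open>h s\<close>, against strict decrease.\<close>
    have rank: "\<beta> \<le> h s" if "\<beta> \<le> \<kappa>" "btree ?D ?D p s" "length p \<le> length s" "same \<beta> s" for \<beta> s
      using that
    proof (induction \<beta> arbitrary: s rule: less_induct)
      case (less \<beta>)
      show ?case
      proof (rule ccontr)
        assume "\<not> \<beta> \<le> h s"
        then have lt: "h s < \<beta>" by simp
        then have "same (csuc (h s)) s"
          using less.prems(4) tp_mono[OF Sacks_branch_facts(3)[OF branch]]
          unfolding same_def by (metis csuc_le_iff)
        then obtain x where x: "btree ?D ?D p (s @ [x])" "same (h s) (s @ [x])"
          using step less.prems lt by (meson order_less_le_trans)
        then have "h s \<le> h (s @ [x])"
          using less.IH[OF lt, of "s @ [x]"] less.prems lt by auto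
        then show False using h(2)[OF x(1)] by simp
      qed
    qed
    \<comment> \<open>The pairs in \<open>p\<close> agree at all levels up to \<kappa>, so they can
      be tested just above the value of \<open>p\<close>, a level below the limit \<kappa>.\<close>
    have "csuc (h p) < \<kappa>" using h(1)[OF btree_p] lim by (simp add: limit_ord_def)
    then have "csuc (h p) \<le> h p" using rank[OF _ btree_p] same_p by (simp add: order_less_imp_le)
    then show False by (simp add: csuc_le_iff)
  qed
  then obtain h where h: "iso_map V N N h" "\<And>i. i < length p \<Longrightarrow> h (pfst (p ! i)) = psnd (p ! i)"
    using btree_path_iso[OF N(1), of N p] by metis
  have "h (e i) = e' i" if "i < n" for i
    using h(2)[of "n - Suc i"] that by (simp add: p_nth len_p Suc_diff_Suc)
  with h(1) show ?thesis by (rule that)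
qed

text \<open>A realization in \<open>N\<close> of the type of the extended tuple need not lie over
  \<open>e'\<close>, but its tail has the type of \<open>e'\<close>. By homogeneity an automorphism
  of \<open>N\<close> carries this tail to \<open>e'\<close>; the image of the new element is the
  witness.\<close>

lemma realizes_tail:
  assumes branch: "Sacks_branch V \<phi> L T"
    and M: "ctbl_struct V M" "models_th M (T \<kappa>)"
    and N: "ctbl_struct V N" "models_th N (T \<kappa>)" "realizes_all_types V (L \<kappa>) (T \<kappa>) N"
    and X: "computable_in X (atomic_diagram V N)" "\<kappa> = omega1_oracle X" and lim: "limit_ord \<kappa>"
    and e: "e \<in> assignments M" "e' \<in> assignments N" and tp: "tp (L \<kappa>) n M e = tp (L \<kappa>) n N e'"
    and c: "c \<in> univ M"
  obtains d where "d \<in> univ N" "tp (L \<kappa>) (Suc n) M (case_nat c e) = tp (L \<kappa>) (Suc n) N (case_nat d e')"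
proof -
  note L = Sacks_branch_facts(2)[OF branch, of \<kappa>]
  then have neg: "\<And>F. F \<in> L \<kappa> \<Longrightarrow> Neg F \<in> L \<kappa>" by (auto simp: closed_frag_def)
  let ?q = "tp (L \<kappa>) (Suc n) M (case_nat c e)"
  have q: "ntype V (L \<kappa>) (T \<kappa>) (Suc n) ?q"
    by (rule ntype_tp[OF M _ neg]) (use c e in auto)
  then obtain e'' where e'': "e'' \<in> assignments N" "\<forall>F\<in>?q. sat N F e''"
    using N(3) unfolding realizes_all_types_def realizes_def by (metis le_add1 plus_1_eq_Suc)
  then have tp'': "tp (L \<kappa>) (Suc n) N e'' = ?q"
    using ntype_eq_tp[OF q N(1,2) _ neg] by blast
  have tail: "tp (L \<kappa>) n N (\<lambda>i. e'' (Suc i)) = tp (L \<kappa>) n N e'"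
    using tp_tail[OF L tp''] tp by simp
  have "(\<lambda>i. e'' (Suc i)) \<in> assignments N" using e''(1) by (simp add: assignments_iff)
  then obtain h where h: "iso_map V N N h" "\<And>i. i < n \<Longrightarrow> h (e'' (Suc i)) = e' i"
    by (rule homogeneous[OF branch N(1,2) X lim _ e(2) tail]) (rule that)
  have "tp (L \<kappa>) (Suc n) N (case_nat (h (e'' 0)) e') = tp (L \<kappa>) (Suc n) N (\<lambda>i. h (e'' i))"
    by (rule tp_cong) (use h(2) in \<open>auto split: nat.split\<close>)
  also have "\<dots> = tp (L \<kappa>) (Suc n) N e''"
    using sat_iso[OF h(1) N(1) _ e''(1)] Sacks_branch_facts(6)[OF branch] by (auto simp: tp_def fml_def)
  finally have "?q = tp (L \<kappa>) (Suc n) N (case_nat (h (e'' 0)) e')"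
    using tp'' by simp
  moreover have "h (e'' 0) \<in> univ N"
    using h(1) e''(1) by (auto simp: iso_map_def bij_betw_def assignments_iff)
  ultimately show ?thesis by (rule that[rotated])
qed

lemma realizes_all_types_unique:
  fixes M :: "'a fostruct" and M' :: "'b fostruct"
  assumes branch: "Sacks_branch V \<phi> L T" and \<kappa>: "\<kappa> \<noteq> 0"
    and M: "ctbl_struct V M" "models_th M (T \<kappa>)" "omega1_struct V M = \<kappa>"
      "realizes_all_types V (L \<kappa>) (T \<kappa>) M"
    and M': "ctbl_struct V M'" "models_th M' (T \<kappa>)" "omega1_struct V M' = \<kappa>"
      "realizes_all_types V (L \<kappa>) (T \<kappa>) M'"
  shows "isomorphic V M M'"
proof -
  have Lok: "symbols_ok V F" if "F \<in> L \<kappa>" for F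
    using Sacks_branch_facts(6)[OF branch that] by (simp add: fml_def)
  have Tok: "symbols_ok V F" if "F \<in> T \<kappa>" for F
    using node_sentences[OF Sacks_branch_facts(1)[OF branch]] that Lok by blast
  \<comment> \<open>Each copy comes with its own oracle of ordinal \<kappa>. Nothing relates
    \<open>X\<close> to \<open>X'\<close>, so homogeneity is used in each copy separately.\<close>
  obtain X N where N: "ctbl_struct V N" "isomorphic V N M" "computable_in X (atomic_diagram V N)"
    "\<kappa> = omega1_oracle X" using omega1_struct_attained[OF M(1)] M(3) by metis
  obtain X' N' where N': "ctbl_struct V N'" "isomorphic V N' M'" "computable_in X' (atomic_diagram V N')"
    "\<kappa> = omega1_oracle X'" using omega1_struct_attained[OF M'(1)] M'(3) by metis
  have lim: "limit_ord \<kappa>" using limit_omega1 N(4) \<kappa> by simp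
  obtain g where g: "iso_map V M N g"
    using isomorphic_sym[OF N(1,2)] by (auto simp: isomorphic_iff)
  obtain g' where g': "iso_map V M' N' g'"
    using isomorphic_sym[OF N'(1,2)] by (auto simp: isomorphic_iff)
  have TN: "models_th N (T \<kappa>)" "realizes_all_types V (L \<kappa>) (T \<kappa>) N"
    using models_th_iso[OF g M(1) Tok M(2)] realizes_all_types_iso[OF g M(1) Lok M(4)] by auto
  have TN': "models_th N' (T \<kappa>)" "realizes_all_types V (L \<kappa>) (T \<kappa>) N'"
    using models_th_iso[OF g' M'(1) Tok M'(2)] realizes_all_types_iso[OF g' M'(1) Lok M'(4)] by auto
  let ?D = "atomic_diagram V N" and ?D' = "atomic_diagram V N'"
  obtain u u' where u: "u \<in> univ N" "u' \<in> univ N'"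
    using N(1) N'(1) by (auto simp: ctbl_struct_def)
  define P where "P s \<longleftrightarrow> (\<forall>i<length s. booked ?D ?D' [] i (s ! i)) \<and>
    tp (L \<kappa>) (length s) N (asgn u (map pfst s)) = tp (L \<kappa>) (length s) N' (asgn u' (map psnd s))" for s
  \<comment> \<open>With no pairs only sentences are compared; \<open>T \<kappa>\<close> decides
    each of them, and both copies are models of it.\<close>
  have P0: "P []"
  proof -
    have "sat N F (asgn u []) = sat N' F (asgn u' [])" if "F \<in> L \<kappa>" "fv F = {}" for F
    proof -
      have "sentence V F" using that Sacks_branch_facts(6)[OF branch] by (simp add: sentence_def)
      then have "F \<in> T \<kappa> \<or> Neg F \<in> T \<kappa>"
        using node_complete[OF Sacks_branch_facts(1)[OF branch]] that by blast
      moreover have "asgn u [] \<in> assignments N" "asgn u' [] \<in> assignments N'"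
        using u by (simp_all add: asgn_in)
      ultimately show ?thesis
        using models_thD[OF TN(1)] models_thD[OF TN'(1)] by (metis sat.simps(3))
    qed
    then show ?thesis by (auto simp: P_def tp_def)
  qed
  have step: "\<exists>x. P (s @ [x])" if s: "P s" for s
  proof -
    let ?e = "asgn u (map pfst s)" and ?e' = "asgn u' (map psnd s)"
    have book: "booked ?D ?D' [] i (s ! i)" if "i < length s" for i
      using s that by (auto simp: P_def)
    have e: "?e \<in> assignments N"
      by (rule asgn_in[OF u(1)]) (use book in \<open>auto simp: booked_def atomic_diagram_univ in_set_conv_nth\<close>)
    have e': "?e' \<in> assignments N'"
      by (rule asgn_in[OF u(2)]) (use book in \<open>auto simp: booked_def atomic_diagram_univ in_set_conv_nth\<close>)
    have tp: "tp (L \<kappa>) (length s) N ?e = tp (L \<kappa>) (length s) N' ?e'"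
      using s by (simp add: P_def)
    let ?P = "\<lambda>c d. tp (L \<kappa>) (Suc (length s)) N (case_nat c ?e) = tp (L \<kappa>) (Suc (length s)) N' (case_nat d ?e')"
    have forw: "\<exists>d\<in>univ N'. ?P c d" if "c \<in> univ N" for c
      using realizes_tail[OF branch N(1) TN(1) N'(1) TN' N'(3,4) lim e e' tp that] by metis
    have backw: "\<exists>c\<in>univ N. ?P c d" if "d \<in> univ N'" for d
      using realizes_tail[OF branch N'(1) TN'(1) N(1) TN N(3,4) lim e' e tp[symmetric] that] by metis
    have "length [] \<le> length s" by simp
    from booked_move[of "[]", OF this forw backw] u
    obtain c d where cd: "c \<in> univ N" "d \<in> univ N'" "?P c d"
      "booked ?D ?D' [] (length s) (prod_encode (c, d))"
      by blast
    have "booked ?D ?D' [] i ((s @ [prod_encode (c, d)]) ! i)" if "i < length (s @ [prod_encode (c, d)])" for i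
      using that book cd(4) by (cases "i = length s") (auto simp: nth_append)
    then show ?thesis
      using cd(3) by (intro exI[of _ "prod_encode (c, d)"]) (simp add: P_def asgn_snoc)
  qed
  \<comment> \<open>No rank is involved in this path: agreement over the full
    \<open>L \<kappa>\<close> is preserved at each extension, so dependent choice suffices.\<close>
  obtain f where "\<And>k. P (map f [0..<k])"
    using path_exists[of P, OF P0 step] by blast
  then have "btree ?D ?D' [] (map f [0..<k])" for k
    using btree_if_tp[OF Sacks_branch_facts(2)[OF branch]] unfolding P_def by blast
  then have "isomorphic V N N'"
    using btree_path_iso[OF N(1)] by (metis isomorphic_iff)
  then show ?thesis
    using isomorphic_trans[OF isomorphic_sym[OF N(1,2)] isomorphic_trans[OF _ N'(2)]] by blast
qed

theorem mainTheorem5: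
  fixes V :: vocab and \<phi> :: fm
    and L T :: "cord \<Rightarrow> fm set" and C :: "cord set" and A B :: "cord \<Rightarrow> nat fostruct"
    and \<kappa> :: cord
  assumes "minimal_counterexample V \<phi>"
    and "countably_many_sigma_types V \<phi>"
    and "unique_uncountable_classes V \<phi>"
    and "Sacks_branch V \<phi> L T"
    and "Sacks_club V \<phi> L T C A B"
    and "\<kappa> \<in> closure_points V \<phi> \<inter> C \<inter> {qr V \<phi><..}"
  shows "(\<forall>(M :: 'a fostruct) (M' :: 'b fostruct).
            ctbl_struct V M \<and> ctbl_struct V M' \<and>
            models_th M (T \<kappa>) \<and> models_th M' (T \<kappa>) \<and>
            omega1_struct V M = \<kappa> \<and> omega1_struct V M' = \<kappa> \<and>
            realizes_all_types V (L \<kappa>) (T \<kappa>) M \<and> realizes_all_types V (L \<kappa>) (T \<kappa>) M' \<longrightarrow>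
            isomorphic V M M') \<and>
         (ctbl_struct V (B \<kappa>) \<and> models_th (B \<kappa>) (T \<kappa>) \<and> omega1_struct V (B \<kappa>) = \<kappa> \<and>
            realizes_all_types V (L \<kappa>) (T \<kappa>) (B \<kappa>)) \<and>
         (\<forall>M :: 'a fostruct.
            ctbl_struct V M \<and> models_th M (T \<kappa>) \<and> omega1_struct V M = \<kappa> \<and>
            realizes_all_types V (L \<kappa>) (T \<kappa>) M \<longrightarrow> isomorphic V M (B \<kappa>))"
proof -
  note branch = \<open>Sacks_branch V \<phi> L T\<close>
  have C: "\<kappa> \<in> C" using assms(6) by simp
  have \<kappa>: "\<kappa> \<noteq> 0"
    using assms(5) C unfolding Sacks_club_def by (metis not_le zero_cord_le)
  have B: "ctbl_struct V (B \<kappa>)" "models_th (B \<kappa>) (T \<kappa>)" "omega1_struct V (B \<kappa>) = \<kappa>"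
    and B_nonprincipal: "\<And>p. p \<in> nonprincipal_types V (L \<kappa>) (T \<kappa>) \<Longrightarrow> realizes (B \<kappa>) p"
    using assms(5) C unfolding Sacks_club_def by blast+
  have B_all: "realizes_all_types V (L \<kappa>) (T \<kappa>) (B \<kappa>)"
    unfolding realizes_all_types_def
  proof (intro allI impI)
    fix n p assume p: "1 \<le> n" "ntype V (L \<kappa>) (T \<kappa>) n p"
    show "realizes (B \<kappa>) p"
    proof (cases "principal V (T \<kappa>) p")
      case True
      show ?thesis
      proof (rule realizes_principal[OF p(2) True _ _ _ B(1,2)])
        show "\<And>F. F \<in> L \<kappa> \<Longrightarrow> Exi F \<in> L \<kappa>"
          using Sacks_branch_facts(2)[OF branch] by (auto simp: closed_frag_def)
      qed (use Sacks_branch_facts(6)[OF branch] node_complete[OF Sacks_branch_facts(1)[OF branch]] in blast)+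
    next
      case False
      then show ?thesis using B_nonprincipal p by (auto simp: nonprincipal_types_def)
    qed
  qed
  show ?thesis
  proof (intro conjI allI impI B B_all; elim conjE)
    fix M :: "'a fostruct" and M' :: "'b fostruct"
    assume "ctbl_struct V M" "models_th M (T \<kappa>)" "omega1_struct V M = \<kappa>"
      "realizes_all_types V (L \<kappa>) (T \<kappa>) M"
      "ctbl_struct V M'" "models_th M' (T \<kappa>)" "omega1_struct V M' = \<kappa>"
      "realizes_all_types V (L \<kappa>) (T \<kappa>) M'"
    then show "isomorphic V M M'" by (rule realizes_all_types_unique[OF branch \<kappa>])
  next
    fix M :: "'a fostruct"
    assume "ctbl_struct V M" "models_th M (T \<kappa>)" "omega1_struct V M = \<kappa>"
      "realizes_all_types V (L \<kappa>) (T \<kappa>) M"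
    then show "isomorphic V M (B \<kappa>)"
      using B B_all by (rule realizes_all_types_unique[OF branch \<kappa>])
  qed
qed

end
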